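(* Let $E$ be an sc-Banach space and $V$ a finite-dimensional partial quadrant. If $f:\mathcal O(V\oplus E,0)\to(E,0)$ is an $\mathrm{sc}^0$-contraction germ which is, in addition, of class $\mathrm{sc}^k$, then the solution germ $\delta:\mathcal O(V,0)\to(E,0)$ satisfying $f(v,\delta(v))=0$ is also of class $\mathrm{sc}^k$.
   Context: An sc-Banach space is a Banach space $E$ with a nested sequence of Banach spaces $E=E_0\supset E_1\supset\cdots$ such that for $m<n$ the inclusion $E_n\to E_m$ is compact and $E_\infty=\bigcap E_m$ is dense in every $E_m$; $\|\cdot\|_m$ is the norm of $E_m$. Finite-dimensional spaces carry the constant structure, direct sums the levelwise one. A finite-dimensional partial quadrant is a subset $L([0,\infty)^k\oplus\mathbb R^{n-k})$ of a finite-dimensional space $F$, $L:\mathbb R^n\to F$ a linear isomorphism. Germs of neighborhoods $\mathcal O(C,0)$ are decreasing sequences $U_0\supset U_1\supset\cdots$ with $U_m$ a relatively open neighborhood of $0$ in $C\cap E_m$. An $\mathrm{sc}^0$-germ $f:\mathcal O(C,0)\to(F,0)$ is a continuous $f:U_0\to F_0$ with $f(0)=0$, $f(U_m)\subset F_m$ and $f:U_m\to F_m$ continuous for all $m$. It is $\mathrm{sc}^1$ if for each $x\in U_1$ there is $Df(x)\in\mathcal L(E_0,F_0)$ with $\|f(x+h)-f(x)-Df(x)h\|_0/\|h\|_1\to 0$ as $\|h\|_1\to 0$, and $Tf(x,h)=(f(x),Df(x)h)$ maps $U_{m+1}\oplus E_m$ into $F_{m+1}\oplus F_m$ and is an $\mathrm{sc}^0$-germ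 into $TF$ (the sc-Banach space $F_1\oplus F_0$ with levels $F_{m+1}\oplus F_m$). Inductively $f$ is $\mathrm{sc}^k$ if it is $\mathrm{sc}^1$ and $Tf$ is $\mathrm{sc}^{k-1}$. An $\mathrm{sc}^0$-contraction germ is an $\mathrm{sc}^0$-germ $f:\mathcal O(V\oplus E,0)\to(E,0)$ of the form $f(v,u)=u-B(v,u)$ such that for every $m\ge0$ and $0<\varepsilon<1$, $\|B(v,u)-B(v,u')\|_m\le\varepsilon\|u-u'\|_m$ for $(v,u),(v,u')$ sufficiently close to $(0,0)$ in $V\oplus E_m$; it has a unique $\mathrm{sc}^0$-solution germ $\delta$. *)

theory Defs
  imports "HOL-Analysis.Analysis"
begin

definition sc_banach :: "(nat \<Rightarrow> 'e::banach set) \<Rightarrow> (nat \<Rightarrow> 'e \<Rightarrow> real) \<Rightarrow> bool" where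
  "sc_banach L N \<longleftrightarrow>
     L 0 = UNIV \<and> (\<forall>x. N 0 x = norm x) \<and>
     (\<forall>m. L (Suc m) \<subseteq> L m) \<and>
     (\<forall>m. subspace (L m)) \<and>
     (\<forall>m. \<forall>x\<in>L m. \<forall>y\<in>L m. \<forall>c::real.
         0 \<le> N m x \<and> (N m x = 0 \<longleftrightarrow> x = 0) \<and> N m (c *\<^sub>R x) = \<bar>c\<bar> * N m x \<and>
         N m (x + y) \<le> N m x + N m y) \<and>
     (\<forall>m (X::nat \<Rightarrow> 'e). (\<forall>k. X k \<in> L m) \<and> (\<forall>\<epsilon>>0. \<exists>K. \<forall>i\<ge>K. \<forall>j\<ge>K. N m (X i - X j) < \<epsilon>)
        \<longrightarrow> (\<exists>x\<in>L m. \<forall>\<epsilon>>0. \<exists>K. \<forall>i\<ge>K. N m (X i - x) < \<epsilon>)) \<and>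
     (\<forall>m n (X::nat \<Rightarrow> 'e). m < n \<and> (\<forall>k. X k \<in> L n) \<and> (\<exists>B. \<forall>k. N n (X k) \<le> B)
        \<longrightarrow> (\<exists>(r::nat \<Rightarrow> nat) x. strict_mono r \<and> x \<in> L m \<and> (\<forall>\<epsilon>>0. \<exists>K. \<forall>i\<ge>K. N m (X (r i) - x) < \<epsilon>))) \<and>
     (\<forall>m. \<forall>x\<in>L m. \<forall>\<epsilon>>0. \<exists>y\<in>(\<Inter>k. L k). N m (x - y) < \<epsilon>)"

definition partial_quadrant :: "'v::euclidean_space set \<Rightarrow> bool" where
  "partial_quadrant V \<longleftrightarrow>
     (\<exists>(T::'v \<Rightarrow> 'v) B. linear T \<and> bij T \<and> B \<subseteq> Basis \<and> V = T ` {x. \<forall>b\<in>B. 0 \<le> x \<bullet> b})"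

text \<open>Levels and norms of the direct sum V + E (V finite dimensional, constant structure).\<close>

definition sum_lev :: "(nat \<Rightarrow> 'e set) \<Rightarrow> nat \<Rightarrow> ('v \<times> 'e) set" where
  "sum_lev L m = UNIV \<times> L m"

definition sum_norm :: "(nat \<Rightarrow> 'e \<Rightarrow> real) \<Rightarrow> nat \<Rightarrow> ('v::real_normed_vector \<times> 'e) \<Rightarrow> real" where
  "sum_norm N m z = norm (fst z) + N m (snd z)"

definition const_lev :: "nat \<Rightarrow> 'v set" where
  "const_lev m = UNIV"

definition const_norm :: "nat \<Rightarrow> 'v::real_normed_vector \<Rightarrow> real" where
  "const_norm m x = norm x"

definition germ_nbhd :: "(nat \<Rightarrow> 'a::real_vector set) \<Rightarrow> (nat \<Rightarrow> 'a \<Rightarrow> real) \<Rightarrow> 'a set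
    \<Rightarrow> (nat \<Rightarrow> 'a set) \<Rightarrow> bool" where
  "germ_nbhd L N C U \<longleftrightarrow>
     (\<forall>m. U (Suc m) \<subseteq> U m) \<and>
     (\<forall>m. 0 \<in> U m \<and> U m \<subseteq> C \<inter> L m \<and>
          (\<forall>x\<in>U m. \<exists>r>0. \<forall>y\<in>C \<inter> L m. N m (y - x) < r \<longrightarrow> y \<in> U m))"

section \<open>Iterated tangent spaces, encoded as finite tuples nat => 'a\<close>

text \<open>A tuple of width n, coordinate i living at level m + s i of the base structure.
  The tangent of (n,s) is (2n, tshift n s); this encodes T(E) = E_1 + E_0 iterated.\<close>

definition tlev :: "(nat \<Rightarrow> 'a::zero set) \<Rightarrow> nat \<Rightarrow> (nat \<Rightarrow> nat) \<Rightarrow> nat \<Rightarrow> (nat \<Rightarrow> 'a) set" where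
  "tlev L n s m = {x. (\<forall>i<n. x i \<in> L (m + s i)) \<and> (\<forall>i\<ge>n. x i = 0)}"

definition tnorm :: "(nat \<Rightarrow> 'a \<Rightarrow> real) \<Rightarrow> nat \<Rightarrow> (nat \<Rightarrow> nat) \<Rightarrow> nat \<Rightarrow> (nat \<Rightarrow> 'a) \<Rightarrow> real" where
  "tnorm N n s m x = (\<Sum>i<n. N (m + s i) (x i))"

definition tshift :: "nat \<Rightarrow> (nat \<Rightarrow> nat) \<Rightarrow> nat \<Rightarrow> nat" where
  "tshift n s = (\<lambda>i. if i < n then Suc (s i) else s (i - n))"

definition tpair :: "nat \<Rightarrow> (nat \<Rightarrow> 'a) \<Rightarrow> (nat \<Rightarrow> 'a) \<Rightarrow> nat \<Rightarrow> 'a" where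
  "tpair n x h = (\<lambda>i. if i < n then x i else h (i - n))"

definition tfst :: "nat \<Rightarrow> (nat \<Rightarrow> 'a::zero) \<Rightarrow> nat \<Rightarrow> 'a" where
  "tfst n y = (\<lambda>i. if i < n then y i else 0)"

definition tsnd :: "nat \<Rightarrow> (nat \<Rightarrow> 'a::zero) \<Rightarrow> nat \<Rightarrow> 'a" where
  "tsnd n y = (\<lambda>i. if i < n then y (i + n) else 0)"

definition sc0_map ::
  "(nat \<Rightarrow> 'a::real_vector set) \<Rightarrow> (nat \<Rightarrow> 'a \<Rightarrow> real) \<Rightarrow> nat \<Rightarrow> (nat \<Rightarrow> nat) \<Rightarrow>
   (nat \<Rightarrow> 'b::real_vector set) \<Rightarrow> (nat \<Rightarrow> 'b \<Rightarrow> real) \<Rightarrow> nat \<Rightarrow> (nat \<Rightarrow> nat) \<Rightarrow>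
   (nat \<Rightarrow> (nat \<Rightarrow> 'a) set) \<Rightarrow> ((nat \<Rightarrow> 'a) \<Rightarrow> (nat \<Rightarrow> 'b)) \<Rightarrow> bool" where
  "sc0_map La Na n s Lb Nb p t W g \<longleftrightarrow>
     (\<forall>m. \<forall>x\<in>W m. g x \<in> tlev Lb p t m \<and>
        (\<forall>\<epsilon>>0. \<exists>\<delta>>0. \<forall>y\<in>W m. tnorm Na n s m (\<lambda>i. y i - x i) < \<delta> \<longrightarrow>
            tnorm Nb p t m (\<lambda>i. g y i - g x i) < \<epsilon>))"

definition sc_deriv ::
  "(nat \<Rightarrow> 'a::real_vector set) \<Rightarrow> (nat \<Rightarrow> 'a \<Rightarrow> real) \<Rightarrow> nat \<Rightarrow> (nat \<Rightarrow> nat) \<Rightarrow>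
   (nat \<Rightarrow> 'b::real_vector set) \<Rightarrow> (nat \<Rightarrow> 'b \<Rightarrow> real) \<Rightarrow> nat \<Rightarrow> (nat \<Rightarrow> nat) \<Rightarrow>
   (nat \<Rightarrow> (nat \<Rightarrow> 'a) set) \<Rightarrow> ((nat \<Rightarrow> 'a) \<Rightarrow> (nat \<Rightarrow> 'b)) \<Rightarrow>
   ((nat \<Rightarrow> 'a) \<Rightarrow> (nat \<Rightarrow> 'a) \<Rightarrow> (nat \<Rightarrow> 'b)) \<Rightarrow> bool" where
  "sc_deriv La Na n s Lb Nb p t W g D \<longleftrightarrow>
     (\<forall>x\<in>W 1.
        (\<forall>h\<in>tlev La n s 0. D x h \<in> tlev Lb p t 0) \<and>
        (\<forall>h\<in>tlev La n s 0. \<forall>h'\<in>tlev La n s 0. \<forall>c::real.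
            D x (\<lambda>i. c *\<^sub>R h i + h' i) = (\<lambda>i. c *\<^sub>R D x h i + D x h' i)) \<and>
        (\<exists>C. \<forall>h\<in>tlev La n s 0. tnorm Nb p t 0 (D x h) \<le> C * tnorm Na n s 0 h) \<and>
        (\<forall>\<epsilon>>0. \<exists>\<delta>>0. \<forall>h. (\<lambda>i. x i + h i) \<in> W 1 \<longrightarrow> tnorm Na n s 1 h < \<delta> \<longrightarrow>
            tnorm Nb p t 0 (\<lambda>i. g (\<lambda>j. x j + h j) i - g x i - D x h i)
              \<le> \<epsilon> * tnorm Na n s 1 h))"

definition tdom :: "(nat \<Rightarrow> 'a::zero set) \<Rightarrow> nat \<Rightarrow> (nat \<Rightarrow> nat) \<Rightarrow> (nat \<Rightarrow> (nat \<Rightarrow> 'a) set)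
    \<Rightarrow> nat \<Rightarrow> (nat \<Rightarrow> 'a) set" where
  "tdom La n s W = (\<lambda>m. {tpair n x h | x h. x \<in> W (Suc m) \<and> h \<in> tlev La n s m})"

definition tmap :: "nat \<Rightarrow> nat \<Rightarrow> ((nat \<Rightarrow> 'a::zero) \<Rightarrow> (nat \<Rightarrow> 'b))
    \<Rightarrow> ((nat \<Rightarrow> 'a) \<Rightarrow> (nat \<Rightarrow> 'a) \<Rightarrow> (nat \<Rightarrow> 'b)) \<Rightarrow> (nat \<Rightarrow> 'a) \<Rightarrow> nat \<Rightarrow> 'b" where
  "tmap n p g D = (\<lambda>y. tpair p (g (tfst n y)) (D (tfst n y) (tsnd n y)))"

fun sck ::
  "nat \<Rightarrow> (nat \<Rightarrow> 'a::real_vector set) \<Rightarrow> (nat \<Rightarrow> 'a \<Rightarrow> real) \<Rightarrow> nat \<Rightarrow> (nat \<Rightarrow> nat) \<Rightarrow>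
   (nat \<Rightarrow> 'b::real_vector set) \<Rightarrow> (nat \<Rightarrow> 'b \<Rightarrow> real) \<Rightarrow> nat \<Rightarrow> (nat \<Rightarrow> nat) \<Rightarrow>
   (nat \<Rightarrow> (nat \<Rightarrow> 'a) set) \<Rightarrow> ((nat \<Rightarrow> 'a) \<Rightarrow> (nat \<Rightarrow> 'b)) \<Rightarrow> bool" where
  "sck 0 La Na n s Lb Nb p t W g = sc0_map La Na n s Lb Nb p t W g"
| "sck (Suc k) La Na n s Lb Nb p t W g =
     (sc0_map La Na n s Lb Nb p t W g \<and>
      (\<exists>D. sc_deriv La Na n s Lb Nb p t W g D \<and>
           sck k La Na (2 * n) (tshift n s) Lb Nb (2 * p) (tshift p t)
               (tdom La n s W) (tmap n p g D)))"

definition lift_dom :: "(nat \<Rightarrow> 'a set) \<Rightarrow> nat \<Rightarrow> (nat \<Rightarrow> 'a::zero) set" where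
  "lift_dom U = (\<lambda>m. {x. x 0 \<in> U m \<and> (\<forall>i\<ge>Suc 0. x i = 0)})"

definition lift_map :: "('a \<Rightarrow> 'b) \<Rightarrow> (nat \<Rightarrow> 'a) \<Rightarrow> nat \<Rightarrow> 'b::zero" where
  "lift_map f = (\<lambda>x i. if i = 0 then f (x 0) else 0)"

definition sc_k_on ::
  "nat \<Rightarrow> (nat \<Rightarrow> 'a::real_vector set) \<Rightarrow> (nat \<Rightarrow> 'a \<Rightarrow> real) \<Rightarrow>
   (nat \<Rightarrow> 'b::real_vector set) \<Rightarrow> (nat \<Rightarrow> 'b \<Rightarrow> real) \<Rightarrow> (nat \<Rightarrow> 'a set) \<Rightarrow> ('a \<Rightarrow> 'b) \<Rightarrow> bool" where
  "sc_k_on k La Na Lb Nb U f =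
     sck k La Na 1 (\<lambda>_. 0) Lb Nb 1 (\<lambda>_. 0) (lift_dom U) (lift_map f)"

definition sc0_germ ::
  "(nat \<Rightarrow> 'a::real_vector set) \<Rightarrow> (nat \<Rightarrow> 'a \<Rightarrow> real) \<Rightarrow> 'a set \<Rightarrow>
   (nat \<Rightarrow> 'b::real_vector set) \<Rightarrow> (nat \<Rightarrow> 'b \<Rightarrow> real) \<Rightarrow> (nat \<Rightarrow> 'a set) \<Rightarrow> ('a \<Rightarrow> 'b) \<Rightarrow> bool" where
  "sc0_germ La Na C Lb Nb U f \<longleftrightarrow>
     germ_nbhd La Na C U \<and> f 0 = 0 \<and> sc_k_on 0 La Na Lb Nb U f"

definition sck_germ ::
  "nat \<Rightarrow> (nat \<Rightarrow> 'a::real_vector set) \<Rightarrow> (nat \<Rightarrow> 'a \<Rightarrow> real) \<Rightarrow> 'a set \<Rightarrow>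
   (nat \<Rightarrow> 'b::real_vector set) \<Rightarrow> (nat \<Rightarrow> 'b \<Rightarrow> real) \<Rightarrow> (nat \<Rightarrow> 'a set) \<Rightarrow> ('a \<Rightarrow> 'b) \<Rightarrow> bool" where
  "sck_germ k La Na C Lb Nb U f \<longleftrightarrow>
     sc0_germ La Na C Lb Nb U f \<and>
     (\<exists>U'. germ_nbhd La Na C U' \<and> (\<forall>m. U' m \<subseteq> U m) \<and> sc_k_on k La Na Lb Nb U' f)"

text \<open>sc^0-contraction germ f(v,u) = u - B(v,u) on O(V + E, 0).\<close>

definition sc0_contraction_germ ::
  "(nat \<Rightarrow> 'e::banach set) \<Rightarrow> (nat \<Rightarrow> 'e \<Rightarrow> real) \<Rightarrow> 'v::euclidean_space set \<Rightarrow>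
   (nat \<Rightarrow> ('v \<times> 'e) set) \<Rightarrow> ('v \<times> 'e \<Rightarrow> 'e) \<Rightarrow> bool" where
  "sc0_contraction_germ L N V U f \<longleftrightarrow>
     sc0_germ (sum_lev L) (sum_norm N) (V \<times> UNIV) L N U f \<and>
     (\<forall>m. \<forall>\<epsilon>. 0 < \<epsilon> \<and> \<epsilon> < 1 \<longrightarrow>
        (\<exists>r>0. \<forall>v u u'. v \<in> V \<and> u \<in> L m \<and> u' \<in> L m \<and>
            norm v < r \<and> N m u < r \<and> N m u' < r \<and> (v, u) \<in> U m \<and> (v, u') \<in> U m \<longrightarrow>
            N m ((u - f (v, u)) - (u' - f (v, u'))) \<le> \<epsilon> * N m (u - u')))"

end

theory Submission
  imports Defs
begin

text \<open>The iterated tangent maps \<open>d\<close> of \<open>\<delta>\<close> and \<open>g\<close> of \<open>f\<close> satisfy \<open>g (x, d x) = 0\<close>. The proof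
  carries along these equations a local estimate \<open>|y - y'| \<le> C |g (x, y) - g (x, y')|\<close> on every level,
  valid for arguments close to the solution one level higher. For \<open>f\<close> it is the contraction property. It
  makes \<open>d\<close> locally Lipschitz on every level, because \<open>V\<close> is finite dimensional and \<open>g\<close> is
  differentiable in the parameter with a loss of one level. By compactness of the inclusions the
  difference quotients of \<open>d\<close> then accumulate at solutions of the linearised equation, which are unique by
  the linearised estimate, so that \<open>d\<close> is \<open>sc\<^sup>1\<close>. If the tangent map of \<open>g\<close> is \<open>sc\<^sup>1\<close> as well,
  the estimate passes to it by the mean value theorem, and the argument can be repeated. As the
  parameter carries the constant structure, the levels lost on the way are recovered by shrinking
  the neighbourhoods.\<close>

section \<open>Scales of normed spaces and iterated tangent tuples\<close>

text \<open>The derivative \<open>D z h\<close> of an sc-smooth map is continuous jointly in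
  \<open>z\<close> and \<open>h\<close>, with \<open>z\<close> one level above \<open>h\<close>, but
  need not be continuous in the operator norm. Invertibility of the fibre derivative therefore
  cannot be propagated by perturbation. The estimate takes its place: it yields uniqueness and
  bounds, while existence of the tangent comes from compactness. It is stated near every point of
  the graph and not just near 0, because the tangent vectors in \<open>tdom\<close> are of arbitrary
  size. Its passage to the tangent equation rests on
  \<open>D z h - D z' h' = D z (h - h') + (D z h' - D z' h')\<close>, where the last term needs a
  Lipschitz bound in the base point, hence one more derivative of the tangent map. This is why the
  estimate is required only while derivatives remain to be taken. A tangent vector of level
  \<open>m\<close> uses the solution at level \<open>m + 2\<close>: one level is lost by the
  Lipschitz estimate and one by compactness. Difference quotients exist only in directions pointing
  into \<open>V\<close>; all other directions are differences of these.\<close>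

locale normed_scale =
  fixes La :: "nat \<Rightarrow> 'a::real_vector set" and Na :: "nat \<Rightarrow> 'a \<Rightarrow> real"
  assumes lev_Suc: "La (Suc m) \<subseteq> La m"
    and lev_subspace: "subspace (La m)"
    and N_nonneg: "x \<in> La m \<Longrightarrow> 0 \<le> Na m x"
    and N_eq_0_iff: "x \<in> La m \<Longrightarrow> Na m x = 0 \<longleftrightarrow> x = 0"
    and N_scale: "x \<in> La m \<Longrightarrow> Na m (c *\<^sub>R x) = \<bar>c\<bar> * Na m x"
    and N_triangle: "x \<in> La m \<Longrightarrow> y \<in> La m \<Longrightarrow> Na m (x + y) \<le> Na m x + Na m y"
    and N_embed_Suc: "\<exists>C. \<forall>x\<in>La (Suc m). Na m x \<le> C * Na (Suc m) x"
begin

lemma lev_mono: "m \<le> n \<Longrightarrow> La n \<subseteq> La m"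
  by (induction n rule: dec_induct) (use lev_Suc in auto)

lemma lev_0 [simp]: "0 \<in> La m"
  using lev_subspace subspace_0 by blast

lemma lev_add: "x \<in> La m \<Longrightarrow> y \<in> La m \<Longrightarrow> x + y \<in> La m"
  using lev_subspace subspace_add by blast

lemma lev_scale: "x \<in> La m \<Longrightarrow> c *\<^sub>R x \<in> La m"
  using lev_subspace subspace_scale by blast

lemma lev_diff: "x \<in> La m \<Longrightarrow> y \<in> La m \<Longrightarrow> x - y \<in> La m"
  using lev_subspace subspace_diff by blast

lemma lev_sum: "(\<And>i. i \<in> A \<Longrightarrow> f i \<in> La m) \<Longrightarrow> sum f A \<in> La m"
  using lev_subspace subspace_sum by blast

lemma N_0 [simp]: "Na m 0 = 0"
  using N_eq_0_iff by simp

lemma N_minus_commute: "x \<in> La m \<Longrightarrow> y \<in> La m \<Longrightarrow> Na m (x - y) = Na m (y - x)"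
  using N_scale[of "x - y" m "-1"] lev_diff by simp

lemma N_diff_triangle:
  assumes "x \<in> La m" "y \<in> La m" "z \<in> La m"
  shows "Na m (x - z) \<le> Na m (x - y) + Na m (y - z)"
  using N_triangle[of "x - y" m "y - z"] lev_diff assms by simp

lemma N_sum_le: "(\<And>i. i \<in> A \<Longrightarrow> f i \<in> La m) \<Longrightarrow> Na m (sum f A) \<le> (\<Sum>i\<in>A. Na m (f i))"
proof (induction A rule: infinite_finite_induct)
  case (insert a A)
  then have "Na m (f a + sum f A) \<le> Na m (f a) + Na m (sum f A)"
    by (intro N_triangle lev_sum) auto
  with insert show ?case by force
qed auto

lemma N_embed: "m \<le> n \<Longrightarrow> \<exists>C>0. \<forall>x\<in>La n. Na m x \<le> C * Na n x"
proof (induction n rule: dec_induct)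
  case base
  show ?case by (rule exI[of _ 1]) simp
next
  case (step n)
  then obtain C where C: "C > 0" "\<forall>x\<in>La n. Na m x \<le> C * Na n x" by blast
  obtain B where B: "\<forall>x\<in>La (Suc n). Na n x \<le> B * Na (Suc n) x" using N_embed_Suc by blast
  show ?case
  proof (intro exI[of _ "C * max B 1"] conjI ballI)
    fix x assume x: "x \<in> La (Suc n)"
    have "Na m x \<le> C * Na n x" using C x lev_Suc by blast
    also have "Na n x \<le> max B 1 * Na (Suc n) x"
      using B x N_nonneg[OF x] by (meson max.cobounded1 mult_right_mono order_trans)
    finally show "Na m x \<le> C * max B 1 * Na (Suc n) x" using C by (simp add: mult.assoc)
  qed (use C in auto)
qed

lemma tlev_D: "x \<in> tlev La n s m \<Longrightarrow> i < n \<Longrightarrow> x i \<in> La (m + s i)"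
  by (simp add: tlev_def)

lemma tlev_0 [simp]: "(\<lambda>i. 0) \<in> tlev La n s m"
  by (simp add: tlev_def)

lemma tlev_add: "x \<in> tlev La n s m \<Longrightarrow> y \<in> tlev La n s m \<Longrightarrow> (\<lambda>i. x i + y i) \<in> tlev La n s m"
  by (simp add: tlev_def lev_add)

lemma tlev_diff: "x \<in> tlev La n s m \<Longrightarrow> y \<in> tlev La n s m \<Longrightarrow> (\<lambda>i. x i - y i) \<in> tlev La n s m"
  by (simp add: tlev_def lev_diff)

lemma tlev_scale: "x \<in> tlev La n s m \<Longrightarrow> (\<lambda>i. c *\<^sub>R x i) \<in> tlev La n s m"
  by (simp add: tlev_def lev_scale)

lemma tlev_mono: "m \<le> m' \<Longrightarrow> tlev La n s m' \<subseteq> tlev La n s m"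
  unfolding tlev_def using lev_mono[of "m + s i" "m' + s i" for i] by auto

lemma tnorm_nonneg: "x \<in> tlev La n s m \<Longrightarrow> 0 \<le> tnorm Na n s m x"
  by (auto simp: tnorm_def tlev_def intro!: sum_nonneg N_nonneg)

lemma tnorm_comp_le: "x \<in> tlev La n s m \<Longrightarrow> i < n \<Longrightarrow> Na (m + s i) (x i) \<le> tnorm Na n s m x"
  unfolding tnorm_def
  by (rule member_le_sum) (auto simp: tlev_def intro: N_nonneg)

lemma tnorm_0 [simp]: "tnorm Na n s m (\<lambda>i. 0) = 0"
  by (simp add: tnorm_def)

lemma tnorm_eq_0_D:
  assumes "x \<in> tlev La n s m" "tnorm Na n s m x \<le> 0"
  shows "x = (\<lambda>i. 0)"
proof
  fix i
  show "x i = 0"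
  proof (cases "i < n")
    case True
    then have "Na (m + s i) (x i) \<le> 0" "x i \<in> La (m + s i)"
      using tnorm_comp_le[OF assms(1) True] assms by (auto simp: tlev_def)
    then show ?thesis using N_nonneg N_eq_0_iff by (meson order_antisym)
  qed (use assms in \<open>auto simp: tlev_def\<close>)
qed

lemma tnorm_triangle:
  assumes "x \<in> tlev La n s m" "y \<in> tlev La n s m"
  shows "tnorm Na n s m (\<lambda>i. x i + y i) \<le> tnorm Na n s m x + tnorm Na n s m y"
  unfolding tnorm_def sum.distrib[symmetric]
  by (rule sum_mono) (use assms in \<open>auto simp: tlev_def intro: N_triangle\<close>)

lemma tnorm_scale:
  "x \<in> tlev La n s m \<Longrightarrow> tnorm Na n s m (\<lambda>i. c *\<^sub>R x i) = \<bar>c\<bar> * tnorm Na n s m x"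
  by (auto simp: tnorm_def tlev_def N_scale sum_distrib_left intro!: sum.cong)

lemma tnorm_uminus: "x \<in> tlev La n s m \<Longrightarrow> tnorm Na n s m (\<lambda>i. - x i) = tnorm Na n s m x"
  using tnorm_scale[of x n s m "-1"] by simp

lemma tnorm_minus_commute:
  "x \<in> tlev La n s m \<Longrightarrow> y \<in> tlev La n s m \<Longrightarrow>
    tnorm Na n s m (\<lambda>i. x i - y i) = tnorm Na n s m (\<lambda>i. y i - x i)"
  using tnorm_uminus[OF tlev_diff, of x n s m y] by simp

lemma tnorm_diff_triangle:
  assumes "x \<in> tlev La n s m" "y \<in> tlev La n s m" "z \<in> tlev La n s m"
  shows "tnorm Na n s m (\<lambda>i. x i - z i) \<le> tnorm Na n s m (\<lambda>i. x i - y i) + tnorm Na n s m (\<lambda>i. y i - z i)"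
  using tnorm_triangle[OF tlev_diff[OF assms(1,2)] tlev_diff[OF assms(2,3)]] by simp

lemma tnorm_embed:
  assumes "m \<le> m'"
  shows "\<exists>C>0. \<forall>x\<in>tlev La n s m'. tnorm Na n s m x \<le> C * tnorm Na n s m' x"
proof -
  have "\<exists>C>0. \<forall>x\<in>La (m' + s i). Na (m + s i) x \<le> C * Na (m' + s i) x" for i
    by (rule N_embed) (use assms in simp)
  then obtain C where C: "\<And>i. C i > 0"
    "\<And>i x. x \<in> La (m' + s i) \<Longrightarrow> Na (m + s i) x \<le> C i * Na (m' + s i) x"
    by metis
  show ?thesis
  proof (intro exI[of _ "1 + sum C {..<n}"] conjI ballI)
    show "0 < 1 + sum C {..<n}" using C(1) by (simp add: add_pos_nonneg less_imp_le sum_nonneg)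
    fix x assume x: "x \<in> tlev La n s m'"
    have "tnorm Na n s m x \<le> (\<Sum>i<n. C i * Na (m' + s i) (x i))"
      unfolding tnorm_def by (rule sum_mono) (use C x in \<open>auto simp: tlev_def\<close>)
    also have "\<dots> \<le> (\<Sum>i<n. (1 + sum C {..<n}) * Na (m' + s i) (x i))"
    proof (rule sum_mono, rule mult_right_mono)
      fix i assume i: "i \<in> {..<n}"
      show "C i \<le> 1 + sum C {..<n}"
        using member_le_sum[of i "{..<n}" C] i C(1) by (force simp: less_imp_le)
      show "0 \<le> Na (m' + s i) (x i)" using i x by (auto simp: tlev_def intro: N_nonneg)
    qed
    finally show "tnorm Na n s m x \<le> (1 + sum C {..<n}) * tnorm Na n s m' x"
      by (simp add: tnorm_def sum_distrib_left)
  qed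
qed

end

section \<open>Splitting a tangent tuple into base point and tangent vector\<close>

lemma tfst_tpair [simp]: "x \<in> tlev La n s m \<Longrightarrow> tfst n (tpair n x h) = x"
  by (auto simp: tfst_def tpair_def tlev_def fun_eq_iff)

lemma tsnd_tpair [simp]: "h \<in> tlev La n s m \<Longrightarrow> tsnd n (tpair n x h) = h"
  by (auto simp: tsnd_def tpair_def tlev_def fun_eq_iff)

text \<open>This is \<open>T E = E_1 + E_0\<close> at level \<open>m\<close> in the flat encoding:
  the first half of the tuple is measured one level higher. Estimates for tangent maps are taken
  apart in this way.\<close>

lemma tnorm_tshift:
  "tnorm Na (2 * n) (tshift n s) m y
    = tnorm Na n s (Suc m) (tfst n y) + tnorm Na n s m (tsnd n y)"
proof -
  have "tnorm Na (2 * n) (tshift n s) m y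
    = (\<Sum>i\<in>{0..<n}. Na (m + tshift n s i) (y i)) + (\<Sum>i\<in>{n..<n+n}. Na (m + tshift n s i) (y i))"
    unfolding tnorm_def by (subst sum.atLeastLessThan_concat) (auto simp: atLeast0LessThan mult_2)
  also have "(\<Sum>i\<in>{0..<n}. Na (m + tshift n s i) (y i)) = tnorm Na n s (Suc m) (tfst n y)"
    by (auto simp: tnorm_def tshift_def tfst_def atLeast0LessThan intro: sum.cong)
  also have "(\<Sum>i\<in>{n..<n+n}. Na (m + tshift n s i) (y i)) = (\<Sum>i\<in>{0..<n}. Na (m + s i) (y (i + n)))"
    using sum.shift_bounds_nat_ivl[of "\<lambda>i. Na (m + tshift n s i) (y i)" 0 n n]
    by (simp add: tshift_def)
  also have "\<dots> = tnorm Na n s m (tsnd n y)"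
    by (auto simp: tnorm_def tsnd_def atLeast0LessThan intro: sum.cong)
  finally show ?thesis .
qed

text \<open>\<open>tsnd n y\<close> vanishes from \<open>n\<close> on, so the equation for
  \<open>y\<close> carries the condition that \<open>y\<close> vanishes from \<open>2 * n\<close>
  on.\<close>

lemma tlev_tshift_iff:
  "y \<in> tlev La (2 * n) (tshift n s) m \<longleftrightarrow>
    y = tpair n (tfst n y) (tsnd n y) \<and> tfst n y \<in> tlev La n s (Suc m) \<and> tsnd n y \<in> tlev La n s m"
  (is "?l \<longleftrightarrow> ?r")
proof
  assume l: ?l
  then have 1: "y i \<in> La (m + tshift n s i)" if "i < n + n" for i
    using that by (auto simp: tlev_def)
  from l have 2: "y i = 0" if "i \<ge> n + n" for i
    using that by (auto simp: tlev_def)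
  have "tsnd n y \<in> tlev La n s m"
    unfolding tlev_def tsnd_def using 1[of "i + n" for i] by (simp add: tshift_def)
  moreover have "tfst n y \<in> tlev La n s (Suc m)"
  proof -
    have "y i \<in> La (Suc (m + s i))" if "i < n" for i
      using 1[of i] that by (simp add: tshift_def)
    then show ?thesis by (simp add: tlev_def tfst_def)
  qed
  moreover have "y = tpair n (tfst n y) (tsnd n y)"
    using 2 by (auto simp: tpair_def tfst_def tsnd_def fun_eq_iff)
  ultimately show ?r by simp
next
  assume r: ?r
  then have y: "y i = tpair n (tfst n y) (tsnd n y) i" for i by metis
  have "y i \<in> La (m + tshift n s i)" if "i < 2 * n" for i
  proof (cases "i < n")
    case True
    then show ?thesis using r by (auto simp: tlev_def tfst_def tshift_def)
  next
    case False
    then have "tsnd n y (i - n) \<in> La (m + s (i - n))" using r that by (auto simp: tlev_def)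
    moreover have "i - n < n" "i - n + n = i" using False that by auto
    ultimately show ?thesis using False by (simp add: tsnd_def tshift_def)
  qed
  moreover have "y i = 0" if "i \<ge> 2 * n" for i
    using y[of i] that by (auto simp: tpair_def tsnd_def)
  ultimately show ?l by (auto simp: tlev_def)
qed

text \<open>The assumptions, at arbitrary levels, provide that \<open>x\<close> and \<open>h\<close>
  vanish from \<open>n\<close> on, so that both can be recovered from the pair.\<close>

lemma tpair_in_tlev_iff:
  assumes "x \<in> tlev La n s' m'" "h \<in> tlev La n s'' m''"
  shows "tpair n x h \<in> tlev La (2 * n) (tshift n s) m \<longleftrightarrow> x \<in> tlev La n s (Suc m) \<and> h \<in> tlev La n s m"
  using assms by (simp add: tlev_tshift_iff)

lemma tfst_minus:
  fixes x y :: "nat \<Rightarrow> 'a::group_add"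
  shows "tfst n (\<lambda>i. x i - y i) = (\<lambda>i. tfst n x i - tfst n y i)"
  by (auto simp: tfst_def)

lemma tsnd_minus:
  fixes x y :: "nat \<Rightarrow> 'a::group_add"
  shows "tsnd n (\<lambda>i. x i - y i) = (\<lambda>i. tsnd n x i - tsnd n y i)"
  by (auto simp: tsnd_def)

lemma tmap_tpair:
  "x \<in> tlev La n s m \<Longrightarrow> h \<in> tlev La n s' m' \<Longrightarrow> tmap n p g D (tpair n x h) = tpair p (g x) (D x h)"
  by (simp add: tmap_def)

text \<open>Closed form of the domains obtained from a germ of neighbourhoods by iterating
  \<open>tdom\<close>: only the base point, coordinate 0, stays restricted to the germ, and the
  other coordinates range over their whole levels. The offset \<open>c\<close> tells how much
  further down the germ the base point lies.\<close>

definition base_dom ::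
  "(nat \<Rightarrow> 'a::zero set) \<Rightarrow> (nat \<Rightarrow> 'a set) \<Rightarrow> nat \<Rightarrow> nat \<Rightarrow> (nat \<Rightarrow> nat) \<Rightarrow> nat \<Rightarrow> (nat \<Rightarrow> 'a) set" where
  "base_dom La U c n s m = {z \<in> tlev La n s m. z 0 \<in> U (m + c)}"

text \<open>The offset grows by one because \<open>tdom\<close> takes the base point from
  \<open>W (Suc m)\<close>.\<close>

lemma tdom_base_dom:
  assumes "n \<ge> 1"
  shows "tdom La n s (base_dom La U c n s) = base_dom La U (Suc c) (2 * n) (tshift n s)"
proof (rule ext, rule set_eqI, rule iffI)
  fix m y
  assume "y \<in> tdom La n s (base_dom La U c n s) m"
  then obtain x h where y: "y = tpair n x h" "x \<in> tlev La n s (Suc m)" "x 0 \<in> U (Suc m + c)" "h \<in> tlev La n s m"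
    by (auto simp: tdom_def base_dom_def)
  then show "y \<in> base_dom La U (Suc c) (2 * n) (tshift n s) m"
    using assms by (auto simp: base_dom_def tpair_in_tlev_iff) (simp add: tpair_def)
next
  fix m y
  assume y: "y \<in> base_dom La U (Suc c) (2 * n) (tshift n s) m"
  then have "y = tpair n (tfst n y) (tsnd n y)" "tfst n y \<in> tlev La n s (Suc m)" "tsnd n y \<in> tlev La n s m"
    by (auto simp: base_dom_def tlev_tshift_iff)
  moreover have "tfst n y 0 \<in> U (Suc m + c)" using y assms by (simp add: tfst_def base_dom_def)
  ultimately show "y \<in> tdom La n s (base_dom La U c n s) m"
    unfolding tdom_def base_dom_def by blast
qed

lemma lift_dom_eq_base_dom:
  "(\<And>m. U m \<subseteq> La m) \<Longrightarrow> lift_dom U = base_dom La U 0 1 (\<lambda>_. 0)"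
  by (auto simp: lift_dom_def base_dom_def tlev_def fun_eq_iff)

lemma tdom_mono: "(\<And>m. W' m \<subseteq> W m) \<Longrightarrow> tdom La n s W' m \<subseteq> tdom La n s W m"
  unfolding tdom_def by blast

lemma sc0_map_mono:
  assumes "sc0_map La Na n s Lb Nb p t W g" "\<And>m. W' m \<subseteq> W m"
  shows "sc0_map La Na n s Lb Nb p t W' g"
  using assms unfolding sc0_map_def by (meson subsetD)

lemma sc_deriv_mono:
  assumes "sc_deriv La Na n s Lb Nb p t W g D" "\<And>m. W' m \<subseteq> W m"
  shows "sc_deriv La Na n s Lb Nb p t W' g D"
proof -
  have W: "\<And>x. x \<in> W' 1 \<Longrightarrow> x \<in> W 1" using assms(2) by blast
  show ?thesis
    unfolding sc_deriv_def
  proof (intro ballI)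
    fix x assume x: "x \<in> W' 1"
    note * = assms(1)[unfolded sc_deriv_def, rule_format, OF W[OF x]]
    show "(\<forall>h\<in>tlev La n s 0. D x h \<in> tlev Lb p t 0) \<and>
        (\<forall>h\<in>tlev La n s 0. \<forall>h'\<in>tlev La n s 0. \<forall>c::real.
            D x (\<lambda>i. c *\<^sub>R h i + h' i) = (\<lambda>i. c *\<^sub>R D x h i + D x h' i)) \<and>
        (\<exists>C. \<forall>h\<in>tlev La n s 0. tnorm Nb p t 0 (D x h) \<le> C * tnorm Na n s 0 h) \<and>
        (\<forall>\<epsilon>>0. \<exists>\<delta>>0. \<forall>h. (\<lambda>i. x i + h i) \<in> W' 1 \<longrightarrow> tnorm Na n s 1 h < \<delta> \<longrightarrow>
            tnorm Nb p t 0 (\<lambda>i. g (\<lambda>j. x j + h j) i - g x i - D x h i)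
              \<le> \<epsilon> * tnorm Na n s 1 h)"
      using * W by (intro conjI) (blast, blast, blast, meson)
  qed
qed

lemma sck_mono:
  "sck k La Na n s Lb Nb p t W g \<Longrightarrow> (\<And>m. W' m \<subseteq> W m) \<Longrightarrow> sck k La Na n s Lb Nb p t W' g"
proof (induction k arbitrary: n s p t W W' g)
  case 0
  then show ?case by (auto intro: sc0_map_mono)
next
  case (Suc k)
  obtain D where D: "sc_deriv La Na n s Lb Nb p t W g D"
    "sck k La Na (2 * n) (tshift n s) Lb Nb (2 * p) (tshift p t) (tdom La n s W) (tmap n p g D)"
    and g: "sc0_map La Na n s Lb Nb p t W g"
    using Suc.prems(1) by auto
  have "sck k La Na (2 * n) (tshift n s) Lb Nb (2 * p) (tshift p t) (tdom La n s W') (tmap n p g D)"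
    by (rule Suc.IH[OF D(2)]) (rule tdom_mono[OF Suc.prems(2)])
  then show ?case
    using sc_deriv_mono[OF D(1) Suc.prems(2)] sc0_map_mono[OF g Suc.prems(2)] by auto
qed

lemma sck_imp_sc0_map: "sck k La Na n s Lb Nb p t W g \<Longrightarrow> sc0_map La Na n s Lb Nb p t W g"
  by (cases k) auto

section \<open>Mean value estimates on the levels of an sc-Banach space\<close>

locale sc_space =
  fixes L :: "nat \<Rightarrow> 'e::banach set" and N :: "nat \<Rightarrow> 'e \<Rightarrow> real"
  assumes sc_banach: "sc_banach L N"
begin

lemma N_0_eq_norm: "N 0 x = norm x"
  using sc_banach unfolding sc_banach_def by auto

lemma level_complete:
  fixes X :: "nat \<Rightarrow> 'e"
  assumes "\<And>k. X k \<in> L m" "\<And>\<epsilon>. \<epsilon> > 0 \<Longrightarrow> \<exists>K. \<forall>i\<ge>K. \<forall>j\<ge>K. N m (X i - X j) < \<epsilon>"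
  obtains x where "x \<in> L m" "\<And>\<epsilon>. \<epsilon> > 0 \<Longrightarrow> \<exists>K. \<forall>i\<ge>K. N m (X i - x) < \<epsilon>"
proof -
  have "\<forall>m (X::nat \<Rightarrow> 'e). (\<forall>k. X k \<in> L m) \<and> (\<forall>\<epsilon>>0. \<exists>K. \<forall>i\<ge>K. \<forall>j\<ge>K. N m (X i - X j) < \<epsilon>)
        \<longrightarrow> (\<exists>x\<in>L m. \<forall>\<epsilon>>0. \<exists>K. \<forall>i\<ge>K. N m (X i - x) < \<epsilon>)"
    using sc_banach unfolding sc_banach_def by (elim conjE)
  from this[rule_format, of X m] assms show ?thesis using that by blast
qed

lemma level_compact:
  fixes X :: "nat \<Rightarrow> 'e"
  assumes "m < n" "\<And>k. X k \<in> L n" "\<And>k. N n (X k) \<le> B"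
  obtains r x where "strict_mono (r :: nat \<Rightarrow> nat)" "x \<in> L m"
    "\<And>\<epsilon>. \<epsilon> > 0 \<Longrightarrow> \<exists>K. \<forall>i\<ge>K. N m (X (r i) - x) < \<epsilon>"
proof -
  have "\<forall>m n (X::nat \<Rightarrow> 'e). m < n \<and> (\<forall>k. X k \<in> L n) \<and> (\<exists>B. \<forall>k. N n (X k) \<le> B)
        \<longrightarrow> (\<exists>(r::nat \<Rightarrow> nat) x. strict_mono r \<and> x \<in> L m \<and> (\<forall>\<epsilon>>0. \<exists>K. \<forall>i\<ge>K. N m (X (r i) - x) < \<epsilon>))"
    using sc_banach unfolding sc_banach_def by (elim conjE)
  from this[rule_format, of m n X] assms show ?thesis using that by blast
qed

lemma level_dense:
  assumes "x \<in> L m" "\<epsilon> > 0"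
  shows "\<exists>y\<in>(\<Inter>k. L k). N m (x - y) < \<epsilon>"
proof -
  have "\<forall>m. \<forall>x\<in>L m. \<forall>\<epsilon>>0. \<exists>y\<in>(\<Inter>k. L k). N m (x - y) < \<epsilon>"
    using sc_banach unfolding sc_banach_def by (elim conjE)
  with assms show ?thesis by blast
qed

sublocale normed_scale L N
proof
  have sub: "L (Suc m) \<subseteq> L m" "subspace (L m)" for m
    using sc_banach unfolding sc_banach_def by auto
  have "\<forall>m. \<forall>x\<in>L m. \<forall>y\<in>L m. \<forall>c::real.
         0 \<le> N m x \<and> (N m x = 0 \<longleftrightarrow> x = 0) \<and> N m (c *\<^sub>R x) = \<bar>c\<bar> * N m x \<and>
         N m (x + y) \<le> N m x + N m y"
    using sc_banach unfolding sc_banach_def by (elim conjE)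
  then have 1: "x \<in> L m \<Longrightarrow> 0 \<le> N m x" "x \<in> L m \<Longrightarrow> N m x = 0 \<longleftrightarrow> x = 0"
    and 2: "x \<in> L m \<Longrightarrow> N m (c *\<^sub>R x) = \<bar>c\<bar> * N m x"
    and 3: "x \<in> L m \<Longrightarrow> y \<in> L m \<Longrightarrow> N m (x + y) \<le> N m x + N m y" for m x y c
    by blast+
  fix m x y and c :: real
  show "L (Suc m) \<subseteq> L m" "subspace (L m)" by (rule sub)+
  show "x \<in> L m \<Longrightarrow> 0 \<le> N m x" "x \<in> L m \<Longrightarrow> N m x = 0 \<longleftrightarrow> x = 0" by (rule 1; assumption)+
  show "x \<in> L m \<Longrightarrow> N m (c *\<^sub>R x) = \<bar>c\<bar> * N m x" by (rule 2)
  show "x \<in> L m \<Longrightarrow> y \<in> L m \<Longrightarrow> N m (x + y) \<le> N m x + N m y" by (rule 3)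
  show "\<exists>C. \<forall>x\<in>L (Suc m). N m x \<le> C * N (Suc m) x"
  \<comment> \<open>A failing bound gives vectors of \<open>N (Suc m)\<close>-norm one with
    unbounded \<open>N m\<close>-norm, and compactness of the inclusion excludes this.\<close>
  proof (rule ccontr)
    assume "\<nexists>C. \<forall>x\<in>L (Suc m). N m x \<le> C * N (Suc m) x"
    then have "\<forall>k. \<exists>x\<in>L (Suc m). real k * N (Suc m) x < N m x"
      by (meson not_le)
    then obtain X where X: "\<And>k. X k \<in> L (Suc m)" "\<And>k. real k * N (Suc m) (X k) < N m (X k)"
      by metis
    define Y where "Y k = (1 / N (Suc m) (X k)) *\<^sub>R X k" for k
    have pos: "N (Suc m) (X k) > 0" for k
    proof -
      have "X k \<noteq> 0"
      proof
        assume "X k = 0"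
        then show False using X(2)[of k] 1(2)[OF X(1), of k] 1(2)[of 0 m] subspace_0[OF sub(2)]
          by simp
      qed
      then show ?thesis using 1[OF X(1), of k] by simp
    qed
    have Y: "Y k \<in> L (Suc m)" for k
      unfolding Y_def using X(1) sub(2) subspace_scale by blast
    have "N (Suc m) (Y k) \<le> 1" for k
      unfolding Y_def using 2[OF X(1)] pos[of k] by simp
    with Y obtain r x where r: "strict_mono (r :: nat \<Rightarrow> nat)" and x: "x \<in> L m"
      and lim: "\<And>\<epsilon>. \<epsilon> > 0 \<Longrightarrow> \<exists>K. \<forall>i\<ge>K. N m (Y (r i) - x) < \<epsilon>"
      using level_compact[of m "Suc m" Y 1] by blast
    obtain K where K: "\<And>i. i \<ge> K \<Longrightarrow> N m (Y (r i) - x) < 1" using lim[of 1] by auto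
    \<comment> \<open>Two bounds collide at this index: \<open>N m (Y (r i)) < 1 + N m x\<close> by
      convergence, and \<open>N m (Y (r i)) > r i \<ge> i \<ge> N m x + 1\<close> by the choice of
      \<open>X\<close>.\<close>
    define i where "i = max K (nat \<lceil>N m x + 1\<rceil>)"
    have Yi: "Y (r i) \<in> L m" using Y sub(1) by blast
    have "N m (Y (r i)) = N m (X (r i)) / N (Suc m) (X (r i))"
      unfolding Y_def using 2[OF subsetD[OF sub(1) X(1)], of "1 / N (Suc m) (X (r i))" "r i"] pos[of "r i"] by simp
    then have "real (r i) < N m (Y (r i))"
      using X(2)[of "r i"] pos[of "r i"] by (simp add: pos_less_divide_eq)
    then have "real i < N m (Y (r i))" using seq_suble[OF r, of i] by linarith
    also have "\<dots> \<le> N m (Y (r i) - x) + N m x"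
      using 3[of "Y (r i) - x" m x] subspace_diff[OF sub(2) Yi x] x by simp
    also have "\<dots> < 1 + N m x" using K[of i] by (simp add: i_def)
    finally have "real i < N m x + 1" by simp
    moreover have "N m x + 1 \<le> real i" unfolding i_def by linarith
    ultimately show False by simp
  qed
qed

section \<open>Riemann sums and the mean value inequality at a fixed level\<close>

lemma norm_le_level:
  obtains C where "C > 0" "\<And>x. x \<in> L m \<Longrightarrow> norm x \<le> C * N m x"
  using N_embed[of 0 m] N_0_eq_norm by auto

text \<open>Left endpoint sums with \<open>k\<close> equal steps. They stand in for an integral with
  values in \<open>L m\<close>, whose norm \<open>N m\<close> is not the norm of the type.\<close>

definition riemann_sum :: "(real \<Rightarrow> 'e) \<Rightarrow> nat \<Rightarrow> 'e" where
  "riemann_sum \<phi> k = (\<Sum>i<k. (1 / real k) *\<^sub>R \<phi> (real i / real k))"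

lemma riemann_sum_in_level:
  assumes "\<And>t. t \<in> {0..1} \<Longrightarrow> \<phi> t \<in> L m" "k \<ge> 1"
  shows "riemann_sum \<phi> k \<in> L m"
  unfolding riemann_sum_def using assms by (intro lev_sum lev_scale) auto

text \<open>The weights \<open>1 / k\<close> add up to one, so the sum is an average of points at
  distance at most \<open>K\<close> from \<open>c\<close>.\<close>

lemma riemann_sum_dist_const:
  assumes "\<And>t. t \<in> {0..1} \<Longrightarrow> \<phi> t \<in> L m" "k \<ge> 1" "c \<in> L m"
    and "\<And>t. t \<in> {0..1} \<Longrightarrow> N m (\<phi> t - c) \<le> K"
  shows "N m (riemann_sum \<phi> k - c) \<le> K"
proof -
  have "riemann_sum \<phi> k - c = (\<Sum>i<k. (1 / real k) *\<^sub>R (\<phi> (real i / real k) - c))"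
    using assms(2) by (simp add: riemann_sum_def scaleR_diff_right sum_subtractf sum_constant_scaleR
        del: sum_constant)
  also have "N m \<dots> \<le> (\<Sum>i<k. N m ((1 / real k) *\<^sub>R (\<phi> (real i / real k) - c)))"
    using assms by (intro N_sum_le lev_scale lev_diff) auto
  also have "\<dots> \<le> (\<Sum>i<k. (1 / real k) * K)"
  proof (rule sum_mono)
    fix i assume i: "i \<in> {..<k}"
    then have t: "real i / real k \<in> {0..1}" by auto
    show "N m ((1 / real k) *\<^sub>R (\<phi> (real i / real k) - c)) \<le> (1 / real k) * K"
      using assms(4)[OF t] N_scale[OF lev_diff[OF assms(1)[OF t] assms(3)], of "1 / real k"]
      by (simp add: divide_right_mono)
  qed
  also have "\<dots> = K" using assms(2) by simp
  finally show ?thesis .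
qed

text \<open>A node of the fine sum lies within \<open>1 / k\<close> of the left end of its coarse
  interval, so \<open>\<epsilon>\<close> bounds each difference before averaging. Sums with
  \<open>k\<close> and with \<open>l\<close> steps can thus be compared through the one with
  \<open>k * l\<close> steps.\<close>

lemma riemann_sum_refine:
  assumes lev: "\<And>t. t \<in> {0..1} \<Longrightarrow> \<phi> t \<in> L m" and k: "k \<ge> 1" "l \<ge> 1"
    and osc: "\<And>s t. s \<in> {0..1} \<Longrightarrow> t \<in> {0..1} \<Longrightarrow> \<bar>s - t\<bar> \<le> 1 / real k \<Longrightarrow> N m (\<phi> s - \<phi> t) \<le> \<epsilon>"
  shows "N m (riemann_sum \<phi> (k * l) - riemann_sum \<phi> k) \<le> \<epsilon>"
proof -
  define q where "q = 1 / real (k * l)"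
  \<comment> \<open>The coarse value is repeated \<open>l\<close> times with the fine weight
    \<open>q\<close>, so that both sums run over the same blocks.\<close>
  have "riemann_sum \<phi> k = (\<Sum>i<k. \<Sum>j\<in>{i*l..<i*l+l}. q *\<^sub>R \<phi> (real i / real k))"
    unfolding riemann_sum_def q_def using k
    by (intro sum.cong) (auto simp: sum_constant_scaleR simp del: sum_constant)
  moreover have "riemann_sum \<phi> (k * l) = (\<Sum>i<k. \<Sum>j\<in>{i*l..<i*l+l}. q *\<^sub>R \<phi> (real j / real (k * l)))"
    unfolding riemann_sum_def q_def by (rule sum.nat_group[symmetric])
  ultimately have "riemann_sum \<phi> (k * l) - riemann_sum \<phi> k =
      (\<Sum>i<k. \<Sum>j\<in>{i*l..<i*l+l}. q *\<^sub>R (\<phi> (real j / real (k * l)) - \<phi> (real i / real k)))"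
    by (simp add: sum_subtractf scaleR_diff_right)
  also have "N m \<dots> \<le> (\<Sum>i<k. \<Sum>j\<in>{i*l..<i*l+l}. q * \<epsilon>)"
  proof -
    have j: "q *\<^sub>R (\<phi> (real j / real (k * l)) - \<phi> (real i / real k)) \<in> L m \<and>
        N m (q *\<^sub>R (\<phi> (real j / real (k * l)) - \<phi> (real i / real k))) \<le> q * \<epsilon>"
      if i: "i < k" and j: "j \<in> {i*l..<i*l+l}" for i j
    proof -
      have "j < k * l"
      proof -
        have "j < (i + 1) * l" using j by simp
        also have "\<dots> \<le> k * l" using i by (intro mult_right_mono) auto
        finally show ?thesis .
      qed
      then have 1: "real j / real (k * l) \<in> {0..1}" using k
        by (simp add: divide_le_eq of_nat_mult[symmetric] del: of_nat_mult)
      have 2: "real i / real k \<in> {0..1}" using i by simp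
      have "real j / real (k * l) - real i / real k = (real j - real (i * l)) / real (k * l)"
        using k by (simp add: field_simps)
      also have "\<bar>\<dots>\<bar> \<le> real l / real (k * l)"
      proof -
        have "real (i * l) \<le> real j" "real j \<le> real (i * l) + real l"
          using j unfolding of_nat_add[symmetric] of_nat_le_iff by auto
        then show ?thesis by (simp add: divide_right_mono del: of_nat_mult)
      qed
      also have "\<dots> = 1 / real k" using k by simp
      finally have 3: "N m (\<phi> (real j / real (k * l)) - \<phi> (real i / real k)) \<le> \<epsilon>"
        using osc 1 2 by blast
      have 4: "\<phi> (real j / real (k * l)) - \<phi> (real i / real k) \<in> L m"
        using lev 1 2 lev_diff by blast
      have "q \<ge> 0" unfolding q_def by simp
      then show ?thesis using N_scale[OF 4, of q] 3 lev_scale[OF 4] by (simp add: mult_left_mono)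
    qed
    have "N m (\<Sum>i<k. \<Sum>j\<in>{i*l..<i*l+l}. q *\<^sub>R (\<phi> (real j / real (k * l)) - \<phi> (real i / real k)))
        \<le> (\<Sum>i<k. N m (\<Sum>j\<in>{i*l..<i*l+l}. q *\<^sub>R (\<phi> (real j / real (k * l)) - \<phi> (real i / real k))))"
      using j by (intro N_sum_le lev_sum) blast
    also have "\<dots> \<le> (\<Sum>i<k. \<Sum>j\<in>{i*l..<i*l+l}. q * \<epsilon>)"
    proof (rule sum_mono)
      fix i assume i: "i \<in> {..<k}"
      have "N m (\<Sum>j\<in>{i*l..<i*l+l}. q *\<^sub>R (\<phi> (real j / real (k * l)) - \<phi> (real i / real k)))
        \<le> (\<Sum>j\<in>{i*l..<i*l+l}. N m (q *\<^sub>R (\<phi> (real j / real (k * l)) - \<phi> (real i / real k))))"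
        using j i by (intro N_sum_le) blast
      also have "\<dots> \<le> (\<Sum>j\<in>{i*l..<i*l+l}. q * \<epsilon>)"
        using j i by (intro sum_mono) blast
      finally show "N m (\<Sum>j\<in>{i*l..<i*l+l}. q *\<^sub>R (\<phi> (real j / real (k * l)) - \<phi> (real i / real k)))
        \<le> (\<Sum>j\<in>{i*l..<i*l+l}. q * \<epsilon>)" .
    qed
    finally show ?thesis .
  qed
  also have "\<dots> = \<epsilon>" unfolding q_def using k by simp
  finally show ?thesis .
qed

text \<open>Continuity for \<open>N m\<close> is not continuity for the topology of the type, so
  compactness is applied to the real function
  \<open>(s, t) \<mapsto> N m (\<phi> s - \<phi> t)\<close> on the unit square, which vanishes on
  the diagonal.\<close>

lemma level_uniformly_continuous:
  assumes lev: "\<And>t. t \<in> {0..1} \<Longrightarrow> \<phi> t \<in> L m"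
    and cont: "\<And>t \<epsilon>. t \<in> {0..1} \<Longrightarrow> \<epsilon> > 0 \<Longrightarrow>
      \<exists>d>0. \<forall>s\<in>{0..1::real}. \<bar>s - t\<bar> < d \<longrightarrow> N m (\<phi> s - \<phi> t) < \<epsilon>"
    and "\<epsilon> > 0"
  obtains d where "d > 0" "\<And>s t. s \<in> {0..1} \<Longrightarrow> t \<in> {0..1} \<Longrightarrow> \<bar>s - t\<bar> < d \<Longrightarrow> N m (\<phi> s - \<phi> t) < \<epsilon>"
proof -
  define C where "C = ({0..1} :: real set) \<times> ({0..1} :: real set)"
  define F where "F p = N m (\<phi> (fst p) - \<phi> (snd p))" for p
  have "continuous_on C F"
    unfolding continuous_on_iff
  proof (intro ballI allI impI)
    fix p and e :: real assume p: "p \<in> C" and e: "e > 0"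
    obtain a b where ab: "p = (a, b)" "a \<in> {0..1}" "b \<in> {0..1}" using p by (auto simp: C_def)
    obtain d1 where d1: "d1 > 0" "\<And>s. s \<in> {0..1} \<Longrightarrow> \<bar>s - a\<bar> < d1 \<Longrightarrow> N m (\<phi> s - \<phi> a) < e / 2"
      using cont[OF ab(2), of "e / 2"] e by auto
    obtain d2 where d2: "d2 > 0" "\<And>s. s \<in> {0..1} \<Longrightarrow> \<bar>s - b\<bar> < d2 \<Longrightarrow> N m (\<phi> s - \<phi> b) < e / 2"
      using cont[OF ab(3), of "e / 2"] e by auto
    show "\<exists>d>0. \<forall>p'\<in>C. dist p' p < d \<longrightarrow> dist (F p') (F p) < e"
    proof (intro exI[of _ "min d1 d2"] conjI ballI impI)
      fix p' assume p': "p' \<in> C" "dist p' p < min d1 d2"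
      obtain a' b' where ab': "p' = (a', b')" "a' \<in> {0..1}" "b' \<in> {0..1}" using p' by (auto simp: C_def)
      have "\<bar>a' - a\<bar> < d1" "\<bar>b' - b\<bar> < d2"
        using p'(2) dist_fst_le[of p' p] dist_snd_le[of p' p] ab ab' by (auto simp: dist_real_def)
      then have n: "N m (\<phi> a' - \<phi> a) < e / 2" "N m (\<phi> b' - \<phi> b) < e / 2" using d1 d2 ab' by auto
      note l = lev[OF ab(2)] lev[OF ab(3)] lev[OF ab'(2)] lev[OF ab'(3)]
      have "N m (\<phi> a' - \<phi> b') \<le> N m (\<phi> a' - \<phi> a) + (N m (\<phi> a - \<phi> b) + N m (\<phi> b - \<phi> b'))"
        using N_diff_triangle[of "\<phi> a'" m "\<phi> a" "\<phi> b'"] N_diff_triangle[of "\<phi> a" m "\<phi> b" "\<phi> b'"] l by simp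
      moreover have "N m (\<phi> a - \<phi> b) \<le> N m (\<phi> a - \<phi> a') + (N m (\<phi> a' - \<phi> b') + N m (\<phi> b' - \<phi> b))"
        using N_diff_triangle[of "\<phi> a" m "\<phi> a'" "\<phi> b"] N_diff_triangle[of "\<phi> a'" m "\<phi> b'" "\<phi> b"] l by simp
      moreover have "N m (\<phi> b - \<phi> b') = N m (\<phi> b' - \<phi> b)" "N m (\<phi> a - \<phi> a') = N m (\<phi> a' - \<phi> a)"
        using N_minus_commute l by auto
      ultimately show "dist (F p') (F p) < e"
        using n by (auto simp: F_def ab ab' dist_real_def abs_less_iff)
    qed (use d1 d2 in auto)
  qed
  moreover have "compact C" unfolding C_def by (intro compact_Times) auto
  ultimately have "uniformly_continuous_on C F" by (rule compact_uniformly_continuous)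
  then obtain d where d: "d > 0" "\<And>p p'. p \<in> C \<Longrightarrow> p' \<in> C \<Longrightarrow> dist p' p < d \<Longrightarrow> dist (F p') (F p) < \<epsilon>"
    unfolding uniformly_continuous_on_def using \<open>\<epsilon> > 0\<close> by meson
  show ?thesis
  proof
    fix s t :: real assume st: "s \<in> {0..1}" "t \<in> {0..1}" "\<bar>s - t\<bar> < d"
    have "dist (F (s, t)) (F (t, t)) < \<epsilon>"
      using d(2)[of "(t, t)" "(s, t)"] st by (auto simp: C_def dist_Pair_Pair dist_real_def)
    then show "N m (\<phi> s - \<phi> t) < \<epsilon>" by (simp add: F_def dist_real_def)
  qed (rule d)
qed

text \<open>In the norm of the type the curve is differentiable: the linearisation error over each
  of the \<open>k\<close> intervals is at most \<open>\<epsilon> / k\<close>, and the increments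
  telescope.\<close>

lemma riemann_sum_approx_norm:
  assumes der: "\<And>t. t \<in> {0..1} \<Longrightarrow> (\<phi> has_vector_derivative \<phi>' t) (at t within {0..1})"
    and k: "k \<ge> 1"
    and osc: "\<And>s t. s \<in> {0..1} \<Longrightarrow> t \<in> {0..1} \<Longrightarrow> \<bar>s - t\<bar> \<le> 1 / real k \<Longrightarrow> norm (\<phi>' s - \<phi>' t) \<le> \<epsilon>"
  shows "norm (\<phi> 1 - \<phi> 0 - riemann_sum \<phi>' k) \<le> \<epsilon>"
proof -
  define p where "p i = real i / real k" for i
  have step: "norm (\<phi> (p (Suc i)) - \<phi> (p i) - (1 / real k) *\<^sub>R \<phi>' (p i)) \<le> (1 / real k) * \<epsilon>"
    if i: "i < k" for i
  proof -
    have in01: "{p i..p (Suc i)} \<subseteq> {0..1}" using i k by (auto simp: p_def field_simps)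
    have le: "p i \<le> p (Suc i)" using k by (simp add: p_def divide_right_mono)
    have diff: "p (Suc i) - p i = 1 / real k" using k by (simp add: p_def field_simps)
    have "norm (\<phi> (p (Suc i)) - \<phi> (p i) - (p (Suc i) - p i) *\<^sub>R \<phi>' (p i)) \<le> norm (p (Suc i) - p i) * \<epsilon>"
    proof (rule differentiable_bound_linearization[where S = "{p i..p (Suc i)}" and f' = "\<lambda>t x. x *\<^sub>R \<phi>' t"])
      show "\<And>t. t \<in> {0..1} \<Longrightarrow> p i + t *\<^sub>R (p (Suc i) - p i) \<in> {p i..p (Suc i)}"
      proof -
        fix t :: real assume "t \<in> {0..1}"
        then have "0 \<le> t * (p (Suc i) - p i)" "t * (p (Suc i) - p i) \<le> p (Suc i) - p i"
          using le mult_left_le_one_le[of "p (Suc i) - p i" t] by auto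
        then show "p i + t *\<^sub>R (p (Suc i) - p i) \<in> {p i..p (Suc i)}"
          unfolding real_scaleR_def atLeastAtMost_iff by linarith
      qed
      show "(\<phi> has_derivative (\<lambda>x. x *\<^sub>R \<phi>' t)) (at t within {p i..p (Suc i)})"
        if "t \<in> {p i..p (Suc i)}" for t
        using der[of t] that in01 has_vector_derivative_within_subset
        unfolding has_vector_derivative_def by (meson has_derivative_subset subsetD)
      show "onorm ((\<lambda>x. x *\<^sub>R \<phi>' t) - (\<lambda>x. x *\<^sub>R \<phi>' (p i))) \<le> \<epsilon>" if t: "t \<in> {p i..p (Suc i)}" for t
        unfolding fun_diff_def
      proof (rule onorm_le)
        fix x :: real
        have "\<bar>t - p i\<bar> \<le> 1 / real k" using t diff by auto
        then have "norm (\<phi>' t - \<phi>' (p i)) \<le> \<epsilon>" using osc t in01 le by auto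
        then show "norm (x *\<^sub>R \<phi>' t - x *\<^sub>R \<phi>' (p i)) \<le> \<epsilon> * norm x"
          by (simp add: scaleR_diff_right[symmetric] mult.commute[of \<epsilon>] mult_left_mono)
      qed
      show "p i \<in> {p i..p (Suc i)}" using le by simp
    qed
    then show ?thesis using diff by simp
  qed
  have "(\<Sum>i<k. \<phi> (p (Suc i)) - \<phi> (p i)) = \<phi> 1 - \<phi> 0"
    using k by (subst sum_lessThan_telescope) (simp add: p_def)
  then have "\<phi> 1 - \<phi> 0 - riemann_sum \<phi>' k
      = (\<Sum>i<k. \<phi> (p (Suc i)) - \<phi> (p i) - (1 / real k) *\<^sub>R \<phi>' (p i))"
    by (simp add: sum_subtractf riemann_sum_def p_def)
  also have "norm \<dots> \<le> (\<Sum>i<k. (1 / real k) * \<epsilon>)"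
    by (rule sum_norm_le) (use step in auto)
  also have "\<dots> = \<epsilon>" using k by simp
  finally show ?thesis .
qed

text \<open>The curve is differentiable only in the norm of level 0, where \<open>\<phi>'\<close> happens to be
  continuous into level \<open>m\<close>. The Riemann sums of \<open>\<phi>'\<close> are Cauchy at level \<open>m\<close>, and their limit
  can be identified in the weaker norm.\<close>

lemma level_mean_value:
  assumes der: "\<And>t. t \<in> {0..1} \<Longrightarrow> (\<phi> has_vector_derivative \<phi>' t) (at t within {0..1})"
    and lev: "\<And>t. t \<in> {0..1} \<Longrightarrow> \<phi>' t \<in> L m" and c: "c \<in> L m"
    and cont: "\<And>t \<epsilon>. t \<in> {0..1} \<Longrightarrow> \<epsilon> > 0 \<Longrightarrow>
      \<exists>d>0. \<forall>s\<in>{0..1}. \<bar>s - t\<bar> < d \<longrightarrow> N m (\<phi>' s - \<phi>' t) < \<epsilon>"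
    and bound: "\<And>t. t \<in> {0..1} \<Longrightarrow> N m (\<phi>' t - c) \<le> K"
  shows "N m (\<phi> 1 - \<phi> 0 - c) \<le> K"
proof -
  have osc: "\<exists>n. \<forall>k>n. \<forall>s\<in>{0..1}. \<forall>t\<in>{0..1}. \<bar>s - t\<bar> \<le> 1 / real k \<longrightarrow> N m (\<phi>' s - \<phi>' t) < \<epsilon>"
    if \<epsilon>: "\<epsilon> > 0" for \<epsilon>
  proof -
    obtain d where d: "d > 0" "\<And>s t. s \<in> {0..1} \<Longrightarrow> t \<in> {0..1} \<Longrightarrow> \<bar>s - t\<bar> < d \<Longrightarrow> N m (\<phi>' s - \<phi>' t) < \<epsilon>"
      by (rule level_uniformly_continuous[of \<phi>' m \<epsilon>]) (use lev cont \<epsilon> in auto)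
    obtain n where n: "inverse (real (Suc n)) < d" using reals_Archimedean[OF d(1)] by blast
    have "1 / real k < d" if "k > n" for k
    proof -
      have "1 / real k \<le> inverse (real (Suc n))" using that by (simp add: divide_simps)
      with n show ?thesis by simp
    qed
    then show ?thesis using d(2) by (meson le_less_trans)
  qed
  define R where "R k = riemann_sum \<phi>' (Suc k)" for k
  have RL: "R k \<in> L m" for k unfolding R_def by (intro riemann_sum_in_level lev) auto
  have "\<exists>n. \<forall>i\<ge>n. \<forall>j\<ge>n. N m (R i - R j) < \<epsilon>" if "\<epsilon> > 0" for \<epsilon>
  proof -
    obtain n where n: "\<And>k s t. k > n \<Longrightarrow> s \<in> {0..1} \<Longrightarrow> t \<in> {0..1} \<Longrightarrow> \<bar>s - t\<bar> \<le> 1 / real k \<Longrightarrow> N m (\<phi>' s - \<phi>' t) < \<epsilon> / 3"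
      using osc[of "\<epsilon> / 3"] \<open>\<epsilon> > 0\<close> by (meson zero_less_divide_iff zero_less_numeral)
    have "N m (R i - R j) < \<epsilon>" if ij: "i \<ge> n" "j \<ge> n" for i j
    proof -
      \<comment> \<open>Common refinement of both sums; the threshold \<open>\<epsilon> / 3\<close>
        leaves room for the strict inequality.\<close>
      define M where "M = riemann_sum \<phi>' (Suc i * Suc j)"
      have Mlev: "M \<in> L m" unfolding M_def by (intro riemann_sum_in_level lev) auto
      have "N m (M - R i) \<le> \<epsilon> / 3" unfolding M_def R_def
        by (rule riemann_sum_refine) (use lev n[of "Suc i"] ij in \<open>auto intro: less_imp_le\<close>)
      moreover have "N m (M - R j) \<le> \<epsilon> / 3" unfolding M_def R_def mult.commute[of "Suc i"]
        by (rule riemann_sum_refine) (use lev n[of "Suc j"] ij in \<open>auto intro: less_imp_le\<close>)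
      ultimately show ?thesis
        using N_diff_triangle[OF RL Mlev RL, of i j] N_minus_commute[OF RL Mlev, of i] \<open>\<epsilon> > 0\<close> by simp
    qed
    then show ?thesis by blast
  qed
  then obtain x where x: "x \<in> L m" "\<And>\<epsilon>. \<epsilon> > 0 \<Longrightarrow> \<exists>n. \<forall>i\<ge>n. N m (R i - x) < \<epsilon>"
    using level_complete[of R m, OF RL] by blast
  obtain C where C: "C > 0" "\<And>x. x \<in> L m \<Longrightarrow> norm x \<le> C * N m x" using norm_le_level by blast
  have "norm (\<phi> 1 - \<phi> 0 - x) \<le> e" if "e > 0" for e
  proof -
    define \<epsilon> where "\<epsilon> = e / (2 * C)"
    have \<epsilon>: "\<epsilon> > 0" "C * \<epsilon> = e / 2" using that C by (auto simp: \<epsilon>_def)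
    obtain n where n: "\<And>k s t. k > n \<Longrightarrow> s \<in> {0..1} \<Longrightarrow> t \<in> {0..1} \<Longrightarrow> \<bar>s - t\<bar> \<le> 1 / real k \<Longrightarrow> N m (\<phi>' s - \<phi>' t) < \<epsilon>"
      using osc[OF \<epsilon>(1)] by meson
    obtain n' where n': "\<And>i. i \<ge> n' \<Longrightarrow> N m (R i - x) < \<epsilon>" using x(2)[OF \<epsilon>(1)] by blast
    define i where "i = max n n'"
    have "norm (\<phi> 1 - \<phi> 0 - R i) \<le> e / 2"
      unfolding R_def
    proof (rule riemann_sum_approx_norm[OF der])
      fix s t :: real assume st: "s \<in> {0..1}" "t \<in> {0..1}" "\<bar>s - t\<bar> \<le> 1 / real (Suc i)"
      have "norm (\<phi>' s - \<phi>' t) \<le> C * N m (\<phi>' s - \<phi>' t)" using C lev st lev_diff by auto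
      also have "\<dots> \<le> C * \<epsilon>"
        using n[of "Suc i" s t] st C less_imp_le[of "N m (\<phi>' s - \<phi>' t)" \<epsilon>]
        by (intro mult_left_mono) (auto simp: i_def simp del: of_nat_Suc)
      finally show "norm (\<phi>' s - \<phi>' t) \<le> e / 2" using \<epsilon> by simp
    qed auto
    moreover have "norm (R i - x) \<le> e / 2"
    proof -
      have "norm (R i - x) \<le> C * N m (R i - x)" using C lev_diff[OF RL x(1)] by auto
      also have "\<dots> \<le> C * \<epsilon>"
        using n'[of i] C by (intro mult_left_mono) (auto simp: i_def)
      finally show ?thesis using \<epsilon> by simp
    qed
    ultimately show ?thesis using norm_triangle_ineq[of "\<phi> 1 - \<phi> 0 - R i" "R i - x"] by simp
  qed
  then have "norm (\<phi> 1 - \<phi> 0 - x) \<le> 0" by (rule field_le_epsilon) simp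
  then have eq: "\<phi> 1 - \<phi> 0 = x" by simp
  have "N m (x - c) \<le> K"
  proof (rule field_le_epsilon)
    fix e :: real assume "e > 0"
    then obtain i where i: "N m (R i - x) < e" using x(2) by blast
    have "N m (R i - c) \<le> K" unfolding R_def
      by (rule riemann_sum_dist_const) (use lev c bound in auto)
    then show "N m (x - c) \<le> K + e"
      using i N_diff_triangle[OF x(1) RL c, of i] N_minus_commute[OF RL x(1), of i] by simp
  qed
  with eq show ?thesis by simp
qed

text \<open>Smooth approximation in every coordinate, used to pass from fibre directions of level
  \<open>Suc m\<close> to those of level \<open>m\<close>. Dividing by \<open>n + 1\<close> makes
  the total error strictly smaller than \<open>e\<close>, also for \<open>n = 0\<close>.\<close>

lemma tlev_dense:
  assumes "k \<in> tlev L n s m" "e > 0"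
  shows "\<exists>k'\<in>tlev L n s (Suc m). tnorm N n s m (\<lambda>i. k' i - k i) < e"
proof -
  have "\<exists>y. (\<forall>j. y \<in> L j) \<and> N (m + s i) (k i - y) < e / (real n + 1)" if "i < n" for i
    using level_dense[of "k i" "m + s i" "e / (real n + 1)"] assms that by (auto simp: tlev_def)
  then obtain y where y: "\<And>i j. i < n \<Longrightarrow> y i \<in> L j" "\<And>i. i < n \<Longrightarrow> N (m + s i) (k i - y i) < e / (real n + 1)"
    by metis
  define k' where "k' = (\<lambda>i. if i < n then y i else 0)"
  have "k' \<in> tlev L n s (Suc m)" using y by (auto simp: k'_def tlev_def)
  moreover have "tnorm N n s m (\<lambda>i. k' i - k i) < e"
  proof -
    have "N (m + s i) (k' i - k i) \<le> e / (real n + 1)" if "i < n" for i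
      using y[OF that] that assms(1) N_minus_commute[of "y i" "m + s i" "k i"]
      by (auto simp: k'_def tlev_def less_imp_le)
    then have "tnorm N n s m (\<lambda>i. k' i - k i) \<le> (\<Sum>i<n. e / (real n + 1))"
      unfolding tnorm_def by (intro sum_mono) auto
    also have "\<dots> < e" using assms(2) by (simp add: field_simps)
    finally show ?thesis .
  qed
  ultimately show ?thesis by blast
qed

text \<open>Coordinate \<open>i\<close> lives at level \<open>m + s i\<close>, so compactness is
  applied to one coordinate at a time, each time thinning out the previous subsequence.\<close>

lemma tlev_compact:
  fixes Y :: "nat \<Rightarrow> nat \<Rightarrow> 'e"
  assumes Y: "\<And>k. Y k \<in> tlev L n s (Suc m)" and B: "\<And>k. tnorm N n s (Suc m) (Y k) \<le> B"
  obtains r y where "strict_mono (r :: nat \<Rightarrow> nat)" "y \<in> tlev L n s m"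
    "(\<lambda>k. tnorm N n s m (\<lambda>i. Y (r k) i - y i)) \<longlonglongrightarrow> 0"
proof -
  have "\<exists>r y. strict_mono (r :: nat \<Rightarrow> nat) \<and>
      (\<forall>i<j. y i \<in> L (m + s i) \<and> (\<lambda>k. N (m + s i) (Y (r k) i - y i)) \<longlonglongrightarrow> 0)" if "j \<le> n" for j
    using that
  proof (induction j)
    case 0
    then show ?case by (intro exI[of _ id]) (auto simp: strict_mono_def)
  next
    case (Suc j)
    then obtain r y where r: "strict_mono (r :: nat \<Rightarrow> nat)"
      and y: "\<And>i. i < j \<Longrightarrow> y i \<in> L (m + s i)" "\<And>i. i < j \<Longrightarrow> (\<lambda>k. N (m + s i) (Y (r k) i - y i)) \<longlonglongrightarrow> 0"
      by auto
    have j: "j < n" using Suc.prems by simp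
    have YL: "Y k j \<in> L (Suc m + s j)" for k using Y j by (simp add: tlev_def)
    have YB: "N (Suc m + s j) (Y k j) \<le> B" for k
      using tnorm_comp_le[OF Y j, of k] B[of k] by simp
    obtain r' x where r': "strict_mono (r' :: nat \<Rightarrow> nat)" "x \<in> L (m + s j)"
      "\<And>\<epsilon>. \<epsilon> > 0 \<Longrightarrow> \<exists>K. \<forall>i\<ge>K. N (m + s j) (Y (r (r' i)) j - x) < \<epsilon>"
      using level_compact[of "m + s j" "Suc m + s j" "\<lambda>k. Y (r k) j" B] YL YB by auto
    have Yx: "0 \<le> N (m + s j) (Y k j - x)" for k
      using YL[of k] r'(2) lev_mono[of "m + s j" "Suc m + s j"] by (intro N_nonneg lev_diff) auto
    have lim: "(\<lambda>k. N (m + s j) (Y (r (r' k)) j - x)) \<longlonglongrightarrow> 0"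
      unfolding LIMSEQ_iff using r'(3) Yx by auto
    have "(\<lambda>k. N (m + s i) (Y (r (r' k)) i - y i)) \<longlonglongrightarrow> 0" if "i < j" for i
      using LIMSEQ_subseq_LIMSEQ[OF y(2)[OF that] r'(1)] by (simp add: o_def)
    then show ?case
      using lim y(1) r'(2) strict_mono_o[OF r r'(1)]
      by (intro exI[of _ "r \<circ> r'"] exI[of _ "y(j := x)"]) (auto simp: less_Suc_eq strict_mono_def)
  qed
  from this[of n] obtain r y where r: "strict_mono (r :: nat \<Rightarrow> nat)"
    and y: "\<And>i. i < n \<Longrightarrow> y i \<in> L (m + s i)" "\<And>i. i < n \<Longrightarrow> (\<lambda>k. N (m + s i) (Y (r k) i - y i)) \<longlonglongrightarrow> 0"
    by auto
  define y' where "y' = (\<lambda>i. if i < n then y i else 0)"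
  have "(\<lambda>k. tnorm N n s m (\<lambda>i. Y (r k) i - y' i)) \<longlonglongrightarrow> (\<Sum>i<n. 0)"
    unfolding tnorm_def by (rule tendsto_sum) (use y(2) in \<open>simp add: y'_def\<close>)
  moreover have "y' \<in> tlev L n s m" using y(1) by (simp add: y'_def tlev_def)
  ultimately show ?thesis using that r by simp
qed

end

section \<open>Implicit equations with a finite-dimensional parameter\<close>

text \<open>Iterated tangents of \<open>V + E\<close> become pairs of tuples: taking tangents
  commutes with direct sums, so parameter and fibre can be separated at every stage.\<close>

definition fun_zip :: "('i \<Rightarrow> 'a) \<Rightarrow> ('i \<Rightarrow> 'b) \<Rightarrow> 'i \<Rightarrow> 'a \<times> 'b" where
  "fun_zip x y = (\<lambda>i. (x i, y i))"

lemma fun_zip_apply [simp]: "fun_zip x y i = (x i, y i)"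
  by (simp add: fun_zip_def)

lemma tfst_fun_zip: "tfst n (fun_zip x y) = fun_zip (tfst n x) (tfst n y)"
  by (auto simp: tfst_def zero_prod_def)

lemma tsnd_fun_zip: "tsnd n (fun_zip x y) = fun_zip (tsnd n x) (tsnd n y)"
  by (auto simp: tsnd_def zero_prod_def)

lemma fun_zip_in_sum_lev_iff:
  "fun_zip x y \<in> tlev (sum_lev L) n s m \<longleftrightarrow> x \<in> tlev const_lev n s m \<and> y \<in> tlev L n s m"
  by (auto simp: tlev_def sum_lev_def const_lev_def zero_prod_def)

lemma tnorm_fun_zip:
  "tnorm (sum_norm N) n s m (fun_zip x y) = tnorm const_norm n s m x + tnorm N n s m y"
  by (simp add: tnorm_def sum_norm_def const_norm_def sum.distrib)

lemma tnorm_fun_zip_diff: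
  fixes x x' :: "nat \<Rightarrow> 'v::real_normed_vector" and y y' :: "nat \<Rightarrow> 'e::real_vector"
  shows "tnorm (sum_norm N) n s m (\<lambda>i. fun_zip x y i - fun_zip x' y' i)
    = tnorm const_norm n s m (\<lambda>i. x i - x' i) + tnorm N n s m (\<lambda>i. y i - y' i)"
  using tnorm_fun_zip[of N n s m "\<lambda>i. x i - x' i" "\<lambda>i. y i - y' i"] by (simp add: fun_zip_def)

lemma const_lev_eq: "const_lev m = const_lev m'"
  by (simp add: const_lev_def)

lemma const_norm_eq: "const_norm m = const_norm m'"
  by (simp add: const_norm_def fun_eq_iff)

lemma tlev_const_eq: "tlev const_lev n s m = tlev const_lev n s' m'"
  by (simp add: tlev_def const_lev_def)

lemma tnorm_const_eq: "tnorm const_norm n s m x = tnorm const_norm n s' m' x"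
  by (simp add: tnorm_def const_norm_def)

lemma normed_scale_const: "normed_scale const_lev (const_norm :: nat \<Rightarrow> 'v::real_normed_vector \<Rightarrow> real)"
  by unfold_locales
    (auto simp: const_lev_def const_norm_def norm_triangle_ineq intro: exI[of _ 1] subspace_UNIV)

lemma (in normed_scale) normed_scale_sum:
  "normed_scale (sum_lev La) (sum_norm Na :: nat \<Rightarrow> 'v::real_normed_vector \<times> 'a \<Rightarrow> real)"
proof
  fix m x y and c :: real
  show "sum_lev La (Suc m) \<subseteq> (sum_lev La m :: ('v \<times> 'a) set)"
    using lev_Suc by (auto simp: sum_lev_def)
  show "subspace (sum_lev La m :: ('v \<times> 'a) set)"
    unfolding sum_lev_def by (intro subspace_Times subspace_UNIV lev_subspace)
  fix x y :: "'v \<times> 'a"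
  show "\<exists>C. \<forall>x\<in>sum_lev La (Suc m). sum_norm Na m (x :: 'v \<times> 'a) \<le> C * sum_norm Na (Suc m) x"
  proof -
    obtain C where C: "C > 0" "\<forall>x\<in>La (Suc m). Na m x \<le> C * Na (Suc m) x"
      using N_embed[of m "Suc m"] by auto
    have "sum_norm Na m x \<le> max 1 C * sum_norm Na (Suc m) x" if "x \<in> sum_lev La (Suc m)" for x :: "'v \<times> 'a"
    proof -
      have "snd x \<in> La (Suc m)" using that by (auto simp: sum_lev_def)
      then have "Na m (snd x) \<le> max 1 C * Na (Suc m) (snd x)"
        using C N_nonneg by (meson max.cobounded2 mult_right_mono order_trans)
      moreover have "norm (fst x) \<le> max 1 C * norm (fst x)"
        using mult_right_mono[of 1 "max 1 C" "norm (fst x)"] by simp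
      ultimately show ?thesis by (simp add: sum_norm_def distrib_left)
    qed
    then show ?thesis by blast
  qed
  assume x: "x \<in> sum_lev La m"
  then show "0 \<le> sum_norm Na m x" "sum_norm Na m (c *\<^sub>R x) = \<bar>c\<bar> * sum_norm Na m x"
    by (auto simp: sum_lev_def sum_norm_def N_nonneg N_scale distrib_left)
  show "sum_norm Na m x = 0 \<longleftrightarrow> x = 0"
    using x by (auto simp: sum_lev_def sum_norm_def N_nonneg N_eq_0_iff prod_eq_iff add_nonneg_eq_0_iff)
  assume y: "y \<in> sum_lev La m"
  then have "Na m (snd x + snd y) \<le> Na m (snd x) + Na m (snd y)"
    using x by (intro N_triangle) (auto simp: sum_lev_def)
  then show "sum_norm Na m (x + y) \<le> sum_norm Na m x + sum_norm Na m y"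
    using norm_triangle_ineq[of "fst x" "fst y"] by (simp add: sum_norm_def)
qed

lemma base_dom_Suc:
  assumes "normed_scale La Na" "\<And>m. G (Suc m) \<subseteq> G m"
  shows "base_dom La G c n s (Suc m) \<subseteq> base_dom La G c n s m"
  using normed_scale.tlev_mono[OF assms(1), of m "Suc m" n s] assms(2)
  by (auto simp: base_dom_def)

lemma base_dom_mono:
  assumes "normed_scale La Na" "\<And>m. G (Suc m) \<subseteq> G m" "m \<le> m'"
  shows "base_dom La G c n s m' \<subseteq> base_dom La G c n s m"
  using assms(3)
proof (induction m' rule: dec_induct)
  case (step m')
  then show ?case using base_dom_Suc[of La Na G c n s m', OF assms(1) assms(2)] by blast
qed simp

lemma germ_nbhd_open:
  assumes "germ_nbhd La Na C G" "x \<in> G k"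
  shows "\<exists>r>0. \<forall>y\<in>C \<inter> La k. Na k (y - x) < r \<longrightarrow> y \<in> G k"
  using assms unfolding germ_nbhd_def by simp

text \<open>Openness comes from the germ at coordinate 0, the only restricted one, whose norm is
  dominated by \<open>tnorm\<close>. The equations \<open>eq\<close> reconcile the germ level
  \<open>m + c\<close> with the tuple level \<open>m + s 0\<close>: on the direct sum they hold by
  the choice \<open>c = s 0\<close>, on the constant structure for every \<open>c\<close>.\<close>

lemma base_dom_open:
  assumes sc: "normed_scale La Na" and G: "germ_nbhd La Na C G" and n: "n \<ge> 1"
    and eq: "La (m + c) = La (m + s 0)" "Na (m + c) = Na (m + s 0)"
    and z0: "z0 \<in> base_dom La G c n s m"
  shows "\<exists>r>0. \<forall>z\<in>tlev La n s m. z 0 \<in> C \<longrightarrow> tnorm Na n s m (\<lambda>i. z i - z0 i) < r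
    \<longrightarrow> z \<in> base_dom La G c n s m"
proof -
  interpret normed_scale La Na by (rule sc)
  have z0': "z0 \<in> tlev La n s m" "z0 0 \<in> G (m + c)" using z0 by (auto simp: base_dom_def)
  then obtain r where r: "r > 0" "\<And>y. y \<in> C \<inter> La (m + c) \<Longrightarrow> Na (m + c) (y - z0 0) < r \<Longrightarrow> y \<in> G (m + c)"
    using germ_nbhd_open[OF G] by meson
  have "z \<in> base_dom La G c n s m"
    if z: "z \<in> tlev La n s m" "z 0 \<in> C" "tnorm Na n s m (\<lambda>i. z i - z0 i) < r" for z
  proof -
    have "Na (m + s 0) (z 0 - z0 0) < r"
      using tnorm_comp_le[OF tlev_diff[OF z(1) z0'(1)], of 0] z(3) n by simp
    moreover have "z 0 \<in> La (m + s 0)" using z(1) n by (simp add: tlev_def)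
    ultimately show ?thesis using r(2)[of "z 0"] z eq by (simp add: base_dom_def)
  qed
  with r(1) show ?thesis by blast
qed

text \<open>Sums and nonnegative multiples make \<open>V\<close> convex, so that segments and inward
  difference quotients stay in the domain, while \<open>V_span\<close> reaches the other directions
  by subtraction.\<close>

locale sc_implicit = sc_space L N for L :: "nat \<Rightarrow> 'e::banach set" and N +
  fixes V :: "'v::euclidean_space set" and U :: "nat \<Rightarrow> ('v \<times> 'e) set" and G :: "nat \<Rightarrow> 'v set"
  assumes V_add: "\<And>a b. a \<in> V \<Longrightarrow> b \<in> V \<Longrightarrow> a + b \<in> V"
    and V_scale: "\<And>a c. a \<in> V \<Longrightarrow> c \<ge> 0 \<Longrightarrow> c *\<^sub>R a \<in> V"
    and V_span: "\<And>v. \<exists>a\<in>V. \<exists>b\<in>V. v = a - b"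
    and U_germ: "germ_nbhd (sum_lev L) (sum_norm N) (V \<times> UNIV) U"
    and G_germ: "germ_nbhd const_lev const_norm V G"
begin

sublocale Z: normed_scale "sum_lev L :: nat \<Rightarrow> ('v \<times> 'e) set" "sum_norm N"
  by (rule normed_scale_sum)

sublocale P: normed_scale "const_lev :: nat \<Rightarrow> 'v set" const_norm
  by (rule normed_scale_const)

text \<open>The shift \<open>s 0\<close> of the base coordinate grows by one with each tangent step.
  Used as the offset, it makes the family reproduce itself under \<open>tdom\<close>, see
  \<open>tdom_\<Omega>\<close>.\<close>

abbreviation \<Omega> :: "nat \<Rightarrow> (nat \<Rightarrow> nat) \<Rightarrow> nat \<Rightarrow> (nat \<Rightarrow> 'v \<times> 'e) set" where
  "\<Omega> n s \<equiv> base_dom (sum_lev L) U (s 0) n s"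

text \<open>The offset \<open>c\<close> provides extra regularity of the solution at the base point of a tuple: each
  tangent step costs two levels, whereas \<open>tdom\<close> accounts for one only.\<close>

abbreviation X :: "nat \<Rightarrow> nat \<Rightarrow> (nat \<Rightarrow> nat) \<Rightarrow> nat \<Rightarrow> (nat \<Rightarrow> 'v) set" where
  "X c n s \<equiv> base_dom const_lev G c n s"

abbreviation TE where "TE \<equiv> tlev L"
abbreviation NE where "NE \<equiv> tnorm N"
abbreviation TZ :: "nat \<Rightarrow> (nat \<Rightarrow> nat) \<Rightarrow> nat \<Rightarrow> (nat \<Rightarrow> 'v \<times> 'e) set" where "TZ \<equiv> tlev (sum_lev L)"
abbreviation NZ :: "nat \<Rightarrow> (nat \<Rightarrow> nat) \<Rightarrow> nat \<Rightarrow> (nat \<Rightarrow> 'v \<times> 'e) \<Rightarrow> real" where "NZ \<equiv> tnorm (sum_norm N)"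
abbreviation TV :: "nat \<Rightarrow> (nat \<Rightarrow> nat) \<Rightarrow> nat \<Rightarrow> (nat \<Rightarrow> 'v) set" where "TV \<equiv> tlev const_lev"
abbreviation NV :: "nat \<Rightarrow> (nat \<Rightarrow> nat) \<Rightarrow> nat \<Rightarrow> (nat \<Rightarrow> 'v) \<Rightarrow> real" where "NV \<equiv> tnorm const_norm"

section \<open>The domains of the equation and of its solution\<close>

lemma U_Suc: "U (Suc m) \<subseteq> U m" and U_sub: "U m \<subseteq> (V \<times> UNIV) \<inter> sum_lev L m"
  using U_germ unfolding germ_nbhd_def by blast+

lemma G_Suc: "G (Suc m) \<subseteq> G m" and G_sub: "G m \<subseteq> V"
  using G_germ unfolding germ_nbhd_def by blast+

lemma \<Omega>_mono: "m \<le> m' \<Longrightarrow> z \<in> \<Omega> n s m' \<Longrightarrow> z \<in> \<Omega> n s m"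
  using base_dom_mono[of "sum_lev L" "sum_norm N" U] Z.normed_scale_axioms U_Suc by blast

lemma X_mono: "m \<le> m' \<Longrightarrow> x \<in> X c n s m' \<Longrightarrow> x \<in> X c n s m"
  using base_dom_mono[of const_lev const_norm G] P.normed_scale_axioms G_Suc by blast

text \<open>Every level of the constant structure is the same space, so the level of a parameter is
  visible only in the index of \<open>G\<close>, where offset and level are added.\<close>

lemma X_shift: "x \<in> X (c + j) n s m \<longleftrightarrow> x \<in> X c n s (m + j)"
  unfolding base_dom_def tlev_const_eq[of n s "m + j" s m] by (simp add: ac_simps)

lemma \<Omega>_TZ: "z \<in> \<Omega> n s m \<Longrightarrow> z \<in> TZ n s m"
  by (simp add: base_dom_def)

lemma X_TV: "x \<in> X c n s m \<Longrightarrow> x \<in> TV n s' m'"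
  by (simp add: base_dom_def tlev_def const_lev_def)

lemma \<Omega>_V: "z \<in> \<Omega> n s m \<Longrightarrow> fst (z 0) \<in> V"
  using U_sub by (fastforce simp: base_dom_def)

lemma X_V: "x \<in> X c n s m \<Longrightarrow> x 0 \<in> V"
  using G_sub by (auto simp: base_dom_def)

lemma V_convex: "a \<in> V \<Longrightarrow> b \<in> V \<Longrightarrow> t \<in> {0..1} \<Longrightarrow> a + t *\<^sub>R (b - a) \<in> V"
  using V_add[OF V_scale[of a "1 - t"] V_scale[of b t]] by (simp add: algebra_simps)

lemma \<Omega>_open:
  assumes "n \<ge> 1" "z0 \<in> \<Omega> n s m"
  shows "\<exists>r>0. \<forall>z\<in>TZ n s m. fst (z 0) \<in> V \<longrightarrow> NZ n s m (\<lambda>i. z i - z0 i) < r \<longrightarrow> z \<in> \<Omega> n s m"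
proof -
  have "z \<in> V \<times> UNIV \<longleftrightarrow> fst z \<in> V" for z :: "'v \<times> 'e" by (cases z) simp
  then show ?thesis
    using base_dom_open[of "sum_lev L" "sum_norm N" "V \<times> UNIV" U n m "s 0" s z0, OF Z.normed_scale_axioms
        U_germ assms(1) refl refl assms(2)] by simp
qed

lemma X_open:
  assumes "n \<ge> 1" "x0 \<in> X c n s m"
  shows "\<exists>r>0. \<forall>x\<in>TV n s m. x 0 \<in> V \<longrightarrow> NV n s m (\<lambda>i. x i - x0 i) < r \<longrightarrow> x \<in> X c n s m"
  by (rule base_dom_open[of const_lev const_norm V G n m c s x0, OF P.normed_scale_axioms G_germ assms(1)
        const_lev_eq const_norm_eq assms(2)])

text \<open>\<open>\<Omega>\<close> need not be convex, but a small ball around one of its points,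
  cut with the tuples whose parameter lies in \<open>V\<close>, is convex and contained in it. The
  bound by the maximum keeps the segment in any smaller ball as well.\<close>

lemma \<Omega>_segment:
  assumes n: "n \<ge> 1" and z0: "z0 \<in> \<Omega> n s m"
  shows "\<exists>r>0. \<forall>z\<in>TZ n s m. \<forall>z'\<in>TZ n s m. fst (z 0) \<in> V \<longrightarrow> fst (z' 0) \<in> V \<longrightarrow>
    NZ n s m (\<lambda>i. z i - z0 i) < r \<longrightarrow> NZ n s m (\<lambda>i. z' i - z0 i) < r \<longrightarrow>
    (\<forall>t\<in>{0..1}. (\<lambda>i. z i + t *\<^sub>R (z' i - z i)) \<in> \<Omega> n s m \<and>
      NZ n s m (\<lambda>i. (z i + t *\<^sub>R (z' i - z i)) - z0 i) \<le> max (NZ n s m (\<lambda>i. z i - z0 i)) (NZ n s m (\<lambda>i. z' i - z0 i)))"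
proof -
  obtain r where r: "r > 0" "\<And>z. z \<in> TZ n s m \<Longrightarrow> fst (z 0) \<in> V \<Longrightarrow> NZ n s m (\<lambda>i. z i - z0 i) < r \<Longrightarrow> z \<in> \<Omega> n s m"
    using \<Omega>_open[OF n z0] by blast
  have "(\<lambda>i. z i + t *\<^sub>R (z' i - z i)) \<in> \<Omega> n s m \<and>
      NZ n s m (\<lambda>i. (z i + t *\<^sub>R (z' i - z i)) - z0 i) \<le> max (NZ n s m (\<lambda>i. z i - z0 i)) (NZ n s m (\<lambda>i. z' i - z0 i))"
    if z: "z \<in> TZ n s m" "fst (z 0) \<in> V" "NZ n s m (\<lambda>i. z i - z0 i) < r"
      and z': "z' \<in> TZ n s m" "fst (z' 0) \<in> V" "NZ n s m (\<lambda>i. z' i - z0 i) < r"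
      and t: "t \<in> {0..1}" for z z' and t :: real
  proof -
    define w where "w = (\<lambda>i. z i + t *\<^sub>R (z' i - z i))"
    have w: "w \<in> TZ n s m" unfolding w_def by (intro Z.tlev_add Z.tlev_scale Z.tlev_diff z z')
    have wV: "fst (w 0) \<in> V" using V_convex[OF z(2) z'(2) t] by (simp add: w_def)
    let ?M = "max (NZ n s m (\<lambda>i. z i - z0 i)) (NZ n s m (\<lambda>i. z' i - z0 i))"
    note d = Z.tlev_diff[OF z(1) \<Omega>_TZ[OF z0]] Z.tlev_diff[OF z'(1) \<Omega>_TZ[OF z0]]
    have "(\<lambda>i. w i - z0 i) = (\<lambda>i. (1 - t) *\<^sub>R (z i - z0 i) + t *\<^sub>R (z' i - z0 i))"
      by (simp add: w_def algebra_simps)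
    then have "NZ n s m (\<lambda>i. w i - z0 i) \<le> (1 - t) * NZ n s m (\<lambda>i. z i - z0 i) + t * NZ n s m (\<lambda>i. z' i - z0 i)"
      using Z.tnorm_triangle[OF Z.tlev_scale[OF d(1), of "1 - t"] Z.tlev_scale[OF d(2), of t]]
        Z.tnorm_scale[OF d(1), of "1 - t"] Z.tnorm_scale[OF d(2), of t] t by simp
    also have "\<dots> \<le> (1 - t) * ?M + t * ?M"
      using t by (intro add_mono mult_left_mono) auto
    also have "\<dots> = ?M" by (simp add: algebra_simps)
    finally have le: "NZ n s m (\<lambda>i. w i - z0 i) \<le> ?M" .
    then show ?thesis using r(2)[OF w wV] z z' unfolding w_def by auto
  qed
  with r(1) show ?thesis by blast
qed

text \<open>The conditions of \<open>sck 1\<close> with the derivative \<open>D\<close> named and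
  the tangent domain already written as an \<open>\<Omega>\<close>.\<close>

definition is_sc1 :: "nat \<Rightarrow> (nat \<Rightarrow> nat) \<Rightarrow> ((nat \<Rightarrow> 'v \<times> 'e) \<Rightarrow> nat \<Rightarrow> 'e) \<Rightarrow>
    ((nat \<Rightarrow> 'v \<times> 'e) \<Rightarrow> (nat \<Rightarrow> 'v \<times> 'e) \<Rightarrow> nat \<Rightarrow> 'e) \<Rightarrow> bool" where
  "is_sc1 n s g D \<longleftrightarrow> n \<ge> 1 \<and>
    sc0_map (sum_lev L) (sum_norm N) n s L N n s (\<Omega> n s) g \<and>
    sc_deriv (sum_lev L) (sum_norm N) n s L N n s (\<Omega> n s) g D \<and>
    sc0_map (sum_lev L) (sum_norm N) (2 * n) (tshift n s) L N (2 * n) (tshift n s)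
      (\<Omega> (2 * n) (tshift n s)) (tmap n n g D)"

lemma tshift_0: "n \<ge> 1 \<Longrightarrow> tshift n s 0 = Suc (s 0)"
  by (simp add: tshift_def)

lemma tpair_in_\<Omega>_iff:
  assumes "n \<ge> 1" "z \<in> TZ n s' m'" "\<eta> \<in> TZ n s'' m''"
  shows "tpair n z \<eta> \<in> \<Omega> (2 * n) (tshift n s) m \<longleftrightarrow> z \<in> \<Omega> n s (Suc m) \<and> \<eta> \<in> TZ n s m"
  using tpair_in_tlev_iff[OF assms(2,3)] assms(1)
  by (auto simp: base_dom_def tshift_0) (auto simp: tpair_def)

lemma tdom_\<Omega>: "n \<ge> 1 \<Longrightarrow> tdom (sum_lev L) n s (\<Omega> n s) = \<Omega> (2 * n) (tshift n s)"
  by (simp add: tdom_base_dom tshift_0)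

lemma NZ_tpair_diff:
  assumes "z \<in> TZ n s (Suc m)" "z' \<in> TZ n s (Suc m)" "h \<in> TZ n s m" "h' \<in> TZ n s m"
  shows "NZ (2 * n) (tshift n s) m (\<lambda>i. tpair n z h i - tpair n z' h' i)
    = NZ n s (Suc m) (\<lambda>i. z i - z' i) + NZ n s m (\<lambda>i. h i - h' i)"
  using assms by (simp add: tnorm_tshift tfst_minus tsnd_minus)

lemma NE_tpair_diff:
  assumes "z \<in> TE n s (Suc m)" "z' \<in> TE n s (Suc m)" "h \<in> TE n s m" "h' \<in> TE n s m"
  shows "NE (2 * n) (tshift n s) m (\<lambda>i. tpair n z h i - tpair n z' h' i)
    = NE n s (Suc m) (\<lambda>i. z i - z' i) + NE n s m (\<lambda>i. h i - h' i)"
  using assms by (simp add: tnorm_tshift tfst_minus tsnd_minus)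

section \<open>Calculus of a single sc1 map\<close>

context
  fixes n s g D assumes C1: "is_sc1 n s g D"
begin

lemma is_sc1_width: "n \<ge> 1"
  using C1 by (simp add: is_sc1_def)

lemma is_sc1_lev: "z \<in> \<Omega> n s m \<Longrightarrow> g z \<in> TE n s m"
  using C1 unfolding is_sc1_def sc0_map_def by blast

lemma deriv_linear:
  assumes "z \<in> \<Omega> n s (Suc m)" "h \<in> TZ n s m'" "h' \<in> TZ n s m''"
  shows "D z (\<lambda>i. c *\<^sub>R h i + h' i) = (\<lambda>i. c *\<^sub>R D z h i + D z h' i)"
proof -
  have "z \<in> \<Omega> n s 1" using \<Omega>_mono[OF _ assms(1), of 1] by simp
  moreover have "h \<in> TZ n s 0" "h' \<in> TZ n s 0"
    using Z.tlev_mono[of 0 m' n s] Z.tlev_mono[of 0 m'' n s] assms by auto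
  ultimately show ?thesis using C1 unfolding is_sc1_def sc_deriv_def by blast
qed

lemma deriv_lev0: "z \<in> \<Omega> n s (Suc m) \<Longrightarrow> h \<in> TZ n s 0 \<Longrightarrow> D z h \<in> TE n s 0"
  using C1 \<Omega>_mono[of 1 "Suc m" z s n] unfolding is_sc1_def sc_deriv_def by (simp add: Ball_def)

lemma deriv_zero: "z \<in> \<Omega> n s (Suc m) \<Longrightarrow> D z (\<lambda>i. 0) = (\<lambda>i. 0)"
  using deriv_linear[of z m "\<lambda>i. 0" 0 "\<lambda>i. 0" 0 "-1"] by simp

lemma deriv_scale: "z \<in> \<Omega> n s (Suc m) \<Longrightarrow> h \<in> TZ n s m' \<Longrightarrow> D z (\<lambda>i. c *\<^sub>R h i) = (\<lambda>i. c *\<^sub>R D z h i)"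
  using deriv_linear[of z m h m' "\<lambda>i. 0" 0 c] deriv_zero by simp

lemma deriv_diff:
  "z \<in> \<Omega> n s (Suc m) \<Longrightarrow> h \<in> TZ n s m' \<Longrightarrow> h' \<in> TZ n s m'' \<Longrightarrow>
    D z (\<lambda>i. h i - h' i) = (\<lambda>i. D z h i - D z h' i)"
  using deriv_linear[of z m h' m'' h m' "-1"] by simp

text \<open>\<open>sc_deriv\<close> speaks of level 0; the higher levels come from the second half
  of the tangent map, which preserves levels.\<close>

lemma deriv_lev:
  assumes z: "z \<in> \<Omega> n s (Suc m)" and h: "h \<in> TZ n s m"
  shows "D z h \<in> TE n s m"
proof -
  have "tpair n z h \<in> \<Omega> (2 * n) (tshift n s) m"
    using tpair_in_\<Omega>_iff[OF is_sc1_width \<Omega>_TZ[OF z] h] z h by simp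
  then have "tmap n n g D (tpair n z h) \<in> TE (2 * n) (tshift n s) m"
    using C1 unfolding is_sc1_def sc0_map_def by blast
  moreover have "D z h \<in> TE n s 0" by (rule deriv_lev0[OF z]) (use h Z.tlev_mono[of 0 m n s] in auto)
  ultimately show ?thesis
    by (simp add: tpair_in_tlev_iff[OF is_sc1_lev[OF z]] tmap_tpair[OF \<Omega>_TZ[OF z] h])
qed

text \<open>Read off from continuity of the tangent map at \<open>(z0, h0)\<close>. The radius
  \<open>d\<close> depends on \<open>h0\<close>, so this is weaker than continuity of
  \<open>D\<close> in the operator norm.\<close>

lemma deriv_cont:
  assumes z0: "z0 \<in> \<Omega> n s (Suc m)" and h0: "h0 \<in> TZ n s m" and "\<epsilon> > 0"
  shows "\<exists>d>0. \<forall>z\<in>\<Omega> n s (Suc m). \<forall>h\<in>TZ n s m.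
    NZ n s (Suc m) (\<lambda>i. z i - z0 i) < d \<longrightarrow> NZ n s m (\<lambda>i. h i - h0 i) < d \<longrightarrow>
    NE n s m (\<lambda>i. D z h i - D z0 h0 i) < \<epsilon>"
proof -
  have p: "tpair n z h \<in> \<Omega> (2 * n) (tshift n s) m" if "z \<in> \<Omega> n s (Suc m)" "h \<in> TZ n s m" for z h
    using tpair_in_\<Omega>_iff[OF is_sc1_width \<Omega>_TZ[OF that(1)] that(2)] that by simp
  have "\<exists>d>0. \<forall>y\<in>\<Omega> (2 * n) (tshift n s) m.
      NZ (2 * n) (tshift n s) m (\<lambda>i. y i - tpair n z0 h0 i) < d \<longrightarrow>
      NE (2 * n) (tshift n s) m (\<lambda>i. tmap n n g D y i - tmap n n g D (tpair n z0 h0) i) < \<epsilon>"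
    using C1 p[OF z0 h0] \<open>\<epsilon> > 0\<close> unfolding is_sc1_def sc0_map_def by blast
  then obtain d where d: "d > 0" "\<And>y. y \<in> \<Omega> (2 * n) (tshift n s) m \<Longrightarrow>
      NZ (2 * n) (tshift n s) m (\<lambda>i. y i - tpair n z0 h0 i) < d \<Longrightarrow>
      NE (2 * n) (tshift n s) m (\<lambda>i. tmap n n g D y i - tmap n n g D (tpair n z0 h0) i) < \<epsilon>"
    by blast
  have "NE n s m (\<lambda>i. D z h i - D z0 h0 i) < \<epsilon>"
    if z: "z \<in> \<Omega> n s (Suc m)" and h: "h \<in> TZ n s m"
      and lt: "NZ n s (Suc m) (\<lambda>i. z i - z0 i) < d / 2" "NZ n s m (\<lambda>i. h i - h0 i) < d / 2" for z h
  proof -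
    have "NE (2 * n) (tshift n s) m (\<lambda>i. tmap n n g D (tpair n z h) i - tmap n n g D (tpair n z0 h0) i) < \<epsilon>"
      by (rule d(2)[OF p[OF z h]]) (use NZ_tpair_diff[OF \<Omega>_TZ[OF z] \<Omega>_TZ[OF z0] h h0] lt in simp)
    then have "NE n s (Suc m) (\<lambda>i. g z i - g z0 i) + NE n s m (\<lambda>i. D z h i - D z0 h0 i) < \<epsilon>"
      by (simp add: NE_tpair_diff[OF is_sc1_lev[OF z] is_sc1_lev[OF z0] deriv_lev[OF z h] deriv_lev[OF z0 h0]]
        tmap_tpair[OF \<Omega>_TZ[OF z] h] tmap_tpair[OF \<Omega>_TZ[OF z0] h0])
    moreover have "0 \<le> NE n s (Suc m) (\<lambda>i. g z i - g z0 i)"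
      by (intro tnorm_nonneg tlev_diff is_sc1_lev z z0)
    ultimately show ?thesis by simp
  qed
  then show ?thesis using d(1) by (intro exI[of _ "d / 2"]) auto
qed

lemma deriv_approx:
  assumes "z \<in> \<Omega> n s (Suc m)" "\<epsilon> > 0"
  shows "\<exists>d>0. \<forall>h. (\<lambda>i. z i + h i) \<in> \<Omega> n s 1 \<longrightarrow> NZ n s 1 h < d \<longrightarrow>
    NE n s 0 (\<lambda>i. g (\<lambda>j. z j + h j) i - g z i - D z h i) \<le> \<epsilon> * NZ n s 1 h"
proof -
  have "z \<in> \<Omega> n s 1" using \<Omega>_mono[OF _ assms(1), of 1] by simp
  then show ?thesis using C1 assms(2) unfolding is_sc1_def sc_deriv_def by blast
qed

lemma deriv_bounded:
  assumes "z \<in> \<Omega> n s (Suc m)"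
  shows "\<exists>C. \<forall>h\<in>TZ n s 0. NE n s 0 (D z h) \<le> C * NZ n s 0 h"
proof -
  have "z \<in> \<Omega> n s 1" using \<Omega>_mono[OF _ assms(1), of 1] by simp
  then show ?thesis using C1 unfolding is_sc1_def sc_deriv_def by blast
qed

text \<open>Along a line the increment \<open>h\<close> of \<open>sc_deriv\<close> is a multiple of
  the fixed direction \<open>\<eta>\<close>, so its level 1 norm is proportional to the time
  increment and an ordinary derivative results, though only in the norm of the type.\<close>

lemma has_vector_derivative_along_segment:
  assumes \<eta>: "\<eta> \<in> TZ n s (Suc m)"
    and seg: "\<And>t. t \<in> {0..1} \<Longrightarrow> (\<lambda>i. z i + t *\<^sub>R \<eta> i) \<in> \<Omega> n s (Suc m)"
    and i: "i < n" and t: "t \<in> {0..1}"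
  shows "((\<lambda>t. g (\<lambda>j. z j + t *\<^sub>R \<eta> j) i) has_vector_derivative D (\<lambda>j. z j + t *\<^sub>R \<eta> j) \<eta> i)
    (at t within {0..1})"
proof -
  have \<eta>1: "\<eta> \<in> TZ n s 1" using Z.tlev_mono[of 1 "Suc m" n s] \<eta> by auto
  define M where "M = NZ n s 1 \<eta>"
  have M: "M \<ge> 0" unfolding M_def by (rule Z.tnorm_nonneg[OF \<eta>1])
  obtain C where C: "C > 0" "\<And>x. x \<in> L (0 + s i) \<Longrightarrow> norm x \<le> C * N (0 + s i) x"
    using norm_le_level by blast
  define p where "p t = (\<lambda>j. z j + t *\<^sub>R \<eta> j)" for t
  note pt = seg[OF t, folded p_def]
  have p1: "p u \<in> \<Omega> n s 1" if "u \<in> {0..1}" for u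
    using \<Omega>_mono[OF _ seg[OF that], of 1] by (simp add: p_def)
  have "((\<lambda>u. g (p u) i) has_derivative (\<lambda>x. x *\<^sub>R D (p t) \<eta> i)) (at t within {0..1})"
    unfolding has_derivative_within_alt
  proof (intro conjI allI impI)
    show "bounded_linear (\<lambda>x. x *\<^sub>R D (p t) \<eta> i)" by (rule bounded_linear_scaleR_left)
    fix e :: real assume e: "e > 0"
    \<comment> \<open>\<open>C\<close> compares the norm of the type with that of level
      \<open>s i\<close>, and \<open>M\<close> is the level 1 length of \<open>\<eta>\<close>; the
      added 1 allows \<open>M = 0\<close>.\<close>
    define \<epsilon> where "\<epsilon> = e / (C * (M + 1))"
    have "M + 1 > 0" using M by simp
    then have \<epsilon>: "\<epsilon> > 0" "C * \<epsilon> * M \<le> e"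
      using e C(1) by (auto simp: \<epsilon>_def divide_le_eq)
    obtain d where d: "d > 0" "\<And>h. (\<lambda>i. p t i + h i) \<in> \<Omega> n s 1 \<Longrightarrow> NZ n s 1 h < d \<Longrightarrow>
        NE n s 0 (\<lambda>i. g (\<lambda>j. p t j + h j) i - g (p t) i - D (p t) h i) \<le> \<epsilon> * NZ n s 1 h"
      using deriv_approx[OF pt \<epsilon>(1)] by blast
    show "\<exists>d>0. \<forall>u\<in>{0..1}. norm (u - t) < d \<longrightarrow>
        norm (g (p u) i - g (p t) i - (u - t) *\<^sub>R D (p t) \<eta> i) \<le> e * norm (u - t)"
    proof (intro exI[of _ "d / (M + 1)"] conjI ballI impI)
      fix u :: real assume u: "u \<in> {0..1}" "norm (u - t) < d / (M + 1)"
      define h where "h = (\<lambda>j. (u - t) *\<^sub>R \<eta> j)"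
      have h: "h \<in> TZ n s 1" unfolding h_def by (rule Z.tlev_scale[OF \<eta>1])
      have ph: "(\<lambda>j. p t j + h j) = p u" by (simp add: p_def h_def algebra_simps)
      have nh: "NZ n s 1 h = \<bar>u - t\<bar> * M" unfolding h_def M_def by (rule Z.tnorm_scale[OF \<eta>1])
      have "\<bar>u - t\<bar> * M \<le> \<bar>u - t\<bar> * (M + 1)" by (simp add: mult_left_mono)
      also have "\<dots> < d" using u(2) M by (simp add: pos_less_divide_eq)
      finally have "NZ n s 1 h < d" unfolding nh .
      moreover have "(\<lambda>j. p t j + h j) \<in> \<Omega> n s 1" unfolding ph by (rule p1[OF u(1)])
      ultimately have lt: "NE n s 0 (\<lambda>i. g (p u) i - g (p t) i - D (p t) h i) \<le> \<epsilon> * NZ n s 1 h"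
        using d(2)[of h] unfolding ph by blast
      have Dh: "D (p t) h = (\<lambda>j. (u - t) *\<^sub>R D (p t) \<eta> j)"
        unfolding h_def by (rule deriv_scale[OF pt \<eta>1])
      have h0: "h \<in> TZ n s 0" using h Z.tlev_mono[of 0 1 n s] by auto
      have T: "(\<lambda>i. g (p u) i - g (p t) i - D (p t) h i) \<in> TE n s 0"
        by (intro tlev_diff is_sc1_lev deriv_lev0[OF pt h0] \<Omega>_mono[OF _ p1[OF u(1)]] \<Omega>_mono[OF _ p1[OF t]]) auto
      have "norm (g (p u) i - g (p t) i - D (p t) h i) \<le> C * N (0 + s i) (g (p u) i - g (p t) i - D (p t) h i)"
        by (rule C(2)) (rule tlev_D[OF T i])
      also have "\<dots> \<le> C * NE n s 0 (\<lambda>i. g (p u) i - g (p t) i - D (p t) h i)"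
        using tnorm_comp_le[OF T i] C(1) by (intro mult_left_mono) auto
      also have "\<dots> \<le> C * (\<epsilon> * (\<bar>u - t\<bar> * M))"
        using lt C(1) nh by (intro mult_left_mono) auto
      also have "\<dots> = (C * \<epsilon> * M) * \<bar>u - t\<bar>" by simp
      also have "\<dots> \<le> e * \<bar>u - t\<bar>" using \<epsilon>(2) by (rule mult_right_mono) simp
      finally show "norm (g (p u) i - g (p t) i - (u - t) *\<^sub>R D (p t) \<eta> i) \<le> e * norm (u - t)"
        by (simp add: Dh)
    qed (use d M in auto)
  qed
  then show ?thesis unfolding has_vector_derivative_def p_def .
qed

text \<open>\<open>level_mean_value\<close> is applied to each coordinate at its own level
  \<open>m + s i\<close>, and adding up the coordinates costs the factor \<open>n\<close>. The
  choice \<open>c = 0\<close> gives Lipschitz bounds; a value of the derivative as \<open>c\<close>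
  gives linearisation errors.\<close>

lemma sc1_mean_value:
  assumes \<eta>: "\<eta> \<in> TZ n s (Suc m)" and c: "c \<in> TE n s m"
    and seg: "\<And>t. t \<in> {0..1} \<Longrightarrow> (\<lambda>i. z i + t *\<^sub>R \<eta> i) \<in> \<Omega> n s (Suc m)"
    and bound: "\<And>t. t \<in> {0..1} \<Longrightarrow> NE n s m (\<lambda>i. D (\<lambda>i. z i + t *\<^sub>R \<eta> i) \<eta> i - c i) \<le> K"
  shows "NE n s m (\<lambda>i. g (\<lambda>i. z i + \<eta> i) i - g z i - c i) \<le> real n * K"
proof -
  have \<eta>m: "\<eta> \<in> TZ n s m" using Z.tlev_mono[of m "Suc m" n s] \<eta> by auto
  define p where "p t = (\<lambda>j. z j + t *\<^sub>R \<eta> j)" for t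
  note pL = seg[folded p_def]
  have p01: "p 0 = z" "p 1 = (\<lambda>i. z i + \<eta> i)" by (auto simp: p_def)
  have "N (m + s i) (g (p 1) i - g (p 0) i - c i) \<le> K" if i: "i < n" for i
  proof (rule level_mean_value[where \<phi> = "\<lambda>t. g (p t) i" and \<phi>' = "\<lambda>t. D (p t) \<eta> i"])
    fix t :: real assume t: "t \<in> {0..1}"
    show "((\<lambda>t. g (p t) i) has_vector_derivative D (p t) \<eta> i) (at t within {0..1})"
      unfolding p_def by (rule has_vector_derivative_along_segment[OF \<eta> seg i t])
    show "D (p t) \<eta> i \<in> L (m + s i)" by (rule tlev_D[OF deriv_lev[OF pL[OF t] \<eta>m] i])
    have T: "(\<lambda>i. D (p t) \<eta> i - c i) \<in> TE n s m" by (intro tlev_diff deriv_lev[OF pL[OF t] \<eta>m] c)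
    show "N (m + s i) (D (p t) \<eta> i - c i) \<le> K"
      using tnorm_comp_le[OF T i] bound[OF t] by (simp add: p_def)
    fix \<epsilon> :: real assume "\<epsilon> > 0"
    then obtain d where d: "d > 0" "\<And>z. z \<in> \<Omega> n s (Suc m) \<Longrightarrow>
      NZ n s (Suc m) (\<lambda>i. z i - p t i) < d \<Longrightarrow> NE n s m (\<lambda>i. D z \<eta> i - D (p t) \<eta> i) < \<epsilon>"
      using deriv_cont[OF pL[OF t] \<eta>m, of \<epsilon>] \<eta>m by fastforce
    define M where "M = NZ n s (Suc m) \<eta>"
    have M: "M \<ge> 0" unfolding M_def by (rule Z.tnorm_nonneg[OF \<eta>])
    show "\<exists>d>0. \<forall>u\<in>{0..1}. \<bar>u - t\<bar> < d \<longrightarrow> N (m + s i) (D (p u) \<eta> i - D (p t) \<eta> i) < \<epsilon>"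
    proof (intro exI[of _ "d / (M + 1)"] conjI ballI impI)
      fix u :: real assume u: "u \<in> {0..1}" "\<bar>u - t\<bar> < d / (M + 1)"
      have "(\<lambda>i. p u i - p t i) = (\<lambda>i. (u - t) *\<^sub>R \<eta> i)" by (simp add: p_def algebra_simps)
      then have "NZ n s (Suc m) (\<lambda>i. p u i - p t i) = \<bar>u - t\<bar> * M"
        unfolding M_def by (simp add: Z.tnorm_scale[OF \<eta>])
      also have "\<dots> \<le> \<bar>u - t\<bar> * (M + 1)" by (simp add: mult_left_mono)
      also have "\<dots> < d" using u(2) M by (simp add: pos_less_divide_eq)
      finally have "NE n s m (\<lambda>i. D (p u) \<eta> i - D (p t) \<eta> i) < \<epsilon>" using d(2) pL[OF u(1)] by blast
      moreover have "(\<lambda>i. D (p u) \<eta> i - D (p t) \<eta> i) \<in> TE n s m"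
        by (intro tlev_diff deriv_lev \<eta>m pL u t)
      ultimately show "N (m + s i) (D (p u) \<eta> i - D (p t) \<eta> i) < \<epsilon>"
        using tnorm_comp_le[OF _ i] by fastforce
    qed (use d M in auto)
  qed (use c i in \<open>auto simp: tlev_def\<close>)
  then have "(\<Sum>i<n. N (m + s i) (g (p 1) i - g (p 0) i - c i)) \<le> (\<Sum>i<n. K)"
    by (intro sum_mono) auto
  then show ?thesis by (simp add: tnorm_def p01)
qed

end

text \<open>Joint continuity at \<open>(z0, 0)\<close> bounds \<open>D z h\<close> by 1 for small
  \<open>h\<close>, and homogeneity turns this into a bound on the operator norms that is uniform in
  \<open>z\<close>.\<close>

lemma deriv_locally_bounded:
  assumes C1: "is_sc1 n s g D" and z0: "z0 \<in> \<Omega> n s (Suc m)"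
  shows "\<exists>r>0. \<exists>C>0. \<forall>z\<in>\<Omega> n s (Suc m). NZ n s (Suc m) (\<lambda>i. z i - z0 i) < r \<longrightarrow>
    (\<forall>h\<in>TZ n s m. NE n s m (D z h) \<le> C * NZ n s m h)"
proof -
  obtain d where d: "d > 0" "\<And>z h. z \<in> \<Omega> n s (Suc m) \<Longrightarrow> h \<in> TZ n s m \<Longrightarrow>
    NZ n s (Suc m) (\<lambda>i. z i - z0 i) < d \<Longrightarrow> NZ n s m (\<lambda>i. h i - 0) < d \<Longrightarrow>
    NE n s m (\<lambda>i. D z h i - D z0 (\<lambda>i. 0) i) < 1"
    using deriv_cont[OF C1 z0 Z.tlev_0, of 1] by (simp del: diff_0_right) blast
  have "NE n s m (D z h) \<le> 2 / d * NZ n s m h"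
    if z: "z \<in> \<Omega> n s (Suc m)" "NZ n s (Suc m) (\<lambda>i. z i - z0 i) < d" and h: "h \<in> TZ n s m" for z h
  proof (cases "NZ n s m h = 0")
    case True
    then have "h = (\<lambda>i. 0)" using Z.tnorm_eq_0_D[OF h] by simp
    then show ?thesis using deriv_zero[OF C1 z(1)] by simp
  next
    case False
    define M where "M = NZ n s m h"
    have M: "M > 0" using False Z.tnorm_nonneg[OF h] by (simp add: M_def)
    \<comment> \<open>Rescales \<open>h\<close> to length \<open>d / 2\<close>, inside the ball
      where the derivative is bounded by 1; this is the source of the constant
      \<open>2 / d\<close>.\<close>
    define a where "a = d / (2 * M)"
    have a: "a > 0" using d M by (simp add: a_def)
    have "NZ n s m (\<lambda>i. a *\<^sub>R h i) = d / 2"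
      using Z.tnorm_scale[OF h, of a] a M by (simp add: M_def[symmetric]) (simp add: a_def)
    then have "NE n s m (D z (\<lambda>i. a *\<^sub>R h i)) < 1"
      using d(2)[OF z(1) Z.tlev_scale[OF h, of a] z(2)] d(1) deriv_zero[OF C1 z0] by simp
    then have "a * NE n s m (D z h) < 1"
      using deriv_scale[OF C1 z(1) h] tnorm_scale[OF deriv_lev[OF C1 z(1) h], of a] a by simp
    then have "NE n s m (D z h) < 1 / a" using a by (simp add: field_simps)
    also have "1 / a = 2 / d * M" by (simp add: a_def)
    finally show ?thesis by (simp add: M_def)
  qed
  then show ?thesis using d(1) by (intro exI[of _ d] exI[of _ "2 / d"] conjI) auto
qed

text \<open>Membership of the base point in \<open>U (m + s 0)\<close> is what puts the graph of
  \<open>d\<close> into \<open>\<Omega>\<close> at every level.\<close>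

definition solution :: "nat \<Rightarrow> (nat \<Rightarrow> nat) \<Rightarrow> nat \<Rightarrow> ((nat \<Rightarrow> 'v \<times> 'e) \<Rightarrow> nat \<Rightarrow> 'e) \<Rightarrow>
    ((nat \<Rightarrow> 'v) \<Rightarrow> nat \<Rightarrow> 'e) \<Rightarrow> bool" where
  "solution n s c g d \<longleftrightarrow> n \<ge> 1 \<and>
    sc0_map const_lev const_norm n s L N n s (X c n s) d \<and>
    (\<forall>m. \<forall>x\<in>X c n s m. (x 0, d x 0) \<in> U (m + s 0)) \<and>
    (\<forall>x\<in>X c n s 0. g (fun_zip x (d x)) = (\<lambda>i. 0))"

text \<open>Substitute for the invertibility of the partial derivative in the fibre direction: unlike
  the contraction property, it is inherited by the tangent equation.\<close>

definition inj_estimate :: "nat \<Rightarrow> (nat \<Rightarrow> nat) \<Rightarrow> nat \<Rightarrow> ((nat \<Rightarrow> 'v \<times> 'e) \<Rightarrow> nat \<Rightarrow> 'e) \<Rightarrow>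
    ((nat \<Rightarrow> 'v) \<Rightarrow> nat \<Rightarrow> 'e) \<Rightarrow> bool" where
  "inj_estimate n s c g d \<longleftrightarrow> (\<forall>m. \<forall>x0\<in>X c n s (Suc m). \<exists>r>0. \<exists>C>0. \<forall>x y y'.
    fun_zip x y \<in> \<Omega> n s (Suc m) \<longrightarrow> fun_zip x y' \<in> \<Omega> n s (Suc m) \<longrightarrow>
    NZ n s (Suc m) (\<lambda>i. fun_zip x y i - fun_zip x0 (d x0) i) < r \<longrightarrow>
    NZ n s (Suc m) (\<lambda>i. fun_zip x y' i - fun_zip x0 (d x0) i) < r \<longrightarrow>
    NE n s m (\<lambda>i. y i - y' i) \<le> C * NE n s m (\<lambda>i. g (fun_zip x y) i - g (fun_zip x y') i))"

lemma solution_lev: "solution n s c g d \<Longrightarrow> x \<in> X c n s m \<Longrightarrow> d x \<in> TE n s m"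
  unfolding solution_def sc0_map_def by blast

lemma solution_in_\<Omega>:
  assumes "solution n s c g d" "x \<in> X c n s m"
  shows "fun_zip x (d x) \<in> \<Omega> n s m"
  using solution_lev[OF assms] X_TV[OF assms(2), of s m] assms
  by (simp add: base_dom_def fun_zip_in_sum_lev_iff solution_def)

lemma solution_zero: "solution n s c g d \<Longrightarrow> x \<in> X c n s m \<Longrightarrow> g (fun_zip x (d x)) = (\<lambda>i. 0)"
  using X_mono[of 0 m x] unfolding solution_def by simp

lemma solution_cont:
  assumes "solution n s c g d" "x0 \<in> X c n s m" "\<epsilon> > 0"
  shows "\<exists>\<delta>>0. \<forall>x\<in>X c n s m. NV n s m (\<lambda>i. x i - x0 i) < \<delta> \<longrightarrow> NE n s m (\<lambda>i. d x i - d x0 i) < \<epsilon>"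
  using assms unfolding solution_def sc0_map_def by blast

lemma graph_cont:
  assumes "solution n s c g d" "x0 \<in> X c n s m" "\<epsilon> > 0"
  shows "\<exists>\<delta>>0. \<forall>x\<in>X c n s m. NV n s m (\<lambda>i. x i - x0 i) < \<delta> \<longrightarrow>
    NZ n s m (\<lambda>i. fun_zip x (d x) i - fun_zip x0 (d x0) i) < \<epsilon>"
proof -
  obtain \<delta> where "\<delta> > 0" "\<And>x. x \<in> X c n s m \<Longrightarrow> NV n s m (\<lambda>i. x i - x0 i) < \<delta> \<Longrightarrow>
      NE n s m (\<lambda>i. d x i - d x0 i) < \<epsilon> / 2"
    using solution_cont[OF assms(1,2), of "\<epsilon> / 2"] assms(3) by auto
  then show ?thesis
    using assms(3) unfolding tnorm_fun_zip_diff
    by (intro exI[of _ "min \<delta> (\<epsilon> / 2)"]) force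
qed

lemma fun_zip_0_in_TZ: "k \<in> TE n s m \<Longrightarrow> fun_zip (\<lambda>i. 0) k \<in> TZ n s m"
  by (simp add: fun_zip_in_sum_lev_iff)

section \<open>Consequences of the fibre estimate\<close>

context
  fixes n s g D c d
  assumes C1: "is_sc1 n s g D" and sol: "solution n s c g d" and inj: "inj_estimate n s c g d"
begin

text \<open>The infinitesimal form of \<open>inj_estimate\<close>: the estimate is applied to
  \<open>z\<close> and \<open>z + \<tau> \<eta>\<close> with a small step \<open>\<tau>\<close> in a
  fibre direction \<open>\<eta>\<close>, and the result is divided by \<open>\<tau>\<close>. The
  constant \<open>C\<close> is inherited.\<close>

lemma deriv_fibre_bounded_below:
  assumes x0: "x0 \<in> X c n s (Suc m)"
  shows "\<exists>r>0. \<exists>C>0. \<forall>x y. fun_zip x y \<in> \<Omega> n s (Suc m) \<longrightarrow>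
    NZ n s (Suc m) (\<lambda>i. fun_zip x y i - fun_zip x0 (d x0) i) < r \<longrightarrow>
    (\<forall>k\<in>TE n s m. NE n s m k \<le> C * NE n s m (D (fun_zip x y) (fun_zip (\<lambda>i. 0) k)))"
proof -
  define z0 where "z0 = fun_zip x0 (d x0)"
  have z0: "z0 \<in> \<Omega> n s (Suc m)" unfolding z0_def by (rule solution_in_\<Omega>[OF sol x0])
  obtain r C where r: "r > 0" "C > 0" and est: "\<And>x y y'. fun_zip x y \<in> \<Omega> n s (Suc m) \<Longrightarrow>
    fun_zip x y' \<in> \<Omega> n s (Suc m) \<Longrightarrow>
    NZ n s (Suc m) (\<lambda>i. fun_zip x y i - z0 i) < r \<Longrightarrow>
    NZ n s (Suc m) (\<lambda>i. fun_zip x y' i - z0 i) < r \<Longrightarrow>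
    NE n s m (\<lambda>i. y i - y' i) \<le> C * NE n s m (\<lambda>i. g (fun_zip x y) i - g (fun_zip x y') i)"
    using inj x0 unfolding inj_estimate_def z0_def by meson
  have n: "n \<ge> 1" by (rule is_sc1_width[OF C1])
  have "NE n s m k \<le> C * NE n s m (D (fun_zip x y) (fun_zip (\<lambda>i. 0) k))"
    if z: "fun_zip x y \<in> \<Omega> n s (Suc m)" and near: "NZ n s (Suc m) (\<lambda>i. fun_zip x y i - z0 i) < r"
      and k: "k \<in> TE n s m" for x y k
  proof -
    define z where "z = fun_zip x y"
    note z = z[folded z_def] and near = near[folded z_def]
    \<comment> \<open>The points \<open>z + t \<tau> \<eta>\<close> must have level
      \<open>Suc m\<close>, so \<open>k\<close> is first taken from that level.\<close>
    have main: "NE n s m k \<le> C * NE n s m (D z (fun_zip (\<lambda>i. 0) k)) + e"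
      if k: "k \<in> TE n s (Suc m)" and e: "e > 0" for k e
    proof -
      define \<eta> where "\<eta> = fun_zip (\<lambda>i. 0 :: 'v) k"
      have \<eta>: "\<eta> \<in> TZ n s (Suc m)" unfolding \<eta>_def by (rule fun_zip_0_in_TZ[OF k])
      have \<eta>m: "\<eta> \<in> TZ n s m" using \<eta> Z.tlev_mono[of m "Suc m" n s] by auto
      have km: "k \<in> TE n s m" using k tlev_mono[of m "Suc m" n s] by auto
      define M where "M = NZ n s (Suc m) \<eta>"
      have M: "M \<ge> 0" unfolding M_def by (rule Z.tnorm_nonneg[OF \<eta>])
      obtain r2 where r2: "r2 > 0" "\<And>w. w \<in> TZ n s (Suc m) \<Longrightarrow> fst (w 0) \<in> V \<Longrightarrow>
          NZ n s (Suc m) (\<lambda>i. w i - z i) < r2 \<Longrightarrow> w \<in> \<Omega> n s (Suc m)"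
        using \<Omega>_open[OF n z] by blast
      \<comment> \<open>Offsets the factor \<open>n\<close> of the mean value inequality and the
        constant \<open>C\<close> of the estimate.\<close>
      define \<epsilon> where "\<epsilon> = e / (C * real n)"
      have \<epsilon>: "\<epsilon> > 0" "C * (real n * \<epsilon>) = e" using e r n by (auto simp: \<epsilon>_def)
      obtain \<rho> where \<rho>: "\<rho> > 0" "\<And>w. w \<in> \<Omega> n s (Suc m) \<Longrightarrow>
          NZ n s (Suc m) (\<lambda>i. w i - z i) < \<rho> \<Longrightarrow> NE n s m (\<lambda>i. D w \<eta> i - D z \<eta> i) < \<epsilon>"
        using deriv_cont[OF C1 z \<eta>m \<epsilon>(1)] \<eta>m by fastforce
      \<comment> \<open>Below this length the step stays in the ball of the estimate, in
        \<open>\<Omega>\<close>, and where \<open>D\<close> changes by less than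
        \<open>\<epsilon>\<close> along \<open>\<eta>\<close>.\<close>
      define \<mu> where "\<mu> = min (min (r - NZ n s (Suc m) (\<lambda>i. z i - z0 i)) r2) \<rho>"
      have \<mu>: "\<mu> > 0" using near r2 \<rho> by (simp add: \<mu>_def)
      define \<tau> where "\<tau> = \<mu> / (2 * (M + 1))"
      have \<tau>: "\<tau> > 0" using \<mu> M by (simp add: \<tau>_def)
      have \<tau>M: "\<tau> * M < \<mu>"
      proof -
        have "\<tau> * M \<le> \<tau> * (M + 1)" using \<tau> by simp
        also have "\<dots> = \<mu> / 2" using M by (simp add: \<tau>_def field_simps)
        also have "\<dots> < \<mu>" using \<mu> by simp
        finally show ?thesis .
      qed
      define p where "p t = (\<lambda>i. z i + t *\<^sub>R (\<tau> *\<^sub>R \<eta> i))" for t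
      have pd: "NZ n s (Suc m) (\<lambda>i. p t i - z i) < \<mu>" if "t \<in> {0..1}" for t
      proof -
        have "(\<lambda>i. p t i - z i) = (\<lambda>i. (t * \<tau>) *\<^sub>R \<eta> i)" by (simp add: p_def)
        then have "NZ n s (Suc m) (\<lambda>i. p t i - z i) = (t * \<tau>) * M"
          using Z.tnorm_scale[OF \<eta>, of "t * \<tau>"] that \<tau> by (simp add: M_def abs_mult)
        also have "\<dots> \<le> \<tau> * M" using that \<tau> M by (simp add: mult_right_mono mult_left_le_one_le)
        finally show ?thesis using \<tau>M by simp
      qed
      have p\<Omega>: "p t \<in> \<Omega> n s (Suc m)" if "t \<in> {0..1}" for t
      proof (rule r2(2))
        show "p t \<in> TZ n s (Suc m)"
          unfolding p_def by (intro Z.tlev_add Z.tlev_scale \<Omega>_TZ[OF z] \<eta>)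
        show "fst (p t 0) \<in> V" using \<Omega>_V[OF z] by (simp add: p_def \<eta>_def)
        show "NZ n s (Suc m) (\<lambda>i. p t i - z i) < r2" using pd[OF that] by (simp add: \<mu>_def)
      qed
      have D\<eta>: "D w (\<lambda>i. \<tau> *\<^sub>R \<eta> i) = (\<lambda>i. \<tau> *\<^sub>R D w \<eta> i)" if "w \<in> \<Omega> n s (Suc m)" for w
        by (rule deriv_scale[OF C1 that \<eta>])
      have "NE n s m (\<lambda>i. g (\<lambda>i. z i + \<tau> *\<^sub>R \<eta> i) i - g z i - \<tau> *\<^sub>R D z \<eta> i) \<le> real n * (\<tau> * \<epsilon>)"
      proof (rule sc1_mean_value[OF C1])
        show "(\<lambda>i. \<tau> *\<^sub>R \<eta> i) \<in> TZ n s (Suc m)" by (rule Z.tlev_scale[OF \<eta>])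
        show "(\<lambda>i. \<tau> *\<^sub>R D z \<eta> i) \<in> TE n s m" by (intro tlev_scale deriv_lev[OF C1 z] \<eta>m)
        fix t :: real assume t: "t \<in> {0..1}"
        show "(\<lambda>i. z i + t *\<^sub>R \<tau> *\<^sub>R \<eta> i) \<in> \<Omega> n s (Suc m)" using p\<Omega>[OF t] by (simp add: p_def)
        have "NE n s m (\<lambda>i. \<tau> *\<^sub>R (D (p t) \<eta> i - D z \<eta> i)) = \<tau> * NE n s m (\<lambda>i. D (p t) \<eta> i - D z \<eta> i)"
          using tnorm_scale[OF tlev_diff[OF deriv_lev[OF C1 p\<Omega>[OF t] \<eta>m] deriv_lev[OF C1 z \<eta>m]], of \<tau>] \<tau> by simp
        also have "\<dots> \<le> \<tau> * \<epsilon>"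
          using \<rho>(2)[OF p\<Omega>[OF t]] pd[OF t] \<tau> by (intro mult_left_mono) (auto simp: \<mu>_def)
        finally show "NE n s m (\<lambda>i. D (\<lambda>i. z i + t *\<^sub>R \<tau> *\<^sub>R \<eta> i) (\<lambda>i. \<tau> *\<^sub>R \<eta> i) i - \<tau> *\<^sub>R D z \<eta> i) \<le> \<tau> * \<epsilon>"
          using D\<eta>[OF p\<Omega>[OF t]] by (simp add: p_def scaleR_diff_right)
      qed
      note mv = this
      have p1: "(\<lambda>i. z i + \<tau> *\<^sub>R \<eta> i) = fun_zip x (\<lambda>i. y i + \<tau> *\<^sub>R k i)"
        by (simp add: z_def \<eta>_def fun_zip_def)
      define w where "w = fun_zip x (\<lambda>i. y i + \<tau> *\<^sub>R k i)"
      have wp: "w = p 1" by (simp add: w_def p1[symmetric] p_def)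
      have w: "w \<in> \<Omega> n s (Suc m)" unfolding wp by (rule p\<Omega>) simp
      have wn: "NZ n s (Suc m) (\<lambda>i. w i - z0 i) < r"
      proof -
        have "NZ n s (Suc m) (\<lambda>i. w i - z0 i) \<le> NZ n s (Suc m) (\<lambda>i. w i - z i) + NZ n s (Suc m) (\<lambda>i. z i - z0 i)"
          by (intro Z.tnorm_diff_triangle \<Omega>_TZ w z z0)
        also have "\<dots> < r" using pd[of 1] by (simp add: wp \<mu>_def)
        finally show ?thesis .
      qed
      have mv: "NE n s m (\<lambda>i. g w i - g z i - \<tau> *\<^sub>R D z \<eta> i) \<le> real n * (\<tau> * \<epsilon>)"
        using mv unfolding w_def p1 .
      have gw: "(\<lambda>i. g w i - g z i) \<in> TE n s m"
        by (intro tlev_diff is_sc1_lev[OF C1] \<Omega>_mono[OF _ w] \<Omega>_mono[OF _ z]) auto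
      have Dz: "(\<lambda>i. \<tau> *\<^sub>R D z \<eta> i) \<in> TE n s m" by (intro tlev_scale deriv_lev[OF C1 z] \<eta>m)
      have "NE n s m (\<lambda>i. g w i - g z i) \<le> real n * (\<tau> * \<epsilon>) + \<tau> * NE n s m (D z \<eta>)"
        using tnorm_triangle[OF tlev_diff[OF gw Dz] Dz] mv tnorm_scale[OF deriv_lev[OF C1 z \<eta>m], of \<tau>] \<tau> by simp
      then have "C * NE n s m (\<lambda>i. g w i - g z i) \<le> C * (real n * (\<tau> * \<epsilon>) + \<tau> * NE n s m (D z \<eta>))"
        using r by (intro mult_left_mono) auto
      moreover have "\<tau> * NE n s m k \<le> C * NE n s m (\<lambda>i. g w i - g z i)"
      proof -
        have "NE n s m (\<lambda>i. (y i + \<tau> *\<^sub>R k i) - y i) \<le> C * NE n s m (\<lambda>i. g w i - g z i)"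
          unfolding w_def z_def
          by (rule est) (use w z wn near in \<open>auto simp: w_def z_def\<close>)
        then show ?thesis using tnorm_scale[OF km, of \<tau>] \<tau> by simp
      qed
      ultimately have "\<tau> * NE n s m k \<le> \<tau> * (C * NE n s m (D z \<eta>) + C * (real n * \<epsilon>))"
        by (simp add: algebra_simps)
      then show ?thesis using \<tau> \<epsilon>(2) by (simp add: \<eta>_def)
    qed
    show ?thesis
    \<comment> \<open>A general \<open>k\<close> is approximated by \<open>k'\<close> of level
      \<open>Suc m\<close>. Three errors of size \<open>e / 3\<close> arise: from replacing
      \<open>k\<close>, from \<open>main\<close>, and from the change of \<open>D z\<close>, which
      is multiplied by \<open>C\<close>.\<close>
    proof (rule field_le_epsilon)
      fix e :: real assume e: "e > 0"
      define h where "h k = fun_zip (\<lambda>i. 0 :: 'v) (k :: nat \<Rightarrow> 'e)" for k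
      have h: "h k' \<in> TZ n s m" if "k' \<in> TE n s m" for k' unfolding h_def by (rule fun_zip_0_in_TZ[OF that])
      obtain \<delta> where \<delta>: "\<delta> > 0" "\<And>h'. h' \<in> TZ n s m \<Longrightarrow> NZ n s m (\<lambda>i. h' i - h k i) < \<delta> \<Longrightarrow>
          NE n s m (\<lambda>i. D z h' i - D z (h k) i) < e / (3 * C)"
        using deriv_cont[OF C1 z h[OF k], of "e / (3 * C)"] e r z by fastforce
      obtain k' where k': "k' \<in> TE n s (Suc m)" "NE n s m (\<lambda>i. k' i - k i) < min \<delta> (e / 3)"
        using tlev_dense[OF k, of "min \<delta> (e / 3)"] \<delta> e by auto
      have k'm: "k' \<in> TE n s m" using k'(1) tlev_mono[of m "Suc m" n s] by auto
      have "NZ n s m (\<lambda>i. h k' i - h k i) < \<delta>"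
        using k'(2) unfolding h_def tnorm_fun_zip_diff by simp
      then have 1: "NE n s m (\<lambda>i. D z (h k') i - D z (h k) i) < e / (3 * C)" by (rule \<delta>(2)[OF h[OF k'm]])
      have "NE n s m (D z (h k')) \<le> NE n s m (\<lambda>i. D z (h k') i - D z (h k) i) + NE n s m (D z (h k))"
        using tnorm_triangle[OF tlev_diff[OF deriv_lev[OF C1 z h[OF k'm]] deriv_lev[OF C1 z h[OF k]]] deriv_lev[OF C1 z h[OF k]]]
        by simp
      then have "C * NE n s m (D z (h k')) \<le> C * (e / (3 * C) + NE n s m (D z (h k)))"
        using 1 r by (intro mult_left_mono) auto
      also have "\<dots> = e / 3 + C * NE n s m (D z (h k))" using r by (simp add: field_simps)
      finally have 2: "C * NE n s m (D z (h k')) \<le> e / 3 + C * NE n s m (D z (h k))" .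
      have 3: "NE n s m k' \<le> C * NE n s m (D z (h k')) + e / 3"
        unfolding h_def by (rule main[OF k'(1)]) (use e in simp)
      have "NE n s m k \<le> NE n s m (\<lambda>i. k i - k' i) + NE n s m k'"
        using tnorm_triangle[OF tlev_diff[OF k k'm] k'm] by simp
      also have "NE n s m (\<lambda>i. k i - k' i) \<le> e / 3"
        using k'(2) tnorm_minus_commute[OF k k'm] by simp
      finally show "NE n s m k \<le> C * NE n s m (D (fun_zip x y) (fun_zip (\<lambda>i. 0) k)) + e"
        using 2 3 by (simp add: h_def z_def)
    qed
  qed
  then show ?thesis using r unfolding z0_def by blast
qed

text \<open>The points \<open>z = (x, d x)\<close> and \<open>z' = (x', d x')\<close> are compared
  through \<open>w = (x', d x)\<close>. The fibre estimate bounds \<open>d x - d x'\<close> by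
  \<open>g w - g z'\<close>, which equals \<open>g w - g z\<close>. The direction
  \<open>w - z\<close> is a pure parameter direction, whose norm is the same at every level, so the
  mean value inequality finishes the proof.\<close>

lemma solution_Lipschitz:
  assumes x0: "x0 \<in> X c n s (Suc m)"
  shows "\<exists>r>0. \<exists>K>0. \<forall>x\<in>X c n s (Suc m). \<forall>x'\<in>X c n s (Suc m).
    NV n s m (\<lambda>i. x i - x0 i) < r \<longrightarrow> NV n s m (\<lambda>i. x' i - x0 i) < r \<longrightarrow>
    NE n s m (\<lambda>i. d x i - d x' i) \<le> K * NV n s m (\<lambda>i. x i - x' i)"
proof -
  define z0 where "z0 = fun_zip x0 (d x0)"
  have z0: "z0 \<in> \<Omega> n s (Suc m)" unfolding z0_def by (rule solution_in_\<Omega>[OF sol x0])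
  have n: "n \<ge> 1" by (rule is_sc1_width[OF C1])
  obtain r1 C where r1: "r1 > 0" "C > 0" and est: "\<And>x y y'. fun_zip x y \<in> \<Omega> n s (Suc m) \<Longrightarrow>
    fun_zip x y' \<in> \<Omega> n s (Suc m) \<Longrightarrow>
    NZ n s (Suc m) (\<lambda>i. fun_zip x y i - z0 i) < r1 \<Longrightarrow>
    NZ n s (Suc m) (\<lambda>i. fun_zip x y' i - z0 i) < r1 \<Longrightarrow>
    NE n s m (\<lambda>i. y i - y' i) \<le> C * NE n s m (\<lambda>i. g (fun_zip x y) i - g (fun_zip x y') i)"
    using inj x0 unfolding inj_estimate_def z0_def by meson
  obtain r2 B where r2: "r2 > 0" "B > 0" "\<And>z h. z \<in> \<Omega> n s (Suc m) \<Longrightarrow>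
    NZ n s (Suc m) (\<lambda>i. z i - z0 i) < r2 \<Longrightarrow> h \<in> TZ n s m \<Longrightarrow> NE n s m (D z h) \<le> B * NZ n s m h"
    using deriv_locally_bounded[OF C1 z0] by meson
  obtain r3 where r3: "r3 > 0" "\<And>z z' t. z \<in> TZ n s (Suc m) \<Longrightarrow> z' \<in> TZ n s (Suc m) \<Longrightarrow>
    fst (z 0) \<in> V \<Longrightarrow> fst (z' 0) \<in> V \<Longrightarrow>
    NZ n s (Suc m) (\<lambda>i. z i - z0 i) < r3 \<Longrightarrow> NZ n s (Suc m) (\<lambda>i. z' i - z0 i) < r3 \<Longrightarrow> t \<in> {0..1} \<Longrightarrow>
    (\<lambda>i. z i + t *\<^sub>R (z' i - z i)) \<in> \<Omega> n s (Suc m) \<and>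
      NZ n s (Suc m) (\<lambda>i. (z i + t *\<^sub>R (z' i - z i)) - z0 i)
        \<le> max (NZ n s (Suc m) (\<lambda>i. z i - z0 i)) (NZ n s (Suc m) (\<lambda>i. z' i - z0 i))"
    using \<Omega>_segment[OF n z0] by meson
  define \<rho> where "\<rho> = min r1 (min r2 r3)"
  have \<rho>: "\<rho> > 0" using r1 r2 r3 by (simp add: \<rho>_def)
  obtain \<delta> where \<delta>: "\<delta> > 0" "\<And>x. x \<in> X c n s (Suc m) \<Longrightarrow> NV n s (Suc m) (\<lambda>i. x i - x0 i) < \<delta> \<Longrightarrow>
      NE n s (Suc m) (\<lambda>i. d x i - d x0 i) < \<rho> / 2"
    using solution_cont[OF sol x0, of "\<rho> / 2"] \<rho> by auto
  \<comment> \<open>One half of \<open>\<rho>\<close> is for the parameter, the other for the fibre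
    part.\<close>
  define r where "r = min \<delta> (\<rho> / 2)"
  have "NE n s m (\<lambda>i. d x i - d x' i) \<le> C * (real n * B) * NV n s m (\<lambda>i. x i - x' i)"
    if x: "x \<in> X c n s (Suc m)" "NV n s m (\<lambda>i. x i - x0 i) < r"
      and x': "x' \<in> X c n s (Suc m)" "NV n s m (\<lambda>i. x' i - x0 i) < r" for x x'
  proof -
    define z where "z = fun_zip x (d x)"
    define w where "w = fun_zip x' (d x)"
    define z' where "z' = fun_zip x' (d x')"
    have nv: "NV n s (Suc m) (\<lambda>i. x i - x0 i) < r" "NV n s (Suc m) (\<lambda>i. x' i - x0 i) < r"
      using x(2) x'(2) by (simp_all add: tnorm_const_eq[of n s "Suc m" _ s m])
    have z: "z \<in> \<Omega> n s (Suc m)" "z' \<in> \<Omega> n s (Suc m)"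
      unfolding z_def z'_def by (intro solution_in_\<Omega>[OF sol] x x')+
    have w: "w \<in> TZ n s (Suc m)"
      unfolding w_def fun_zip_in_sum_lev_iff using solution_lev[OF sol x(1)] X_TV[OF x'(1)] by simp
    have wV: "fst (w 0) \<in> V" using X_V[OF x'(1)] by (simp add: w_def)
    have near: "NZ n s (Suc m) (\<lambda>i. z i - z0 i) < \<rho>" "NZ n s (Suc m) (\<lambda>i. w i - z0 i) < \<rho>"
        "NZ n s (Suc m) (\<lambda>i. z' i - z0 i) < \<rho>"
      unfolding z_def z'_def w_def z0_def tnorm_fun_zip_diff
      using nv \<delta>(2)[OF x(1)] \<delta>(2)[OF x'(1)] by (auto simp: r_def)
    define \<eta> where "\<eta> = (\<lambda>i. w i - z i)"
    have \<eta>eq: "\<eta> = fun_zip (\<lambda>i. x' i - x i) (\<lambda>i. 0)"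
      by (simp add: \<eta>_def w_def z_def fun_zip_def)
    have \<eta>: "\<eta> \<in> TZ n s (Suc m)" unfolding \<eta>_def by (intro Z.tlev_diff w \<Omega>_TZ z)
    have \<eta>m: "\<eta> \<in> TZ n s m" using \<eta> Z.tlev_mono[of m "Suc m" n s] by auto
    have N\<eta>: "NZ n s m \<eta> = NV n s m (\<lambda>i. x i - x' i)"
      unfolding \<eta>eq tnorm_fun_zip using P.tnorm_minus_commute[OF X_TV[OF x(1)] X_TV[OF x'(1)]] by simp
    have seg: "(\<lambda>i. z i + t *\<^sub>R \<eta> i) \<in> \<Omega> n s (Suc m) \<and> NZ n s (Suc m) (\<lambda>i. (z i + t *\<^sub>R \<eta> i) - z0 i) < \<rho>"
      if "t \<in> {0..1}" for t
      using r3(2)[OF \<Omega>_TZ[OF z(1)] w \<Omega>_V[OF z(1)] wV _ _ that] near unfolding \<eta>_def by (auto simp: \<rho>_def)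
    have w\<Omega>: "w \<in> \<Omega> n s (Suc m)" using seg[of 1] by (simp add: \<eta>_def)
    have "NE n s m (\<lambda>i. g (\<lambda>i. z i + \<eta> i) i - g z i - (\<lambda>i. 0) i) \<le> real n * (B * NZ n s m \<eta>)"
    proof (rule sc1_mean_value[OF C1 \<eta> tlev_0])
      fix t :: real assume t: "t \<in> {0..1}"
      show "(\<lambda>i. z i + t *\<^sub>R \<eta> i) \<in> \<Omega> n s (Suc m)" using seg[OF t] by simp
      show "NE n s m (\<lambda>i. D (\<lambda>i. z i + t *\<^sub>R \<eta> i) \<eta> i - (\<lambda>i. 0) i) \<le> B * NZ n s m \<eta>"
        using r2(3)[of "\<lambda>i. z i + t *\<^sub>R \<eta> i", OF _ _ \<eta>m] seg[OF t] by (simp add: \<rho>_def)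
    qed
    moreover have "g z = (\<lambda>i. 0)" "g z' = (\<lambda>i. 0)"
      unfolding z_def z'_def by (rule solution_zero[OF sol] x x')+
    moreover have "(\<lambda>i. z i + \<eta> i) = w" by (simp add: \<eta>_def)
    ultimately have gw: "NE n s m (g w) \<le> real n * (B * NZ n s m \<eta>)" by simp
    have "NE n s m (\<lambda>i. d x i - d x' i) \<le> C * NE n s m (\<lambda>i. g w i - g z' i)"
      unfolding w_def z'_def
      by (rule est) (use w\<Omega> z near in \<open>auto simp: w_def z'_def \<rho>_def\<close>)
    also have "\<dots> = C * NE n s m (g w)" using \<open>g z' = (\<lambda>i. 0)\<close> by simp
    also have "\<dots> \<le> C * (real n * (B * NZ n s m \<eta>))" using gw r1 by (intro mult_left_mono) auto
    finally show ?thesis by (simp add: N\<eta> mult.assoc)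
  qed
  moreover have "r > 0" "C * (real n * B) > 0" using \<delta> \<rho> r1 r2 n by (auto simp: r_def)
  ultimately show ?thesis by blast
qed

end

section \<open>The tangent map of a solution\<close>

text \<open>The tangent of the solution is determined by the linearised equation. The description is
  meaningful only where that equation has a unique solution, see \<open>tangent\<close> and \<open>tangent_unique\<close>
  below.\<close>

definition tangent :: "nat \<Rightarrow> (nat \<Rightarrow> nat) \<Rightarrow> ((nat \<Rightarrow> 'v \<times> 'e) \<Rightarrow> (nat \<Rightarrow> 'v \<times> 'e) \<Rightarrow> nat \<Rightarrow> 'e) \<Rightarrow>
    ((nat \<Rightarrow> 'v) \<Rightarrow> nat \<Rightarrow> 'e) \<Rightarrow> (nat \<Rightarrow> 'v) \<Rightarrow> (nat \<Rightarrow> 'v) \<Rightarrow> nat \<Rightarrow> 'e" where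
  "tangent n s D d x h =
    (THE k. k \<in> TE n s 0 \<and> D (fun_zip x (d x)) (fun_zip h k) = (\<lambda>i. 0))"

lemma fun_zip_in_TZ: "h \<in> TV n s' m' \<Longrightarrow> k \<in> TE n s m \<Longrightarrow> fun_zip h k \<in> TZ n s m"
  by (auto simp: tlev_def const_lev_def sum_lev_def zero_prod_def)

lemma TV_0: "h \<in> TV n s m \<Longrightarrow> h \<in> TV n s' m'"
  by (simp add: tlev_def const_lev_def)

text \<open>Raising the offset by two gives the base point two levels more than \<open>m\<close>, as
  the tangent at level \<open>m\<close> requires; \<open>tdom\<close> by itself supplies one of
  them.\<close>

lemma X_tshift_D:
  assumes n: "n \<ge> 1" and x: "x \<in> X (Suc (Suc c)) (2 * n) (tshift n s) m"
  shows "x = tpair n (tfst n x) (tsnd n x)" "tfst n x \<in> X c n s (Suc (Suc m))" "tsnd n x \<in> TV n s m"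
proof -
  have 1: "x = tpair n (tfst n x) (tsnd n x)" "tfst n x \<in> TV n s (Suc m)" "tsnd n x \<in> TV n s m"
    using x by (auto simp: base_dom_def tlev_tshift_iff)
  moreover have "tfst n x 0 \<in> G (Suc (Suc m) + c)" using x n by (simp add: base_dom_def tfst_def)
  ultimately show "x = tpair n (tfst n x) (tsnd n x)" "tfst n x \<in> X c n s (Suc (Suc m))" "tsnd n x \<in> TV n s m"
    using TV_0[OF 1(2)] by (auto simp: base_dom_def)
qed

context
  fixes n s g D c d
  assumes C1: "is_sc1 n s g D" and sol: "solution n s c g d" and inj: "inj_estimate n s c g d"
begin

text \<open>Surjectivity of the linearised equation is not needed: difference quotients are bounded at
  level \<open>Suc m\<close>, so a subsequence converges at level \<open>m\<close>, and its limit solves the linearised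
  equation.\<close>

lemma tangent_exists_inward:
  assumes x: "x \<in> X c n s (Suc (Suc m))" and h: "h \<in> TV n s m" "h 0 \<in> V"
  shows "\<exists>k\<in>TE n s m. D (fun_zip x (d x)) (fun_zip h k) = (\<lambda>i. 0)"
proof -
  have n: "n \<ge> 1" by (rule is_sc1_width[OF C1])
  define z where "z = fun_zip x (d x)"
  have z2: "z \<in> \<Omega> n s (Suc (Suc m))" unfolding z_def by (rule solution_in_\<Omega>[OF sol x])
  have z: "z \<in> \<Omega> n s (Suc m)" by (rule \<Omega>_mono[OF _ z2]) simp
  have xm: "x \<in> X c n s (Suc m)" by (rule X_mono[OF _ x]) simp
  obtain r1 K where r1: "r1 > 0" "K > 0" "\<And>x' x''. x' \<in> X c n s (Suc (Suc m)) \<Longrightarrow> x'' \<in> X c n s (Suc (Suc m)) \<Longrightarrow>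
      NV n s (Suc m) (\<lambda>i. x' i - x i) < r1 \<Longrightarrow> NV n s (Suc m) (\<lambda>i. x'' i - x i) < r1 \<Longrightarrow>
      NE n s (Suc m) (\<lambda>i. d x' i - d x'' i) \<le> K * NV n s (Suc m) (\<lambda>i. x' i - x'' i)"
    using solution_Lipschitz[OF C1 sol inj x] by meson
  obtain r2 where r2: "r2 > 0" "\<And>x'. x' \<in> TV n s (Suc (Suc m)) \<Longrightarrow> x' 0 \<in> V \<Longrightarrow>
      NV n s (Suc (Suc m)) (\<lambda>i. x' i - x i) < r2 \<Longrightarrow> x' \<in> X c n s (Suc (Suc m))"
    using X_open[OF n x] by blast
  obtain r3 where r3: "r3 > 0" "\<And>w w' t. w \<in> TZ n s (Suc m) \<Longrightarrow> w' \<in> TZ n s (Suc m) \<Longrightarrow>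
    fst (w 0) \<in> V \<Longrightarrow> fst (w' 0) \<in> V \<Longrightarrow>
    NZ n s (Suc m) (\<lambda>i. w i - z i) < r3 \<Longrightarrow> NZ n s (Suc m) (\<lambda>i. w' i - z i) < r3 \<Longrightarrow> t \<in> {0..1} \<Longrightarrow>
    (\<lambda>i. w i + t *\<^sub>R (w' i - w i)) \<in> \<Omega> n s (Suc m) \<and>
      NZ n s (Suc m) (\<lambda>i. (w i + t *\<^sub>R (w' i - w i)) - z i)
        \<le> max (NZ n s (Suc m) (\<lambda>i. w i - z i)) (NZ n s (Suc m) (\<lambda>i. w' i - z i))"
    using \<Omega>_segment[OF n z] by meson
  define M where "M = NV n s m h"
  have M: "M \<ge> 0" unfolding M_def by (rule P.tnorm_nonneg[OF h(1)])
  have NVh: "NV n s m' h = M" for m' unfolding M_def by (rule tnorm_const_eq)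
  \<comment> \<open>Step lengths tending to zero; the factors \<open>M + 1\<close> and
    \<open>real l + 2\<close> keep every increment strictly below both radii, also when
    \<open>M = 0\<close>.\<close>
  define \<tau> where "\<tau> l = min r1 r2 / ((M + 1) * (real l + 2))" for l :: nat
  have \<tau>: "\<tau> l > 0" for l using r1 r2 M by (simp add: \<tau>_def)
  have \<tau>M: "\<tau> l * M < min r1 r2" for l
  proof -
    have "\<tau> l * M \<le> \<tau> l * (M + 1)" using \<tau>[of l] by simp
    also have "\<dots> = min r1 r2 / (real l + 2)" using M by (simp add: \<tau>_def)
    also have "\<dots> < min r1 r2"
    proof -
      have "min r1 r2 > 0" using r1 r2 by simp
      then have "min r1 r2 * 1 < min r1 r2 * (real l + 2)" by (intro mult_strict_left_mono) auto
      then show ?thesis by (subst pos_divide_less_eq) auto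
    qed
    finally show ?thesis .
  qed
  have \<tau>lim: "(\<lambda>l. \<tau> l * M) \<longlonglongrightarrow> 0"
  proof -
    have "(\<lambda>l. (min r1 r2 * M / (M + 1)) * (1 / (real l + 2))) \<longlonglongrightarrow> (min r1 r2 * M / (M + 1)) * 0"
      by (intro tendsto_mult_left) real_asymp
    then show ?thesis by (simp add: \<tau>_def)
  qed
  define xl where "xl l = (\<lambda>i. x i + \<tau> l *\<^sub>R h i)" for l
  have xld: "NV n s m' (\<lambda>i. xl l i - x i) = \<tau> l * M" for l m'
    using P.tnorm_scale[OF TV_0[OF h(1)], of s m' "\<tau> l"] \<tau>[of l] NVh[of m'] by (simp add: xl_def)
  have xl: "xl l \<in> X c n s (Suc (Suc m))" for l
  proof (rule r2(2))
    show "xl l \<in> TV n s (Suc (Suc m))"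
      unfolding xl_def by (intro P.tlev_add P.tlev_scale TV_0[OF h(1)] X_TV[OF x])
    show "xl l 0 \<in> V" unfolding xl_def using \<tau>[of l] by (intro V_add V_scale X_V[OF x] h) simp
    show "NV n s (Suc (Suc m)) (\<lambda>i. xl l i - x i) < r2" using \<tau>M[of l] by (simp add: xld)
  qed
  define q where "q l = (\<lambda>i. (1 / \<tau> l) *\<^sub>R (d (xl l) i - d x i))" for l
  have dd: "(\<lambda>i. d (xl l) i - d x i) \<in> TE n s (Suc m)" for l
    by (intro tlev_diff solution_lev[OF sol] X_mono[OF _ xl] X_mono[OF _ x]) auto
  have qT: "q l \<in> TE n s (Suc m)" for l unfolding q_def by (rule tlev_scale[OF dd])
  have qB: "NE n s (Suc m) (q l) \<le> K * M" for l
  proof -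
    have "NE n s (Suc m) (\<lambda>i. d (xl l) i - d x i) \<le> K * NV n s (Suc m) (\<lambda>i. xl l i - x i)"
      by (rule r1(3)[OF xl x]) (use \<tau>M[of l] r1(1) in \<open>simp_all add: xld\<close>)
    then have "NE n s (Suc m) (\<lambda>i. d (xl l) i - d x i) \<le> \<tau> l * (K * M)" by (simp add: xld mult.left_commute)
    then show ?thesis
      unfolding q_def tnorm_scale[OF dd] using \<tau>[of l] by (simp add: pos_divide_le_eq mult.commute)
  qed
  obtain \<sigma> k where \<sigma>: "strict_mono (\<sigma> :: nat \<Rightarrow> nat)" and k: "k \<in> TE n s m"
    and lim: "(\<lambda>l. NE n s m (\<lambda>i. q (\<sigma> l) i - k i)) \<longlonglongrightarrow> 0"
    using tlev_compact[of q n s m "K * M", OF qT qB] by blast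
  define h' where "h' y = fun_zip h y" for y :: "nat \<Rightarrow> 'e"
  have h'm: "h' y \<in> TZ n s m'" if "y \<in> TE n s m'" for y m'
    unfolding h'_def by (rule fun_zip_in_TZ[OF h(1) that])
  define C where "C = D z (h' k)"
  have C: "C \<in> TE n s m" unfolding C_def by (rule deriv_lev[OF C1 z h'm[OF k]])
  have "NE n s m C \<le> e" if e: "e > 0" for e
  proof -
    define \<epsilon> where "\<epsilon> = e / real n"
    have \<epsilon>: "\<epsilon> > 0" "real n * \<epsilon> = e" using e n by (auto simp: \<epsilon>_def)
    obtain \<delta> where \<delta>: "\<delta> > 0" "\<And>w h''. w \<in> \<Omega> n s (Suc m) \<Longrightarrow> h'' \<in> TZ n s m \<Longrightarrow>
        NZ n s (Suc m) (\<lambda>i. w i - z i) < \<delta> \<Longrightarrow> NZ n s m (\<lambda>i. h'' i - h' k i) < \<delta> \<Longrightarrow>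
        NE n s m (\<lambda>i. D w h'' i - C i) < \<epsilon>"
      using deriv_cont[OF C1 z h'm[OF k] \<epsilon>(1)] unfolding C_def by blast
    obtain \<gamma> where \<gamma>: "\<gamma> > 0" "\<And>x'. x' \<in> X c n s (Suc m) \<Longrightarrow> NV n s (Suc m) (\<lambda>i. x' i - x i) < \<gamma> \<Longrightarrow>
        NZ n s (Suc m) (\<lambda>i. fun_zip x' (d x') i - z i) < min r3 \<delta>"
      using graph_cont[OF sol xm, of "min r3 \<delta>"] r3(1) \<delta>(1) unfolding z_def by auto
    have "\<forall>\<^sub>F l in sequentially. NE n s m (\<lambda>i. q (\<sigma> l) i - k i) < \<delta>"
      by (rule order_tendstoD(2)[OF lim \<delta>(1)])
    moreover have "\<forall>\<^sub>F l in sequentially. \<tau> (\<sigma> l) * M < \<gamma>"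
      using order_tendstoD(2)[OF LIMSEQ_subseq_LIMSEQ[OF \<tau>lim \<sigma>] \<gamma>(1)] by (simp add: o_def)
    ultimately have "\<forall>\<^sub>F l in sequentially. NE n s m (\<lambda>i. q (\<sigma> l) i - k i) < \<delta> \<and> \<tau> (\<sigma> l) * M < \<gamma>"
      by (rule eventually_conj)
    then obtain l0 where l0: "NE n s m (\<lambda>i. q (\<sigma> l0) i - k i) < \<delta>" "\<tau> (\<sigma> l0) * M < \<gamma>"
      using eventually_happens'[OF sequentially_bot] by blast
    define l where "l = \<sigma> l0"
    note l0 = l0[folded l_def]
    define w where "w = fun_zip (xl l) (d (xl l))"
    have w: "w \<in> \<Omega> n s (Suc m)" unfolding w_def by (rule solution_in_\<Omega>[OF sol]) (rule X_mono[OF _ xl], simp)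
    have wz: "NZ n s (Suc m) (\<lambda>i. w i - z i) < min r3 \<delta>"
      unfolding w_def by (rule \<gamma>(2)[OF X_mono[OF _ xl]]) (use l0 in \<open>simp_all add: xld\<close>)
    define \<eta> where "\<eta> = (\<lambda>i. w i - z i)"
    have \<eta>: "\<eta> \<in> TZ n s (Suc m)" unfolding \<eta>_def by (intro Z.tlev_diff \<Omega>_TZ w z)
    \<comment> \<open>The increment of the graph is the step length times \<open>(h, q l)\<close>,
      so convergence of the quotients \<open>q\<close> and joint continuity of \<open>D\<close>
      control the derivative along the segment.\<close>
    have \<eta>q: "\<eta> = (\<lambda>i. \<tau> l *\<^sub>R h' (q l) i)"
      using \<tau>[of l] by (simp add: \<eta>_def w_def z_def xl_def h'_def q_def fun_eq_iff)
    have qm: "q l \<in> TE n s m" using qT[of l] tlev_mono[of m "Suc m" n s] by auto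
    have "NE n s m (\<lambda>i. g (\<lambda>i. z i + \<eta> i) i - g z i - \<tau> l *\<^sub>R C i) \<le> real n * (\<tau> l * \<epsilon>)"
    proof (rule sc1_mean_value[OF C1 \<eta>])
      show "(\<lambda>i. \<tau> l *\<^sub>R C i) \<in> TE n s m" by (rule tlev_scale[OF C])
      fix t :: real assume t: "t \<in> {0..1}"
      define p where "p = (\<lambda>i. z i + t *\<^sub>R \<eta> i)"
      have zz: "NZ n s (Suc m) (\<lambda>i. z i - z i) < r3" using r3(1) by simp
      have wr: "NZ n s (Suc m) (\<lambda>i. w i - z i) < r3" using wz by simp
      note seg = r3(2)[OF \<Omega>_TZ[OF z] \<Omega>_TZ[OF w] \<Omega>_V[OF z] \<Omega>_V[OF w] zz wr t]
      have p: "p \<in> \<Omega> n s (Suc m)" using seg unfolding p_def \<eta>_def by blast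
      have pz: "NZ n s (Suc m) (\<lambda>i. p i - z i) < \<delta>"
        unfolding p_def \<eta>_def
        by (rule le_less_trans[OF conjunct2[OF seg]]) (use wz \<delta>(1) in simp)
      from p show "(\<lambda>i. z i + t *\<^sub>R \<eta> i) \<in> \<Omega> n s (Suc m)" by (simp add: p_def)
      have hq: "NZ n s m (\<lambda>i. h' (q l) i - h' k i) < \<delta>"
        unfolding h'_def tnorm_fun_zip_diff using l0 by simp
      have "NE n s m (\<lambda>i. D p (h' (q l)) i - C i) < \<epsilon>" by (rule \<delta>(2)[OF p h'm[OF qm] pz hq])
      moreover have "(\<lambda>i. D p \<eta> i - \<tau> l *\<^sub>R C i) = (\<lambda>i. \<tau> l *\<^sub>R (D p (h' (q l)) i - C i))"
        unfolding \<eta>q deriv_scale[OF C1 p h'm[OF qm]] by (simp add: scaleR_diff_right)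
      ultimately show "NE n s m (\<lambda>i. D (\<lambda>i. z i + t *\<^sub>R \<eta> i) \<eta> i - \<tau> l *\<^sub>R C i) \<le> \<tau> l * \<epsilon>"
        using tnorm_scale[OF tlev_diff[OF deriv_lev[OF C1 p h'm[OF qm]] C], of "\<tau> l"] \<tau>[of l]
        by (simp add: p_def)
    qed
    moreover have "(\<lambda>i. z i + \<eta> i) = w" by (simp add: \<eta>_def)
    moreover have "g z = (\<lambda>i. 0)" unfolding z_def by (rule solution_zero[OF sol x])
    moreover have "g w = (\<lambda>i. 0)" unfolding w_def by (rule solution_zero[OF sol xl])
    \<comment> \<open>Both ends of the segment lie on the graph, where \<open>g\<close> vanishes, so
      the linearisation error is just the linear term.\<close>
    ultimately have "NE n s m (\<lambda>i. - (\<tau> l *\<^sub>R C i)) \<le> real n * (\<tau> l * \<epsilon>)" by simp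
    then have "\<tau> l * NE n s m C \<le> \<tau> l * e"
      using tnorm_uminus[OF tlev_scale[OF C, of "\<tau> l"]] tnorm_scale[OF C, of "\<tau> l"] \<tau>[of l] \<epsilon>(2)
      by (simp add: mult.left_commute)
    then show ?thesis using \<tau>[of l] by simp
  qed
  then have "NE n s m C \<le> 0" by (rule field_le_epsilon) simp
  then have "C = (\<lambda>i. 0)" by (rule tnorm_eq_0_D[OF C])
  with k show ?thesis unfolding C_def z_def h'_def by blast
qed

text \<open>Only coordinate 0 of a tangent vector has to point into \<open>V\<close>. Writing it as
  a difference of two vectors of the cone and using linearity of \<open>D\<close> reduces the claim
  to the inward case.\<close>

lemma tangent_exists:
  assumes x: "x \<in> X c n s (Suc (Suc m))" and h: "h \<in> TV n s m"
  shows "\<exists>k\<in>TE n s m. D (fun_zip x (d x)) (fun_zip h k) = (\<lambda>i. 0)"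
proof -
  have n: "n \<ge> 1" by (rule is_sc1_width[OF C1])
  have z: "fun_zip x (d x) \<in> \<Omega> n s (Suc m)"
    by (rule solution_in_\<Omega>[OF sol]) (rule X_mono[OF _ x], simp)
  obtain a b where ab: "a \<in> V" "b \<in> V" "h 0 = a - b" using V_span by blast
  define h1 where "h1 = h(0 := a)"
  define h2 where "h2 = (\<lambda>i::nat. 0)(0 := b)"
  have h12: "h1 \<in> TV n s m" "h2 \<in> TV n s m"
    using h n by (auto simp: h1_def h2_def tlev_def const_lev_def)
  obtain k1 where k1: "k1 \<in> TE n s m" "D (fun_zip x (d x)) (fun_zip h1 k1) = (\<lambda>i. 0)"
    using tangent_exists_inward[OF x h12(1)] ab(1) by (auto simp: h1_def)
  obtain k2 where k2: "k2 \<in> TE n s m" "D (fun_zip x (d x)) (fun_zip h2 k2) = (\<lambda>i. 0)"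
    using tangent_exists_inward[OF x h12(2)] ab(2) by (auto simp: h2_def)
  have "fun_zip h (\<lambda>i. k1 i - k2 i) = (\<lambda>i. fun_zip h1 k1 i - fun_zip h2 k2 i)"
    using ab by (auto simp: h1_def h2_def fun_zip_def)
  then have "D (fun_zip x (d x)) (fun_zip h (\<lambda>i. k1 i - k2 i)) = (\<lambda>i. 0)"
    using deriv_diff[OF C1 z fun_zip_in_TZ[OF h12(1) k1(1)] fun_zip_in_TZ[OF h12(2) k2(1)]] k1 k2 by simp
  then show ?thesis using tlev_diff[OF k1(1) k2(1)] by blast
qed

text \<open>Two solutions differ by a fibre direction annihilated by \<open>D z\<close>, which the
  lower bound forces to vanish. Uniqueness at level 0 makes solutions found at different levels
  coincide.\<close>

lemma tangent_unique:
  assumes x: "x \<in> X c n s (Suc m)" and h: "h \<in> TV n s' m'"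
    and k: "k \<in> TE n s 0" "k' \<in> TE n s 0"
    and "D (fun_zip x (d x)) (fun_zip h k) = (\<lambda>i. 0)" "D (fun_zip x (d x)) (fun_zip h k') = (\<lambda>i. 0)"
  shows "k = k'"
proof -
  have x1: "x \<in> X c n s (Suc 0)" by (rule X_mono[OF _ x]) simp
  define z where "z = fun_zip x (d x)"
  have z: "z \<in> \<Omega> n s (Suc 0)" unfolding z_def by (rule solution_in_\<Omega>[OF sol x1])
  obtain r C where rC: "r > 0" "C > 0" "\<And>y y' k. fun_zip y y' \<in> \<Omega> n s (Suc 0) \<Longrightarrow>
    NZ n s (Suc 0) (\<lambda>i. fun_zip y y' i - z i) < r \<Longrightarrow> k \<in> TE n s 0 \<Longrightarrow>
    NE n s 0 k \<le> C * NE n s 0 (D (fun_zip y y') (fun_zip (\<lambda>i. 0) k))"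
    using deriv_fibre_bounded_below[OF C1 sol inj x1] unfolding z_def by meson
  have kk: "(\<lambda>i. k i - k' i) \<in> TE n s 0" by (rule tlev_diff[OF k])
  have "fun_zip (\<lambda>i. 0) (\<lambda>i. k i - k' i) = (\<lambda>i. fun_zip h k i - fun_zip h k' i)"
    by (simp add: fun_zip_def)
  then have D0: "D z (fun_zip (\<lambda>i. 0) (\<lambda>i. k i - k' i)) = (\<lambda>i. 0)"
    using deriv_diff[OF C1 z fun_zip_in_TZ[OF h k(1)] fun_zip_in_TZ[OF h k(2)]] assms(5,6)
    by (simp add: z_def)
  have "NE n s 0 (\<lambda>i. k i - k' i) \<le> C * NE n s 0 (D z (fun_zip (\<lambda>i. 0) (\<lambda>i. k i - k' i)))"
    unfolding z_def by (rule rC(3)[OF _ _ kk]) (use z rC(1) in \<open>simp_all add: z_def\<close>)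
  then have "NE n s 0 (\<lambda>i. k i - k' i) \<le> 0" by (simp add: D0)
  then have "(\<lambda>i. k i - k' i) = (\<lambda>i. 0)" by (rule tnorm_eq_0_D[OF kk])
  then show ?thesis by (simp add: fun_eq_iff)
qed

lemma tangent_eqI:
  assumes "x \<in> X c n s (Suc m)" "h \<in> TV n s' m'" "k \<in> TE n s 0"
    "D (fun_zip x (d x)) (fun_zip h k) = (\<lambda>i. 0)"
  shows "tangent n s D d x h = k"
  unfolding tangent_def
  by (rule the_equality) (use assms tangent_unique[OF assms(1,2)] in blast)+

text \<open>The description operator selects at level 0; by uniqueness the selected vector is the
  solution of level \<open>m\<close> found by compactness, and so has that regularity.\<close>

lemma tangent:
  assumes x: "x \<in> X c n s (Suc (Suc m))" and h: "h \<in> TV n s' m'"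
  shows "tangent n s D d x h \<in> TE n s m"
    and "D (fun_zip x (d x)) (fun_zip h (tangent n s D d x h)) = (\<lambda>i. 0)"
proof -
  obtain k where k: "k \<in> TE n s m" "D (fun_zip x (d x)) (fun_zip h k) = (\<lambda>i. 0)"
    using tangent_exists[OF x TV_0[OF h]] by blast
  have "k \<in> TE n s 0" using k(1) tlev_mono[of 0 m n s] by auto
  then have "tangent n s D d x h = k" by (rule tangent_eqI[OF x h _ k(2)])
  with k show "tangent n s D d x h \<in> TE n s m"
    "D (fun_zip x (d x)) (fun_zip h (tangent n s D d x h)) = (\<lambda>i. 0)" by auto
qed

lemma tangent_linear:
  assumes x: "x \<in> X c n s (Suc (Suc 0))" and h: "h \<in> TV n s 0" "h' \<in> TV n s 0"
  shows "tangent n s D d x (\<lambda>i. a *\<^sub>R h i + h' i) = (\<lambda>i. a *\<^sub>R tangent n s D d x h i + tangent n s D d x h' i)"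
proof (rule tangent_eqI[OF x])
  note k = tangent[OF x h(1)] and k' = tangent[OF x h(2)]
  show "(\<lambda>i. a *\<^sub>R h i + h' i) \<in> TV n s 0" by (intro P.tlev_add P.tlev_scale h)
  show "(\<lambda>i. a *\<^sub>R tangent n s D d x h i + tangent n s D d x h' i) \<in> TE n s 0"
    by (intro tlev_add tlev_scale k k')
  have z: "fun_zip x (d x) \<in> \<Omega> n s (Suc 0)"
    by (rule solution_in_\<Omega>[OF sol]) (rule X_mono[OF _ x], simp)
  have "fun_zip (\<lambda>i. a *\<^sub>R h i + h' i) (\<lambda>i. a *\<^sub>R tangent n s D d x h i + tangent n s D d x h' i)
    = (\<lambda>i. a *\<^sub>R fun_zip h (tangent n s D d x h) i + fun_zip h' (tangent n s D d x h') i)"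
    by (simp add: fun_zip_def)
  then show "D (fun_zip x (d x)) (fun_zip (\<lambda>i. a *\<^sub>R h i + h' i)
      (\<lambda>i. a *\<^sub>R tangent n s D d x h i + tangent n s D d x h' i)) = (\<lambda>i. 0)"
    using deriv_linear[OF C1 z fun_zip_in_TZ[OF h(1) k(1)] fun_zip_in_TZ[OF h(2) k'(1)], of a] k(2) k'(2)
    by simp
qed

text \<open>Since \<open>D z (h, k) = 0\<close> for the tangent \<open>k\<close>, the value
  \<open>D z (0, k)\<close> equals \<open>- D z (h, 0)\<close>; the lower bound on the fibre and the
  upper bound on \<open>D z\<close> combine.\<close>

lemma tangent_bounded:
  assumes x: "x \<in> X c n s (Suc (Suc 0))"
  shows "\<exists>C. \<forall>h\<in>TV n s 0. NE n s 0 (tangent n s D d x h) \<le> C * NV n s 0 h"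
proof -
  have x1: "x \<in> X c n s (Suc 0)" by (rule X_mono[OF _ x]) simp
  define z where "z = fun_zip x (d x)"
  have z: "z \<in> \<Omega> n s (Suc 0)" unfolding z_def by (rule solution_in_\<Omega>[OF sol x1])
  obtain r C where rC: "r > 0" "C > 0" "\<And>y y' k. fun_zip y y' \<in> \<Omega> n s (Suc 0) \<Longrightarrow>
    NZ n s (Suc 0) (\<lambda>i. fun_zip y y' i - z i) < r \<Longrightarrow> k \<in> TE n s 0 \<Longrightarrow>
    NE n s 0 k \<le> C * NE n s 0 (D (fun_zip y y') (fun_zip (\<lambda>i. 0) k))"
    using deriv_fibre_bounded_below[OF C1 sol inj x1] unfolding z_def by meson
  obtain B where B: "\<And>h. h \<in> TZ n s 0 \<Longrightarrow> NE n s 0 (D z h) \<le> B * NZ n s 0 h"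
    using deriv_bounded[OF C1 z] by blast
  have "NE n s 0 (tangent n s D d x h) \<le> C * B * NV n s 0 h" if h: "h \<in> TV n s 0" for h
  proof -
    note k = tangent[OF x h]
    define h0 where "h0 = fun_zip h (\<lambda>i. 0 :: 'e)"
    have h0: "h0 \<in> TZ n s 0" unfolding h0_def by (rule fun_zip_in_TZ[OF h tlev_0])
    have "fun_zip (\<lambda>i. 0) (tangent n s D d x h) = (\<lambda>i. fun_zip h (tangent n s D d x h) i - h0 i)"
      by (simp add: fun_zip_def h0_def)
    then have eq: "D z (fun_zip (\<lambda>i. 0) (tangent n s D d x h)) = (\<lambda>i. - D z h0 i)"
      using deriv_diff[OF C1 z fun_zip_in_TZ[OF h k(1)] h0] k(2) by (simp add: z_def)
    have "NE n s 0 (tangent n s D d x h) \<le> C * NE n s 0 (D z (fun_zip (\<lambda>i. 0) (tangent n s D d x h)))"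
      unfolding z_def by (rule rC(3)[OF _ _ k(1)]) (use z rC(1) in \<open>simp_all add: z_def\<close>)
    also have "\<dots> = C * NE n s 0 (D z h0)"
      unfolding eq tnorm_uminus[OF deriv_lev0[OF C1 z h0]] ..
    also have "\<dots> \<le> C * (B * NZ n s 0 h0)" using B[OF h0] rC(2) by (intro mult_left_mono) auto
    also have "NZ n s 0 h0 = NV n s 0 h" unfolding h0_def tnorm_fun_zip by simp
    finally show ?thesis by (simp add: mult.assoc)
  qed
  then show ?thesis by blast
qed

text \<open>With \<open>y\<close> the increment of \<open>d\<close> and \<open>k\<close> its
  candidate linear part, \<open>D z (0, y - k) = D z (h, y)\<close>, and this is minus the
  linearisation error of \<open>g\<close> because \<open>g\<close> vanishes at both points. The
  lower bound on the fibre turns its smallness into smallness of \<open>y - k\<close>.\<close>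

lemma tangent_approx:
  assumes x: "x \<in> X c n s (Suc (Suc 0))" and "e > 0"
  shows "\<exists>\<delta>>0. \<forall>h. (\<lambda>i. x i + h i) \<in> X c n s (Suc (Suc 0)) \<longrightarrow> NV n s 1 h < \<delta> \<longrightarrow>
    NE n s 0 (\<lambda>i. d (\<lambda>j. x j + h j) i - d x i - tangent n s D d x h i) \<le> e * NV n s 1 h"
proof -
  have x1: "x \<in> X c n s (Suc 0)" by (rule X_mono[OF _ x]) simp
  define z where "z = fun_zip x (d x)"
  have z: "z \<in> \<Omega> n s (Suc 0)" unfolding z_def by (rule solution_in_\<Omega>[OF sol x1])
  obtain r C where rC: "r > 0" "C > 0" "\<And>y y' k. fun_zip y y' \<in> \<Omega> n s (Suc 0) \<Longrightarrow>
    NZ n s (Suc 0) (\<lambda>i. fun_zip y y' i - z i) < r \<Longrightarrow> k \<in> TE n s 0 \<Longrightarrow>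
    NE n s 0 k \<le> C * NE n s 0 (D (fun_zip y y') (fun_zip (\<lambda>i. 0) k))"
    using deriv_fibre_bounded_below[OF C1 sol inj x1] unfolding z_def by meson
  obtain r1 K where r1: "r1 > 0" "K > 0" "\<And>x' x''. x' \<in> X c n s (Suc (Suc 0)) \<Longrightarrow> x'' \<in> X c n s (Suc (Suc 0)) \<Longrightarrow>
      NV n s (Suc 0) (\<lambda>i. x' i - x i) < r1 \<Longrightarrow> NV n s (Suc 0) (\<lambda>i. x'' i - x i) < r1 \<Longrightarrow>
      NE n s (Suc 0) (\<lambda>i. d x' i - d x'' i) \<le> K * NV n s (Suc 0) (\<lambda>i. x' i - x'' i)"
    using solution_Lipschitz[OF C1 sol inj x] by meson
  \<comment> \<open>\<open>1 + K\<close> bounds the norm of the graph increment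
    \<open>(h, y)\<close> in terms of \<open>h\<close>, and \<open>C\<close> is the constant of the
    fibre bound.\<close>
  define \<epsilon> where "\<epsilon> = e / (C * (1 + K))"
  have \<epsilon>: "\<epsilon> > 0" "C * (\<epsilon> * (1 + K)) = e" using \<open>e > 0\<close> rC r1 by (auto simp: \<epsilon>_def add_pos_pos)
  obtain \<rho> where \<rho>: "\<rho> > 0" "\<And>h. (\<lambda>i. z i + h i) \<in> \<Omega> n s 1 \<Longrightarrow> NZ n s 1 h < \<rho> \<Longrightarrow>
    NE n s 0 (\<lambda>i. g (\<lambda>j. z j + h j) i - g z i - D z h i) \<le> \<epsilon> * NZ n s 1 h"
    using deriv_approx[OF C1 z \<epsilon>(1)] by blast
  define \<delta> where "\<delta> = min r1 (\<rho> / (1 + K))"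
  have \<delta>: "\<delta> > 0" using r1 \<rho> by (simp add: \<delta>_def)
  have "NE n s 0 (\<lambda>i. d (\<lambda>j. x j + h j) i - d x i - tangent n s D d x h i) \<le> e * NV n s 1 h"
    if xh: "(\<lambda>i. x i + h i) \<in> X c n s (Suc (Suc 0))" and hs: "NV n s 1 h < \<delta>" for h
  proof -
    define x' where "x' = (\<lambda>i. x i + h i)"
    note xh = xh[folded x'_def]
    have x'1: "x' \<in> X c n s (Suc 0)" by (rule X_mono[OF _ xh]) simp
    have h: "h \<in> TV n s 0"
      using P.tlev_diff[OF X_TV[OF xh] X_TV[OF x]] by (simp add: x'_def)
    define w where "w = fun_zip x' (d x')"
    define y where "y = (\<lambda>i. d x' i - d x i)"
    have w: "w \<in> \<Omega> n s 1" unfolding w_def by (rule solution_in_\<Omega>[OF sol]) (use x'1 in simp)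
    have wz: "w = (\<lambda>i. z i + fun_zip h y i)" by (simp add: w_def z_def y_def x'_def fun_zip_def)
    have y: "y \<in> TE n s 0" unfolding y_def
      by (intro tlev_diff solution_lev[OF sol] X_mono[OF _ x] X_mono[OF _ xh]) auto
    have "NE n s 1 y \<le> K * NV n s 1 (\<lambda>i. x' i - x i)"
      unfolding y_def using r1(3)[OF xh x] r1(1) hs by (simp add: x'_def \<delta>_def)
    then have Nz: "NZ n s 1 (fun_zip h y) \<le> (1 + K) * NV n s 1 h"
      unfolding tnorm_fun_zip by (simp add: x'_def algebra_simps)
    also have "\<dots> < \<rho>" using hs r1(2) by (simp add: \<delta>_def pos_less_divide_eq mult.commute)
    finally have "NE n s 0 (\<lambda>i. g w i - g z i - D z (fun_zip h y) i) \<le> \<epsilon> * NZ n s 1 (fun_zip h y)"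
      using \<rho>(2)[of "fun_zip h y"] w unfolding wz by blast
    moreover have "g w = (\<lambda>i. 0)" "g z = (\<lambda>i. 0)"
      unfolding w_def z_def by (rule solution_zero[OF sol] x xh)+
    ultimately have est: "NE n s 0 (D z (fun_zip h y)) \<le> \<epsilon> * NZ n s 1 (fun_zip h y)"
      using tnorm_uminus[OF deriv_lev0[OF C1 z fun_zip_in_TZ[OF h y]]] by simp
    note k = tangent[OF x h]
    have T: "(\<lambda>i. y i - tangent n s D d x h i) \<in> TE n s 0" by (rule tlev_diff[OF y k(1)])
    have "fun_zip (\<lambda>i. 0) (\<lambda>i. y i - tangent n s D d x h i)
        = (\<lambda>i. fun_zip h y i - fun_zip h (tangent n s D d x h) i)"
      by (simp add: fun_zip_def)
    then have eq: "D z (fun_zip (\<lambda>i. 0) (\<lambda>i. y i - tangent n s D d x h i)) = D z (fun_zip h y)"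
      using deriv_diff[OF C1 z fun_zip_in_TZ[OF h y] fun_zip_in_TZ[OF h k(1)]] k(2) by (simp add: z_def)
    have "NE n s 0 (\<lambda>i. y i - tangent n s D d x h i)
        \<le> C * NE n s 0 (D z (fun_zip (\<lambda>i. 0) (\<lambda>i. y i - tangent n s D d x h i)))"
      unfolding z_def by (rule rC(3)[OF _ _ T]) (use z rC(1) in \<open>simp_all add: z_def\<close>)
    also have "\<dots> \<le> C * (\<epsilon> * ((1 + K) * NV n s 1 h))"
    proof -
      have "\<epsilon> * NZ n s 1 (fun_zip h y) \<le> \<epsilon> * ((1 + K) * NV n s 1 h)"
        using Nz \<epsilon>(1) by (intro mult_left_mono) auto
      then show ?thesis unfolding eq using est rC(2) by (intro mult_left_mono) auto
    qed
    also have "\<dots> = C * (\<epsilon> * (1 + K)) * NV n s 1 h" by simp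
    finally show ?thesis unfolding \<epsilon>(2) by (simp add: y_def x'_def)
  qed
  then show ?thesis using \<delta> by blast
qed

text \<open>\<open>sc_deriv\<close> looks at points of level 1, whereas the tangent requires level
  2; the offset \<open>Suc c\<close> makes up the difference.\<close>

lemma tangent_sc_deriv:
  "sc_deriv const_lev const_norm n s L N n s (X (Suc c) n s) d (tangent n s D d)"
  unfolding sc_deriv_def
proof (intro ballI)
  fix x assume "x \<in> X (Suc c) n s 1"
  then have x: "x \<in> X c n s (Suc (Suc 0))"
    using X_shift[of x c 1 n s "Suc 0"] by simp
  have X1: "X (Suc c) n s 1 = X c n s (Suc (Suc 0))"
    using X_shift[of _ c 1 n s "Suc 0"] by auto
  show "(\<forall>h\<in>TV n s 0. tangent n s D d x h \<in> TE n s 0) \<and>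
        (\<forall>h\<in>TV n s 0. \<forall>h'\<in>TV n s 0. \<forall>c::real. tangent n s D d x (\<lambda>i. c *\<^sub>R h i + h' i) =
            (\<lambda>i. c *\<^sub>R tangent n s D d x h i + tangent n s D d x h' i)) \<and>
        (\<exists>C. \<forall>h\<in>TV n s 0. NE n s 0 (tangent n s D d x h) \<le> C * NV n s 0 h) \<and>
        (\<forall>\<epsilon>>0. \<exists>\<delta>>0. \<forall>h. (\<lambda>i. x i + h i) \<in> X (Suc c) n s 1 \<longrightarrow> NV n s 1 h < \<delta> \<longrightarrow>
            NE n s 0 (\<lambda>i. d (\<lambda>j. x j + h j) i - d x i - tangent n s D d x h i) \<le> \<epsilon> * NV n s 1 h)"
    unfolding X1
    using tangent(1)[OF x] tangent_linear[OF x] tangent_bounded[OF x] tangent_approx[OF x] by blast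
qed

text \<open>With \<open>k\<close> and \<open>k0\<close> the tangents at \<open>(x, h)\<close> and
  \<open>(x0, h0)\<close>, the difference is bounded through
  \<open>D z (0, k - k0) = - D z (h, k0)\<close>, which tends to \<open>D z0 (h0, k0) = 0\<close>.
  As \<open>k0\<close> stays fixed, joint continuity suffices, and the fibre bound is uniform near
  \<open>z0\<close>.\<close>

lemma tangent_cont:
  assumes x0: "x0 \<in> X c n s (Suc (Suc m))" and h0: "h0 \<in> TV n s m" and "e > 0"
  shows "\<exists>\<delta>>0. \<forall>x\<in>X c n s (Suc (Suc m)). \<forall>h\<in>TV n s m.
    NV n s m (\<lambda>i. x i - x0 i) < \<delta> \<longrightarrow> NV n s m (\<lambda>i. h i - h0 i) < \<delta> \<longrightarrow>
    NE n s m (\<lambda>i. tangent n s D d x h i - tangent n s D d x0 h0 i) < e"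
proof -
  have x1: "x0 \<in> X c n s (Suc m)" by (rule X_mono[OF _ x0]) simp
  define z0 where "z0 = fun_zip x0 (d x0)"
  have z0: "z0 \<in> \<Omega> n s (Suc m)" unfolding z0_def by (rule solution_in_\<Omega>[OF sol x1])
  obtain r C where rC: "r > 0" "C > 0" "\<And>y y' k. fun_zip y y' \<in> \<Omega> n s (Suc m) \<Longrightarrow>
    NZ n s (Suc m) (\<lambda>i. fun_zip y y' i - z0 i) < r \<Longrightarrow> k \<in> TE n s m \<Longrightarrow>
    NE n s m k \<le> C * NE n s m (D (fun_zip y y') (fun_zip (\<lambda>i. 0) k))"
    using deriv_fibre_bounded_below[OF C1 sol inj x1] unfolding z0_def by meson
  define k0 where "k0 = tangent n s D d x0 h0"
  have k0: "k0 \<in> TE n s m" "D z0 (fun_zip h0 k0) = (\<lambda>i. 0)"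
    using tangent[OF x0 h0] by (simp_all add: k0_def z0_def)
  have "e / C > 0" using \<open>e > 0\<close> rC by simp
  then obtain \<rho> where \<rho>: "\<rho> > 0" "\<And>z h. z \<in> \<Omega> n s (Suc m) \<Longrightarrow> h \<in> TZ n s m \<Longrightarrow>
    NZ n s (Suc m) (\<lambda>i. z i - z0 i) < \<rho> \<Longrightarrow> NZ n s m (\<lambda>i. h i - fun_zip h0 k0 i) < \<rho> \<Longrightarrow>
    NE n s m (\<lambda>i. D z h i - D z0 (fun_zip h0 k0) i) < e / C"
    using deriv_cont[OF C1 z0 fun_zip_in_TZ[OF h0 k0(1)]] by meson
  obtain \<gamma> where \<gamma>: "\<gamma> > 0" "\<And>x. x \<in> X c n s (Suc m) \<Longrightarrow> NV n s (Suc m) (\<lambda>i. x i - x0 i) < \<gamma> \<Longrightarrow>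
      NZ n s (Suc m) (\<lambda>i. fun_zip x (d x) i - z0 i) < min r \<rho>"
    using graph_cont[OF sol x1, of "min r \<rho>"] rC(1) \<rho>(1) unfolding z0_def by auto
  have "NE n s m (\<lambda>i. tangent n s D d x h i - k0 i) < e"
    if x: "x \<in> X c n s (Suc (Suc m))" and h: "h \<in> TV n s m"
      and near: "NV n s m (\<lambda>i. x i - x0 i) < min \<gamma> \<rho>" "NV n s m (\<lambda>i. h i - h0 i) < min \<gamma> \<rho>" for x h
  proof -
    have xm: "x \<in> X c n s (Suc m)" by (rule X_mono[OF _ x]) simp
    define z where "z = fun_zip x (d x)"
    have z: "z \<in> \<Omega> n s (Suc m)" unfolding z_def by (rule solution_in_\<Omega>[OF sol xm])
    have zz: "NZ n s (Suc m) (\<lambda>i. z i - z0 i) < min r \<rho>"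
      unfolding z_def
      by (rule \<gamma>(2)[OF xm]) (use near in \<open>simp add: tnorm_const_eq[of n s "Suc m" _ s m]\<close>)
    define k where "k = tangent n s D d x h"
    have k: "k \<in> TE n s m" "D z (fun_zip h k) = (\<lambda>i. 0)"
      using tangent[OF x h] by (simp_all add: k_def z_def)
    note T = tlev_diff[OF k(1) k0(1)]
    have hk0: "fun_zip h k0 \<in> TZ n s m" by (rule fun_zip_in_TZ[OF h k0(1)])
    have "fun_zip (\<lambda>i. 0) (\<lambda>i. k i - k0 i) = (\<lambda>i. fun_zip h k i - fun_zip h k0 i)"
      by (simp add: fun_zip_def)
    then have eq: "D z (fun_zip (\<lambda>i. 0) (\<lambda>i. k i - k0 i)) = (\<lambda>i. - D z (fun_zip h k0) i)"
      using deriv_diff[OF C1 z fun_zip_in_TZ[OF h k(1)] hk0] k(2) by simp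
    have "NE n s m (\<lambda>i. k i - k0 i) \<le> C * NE n s m (D z (fun_zip (\<lambda>i. 0) (\<lambda>i. k i - k0 i)))"
      unfolding z_def by (rule rC(3)[OF _ _ T]) (use z zz in \<open>simp_all add: z_def\<close>)
    also have "\<dots> = C * NE n s m (D z (fun_zip h k0))"
      unfolding eq tnorm_uminus[OF deriv_lev[OF C1 z hk0]] ..
    also have "\<dots> < C * (e / C)"
    proof (rule mult_strict_left_mono)
      have "NZ n s m (\<lambda>i. fun_zip h k0 i - fun_zip h0 k0 i) < \<rho>"
        unfolding tnorm_fun_zip_diff using near by simp
      then show "NE n s m (D z (fun_zip h k0)) < e / C"
        using \<rho>(2)[OF z hk0] zz k0(2) by simp
    qed (rule rC)
    finally show ?thesis using rC by (simp add: k_def)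
  qed
  moreover have "min \<gamma> \<rho> > 0" using \<gamma> \<rho> by simp
  ultimately show ?thesis unfolding k0_def by blast
qed

lemma tmap_tangent_lev:
  assumes "x \<in> X (Suc (Suc c)) (2 * n) (tshift n s) m"
  shows "tmap n n d (tangent n s D d) x \<in> TE (2 * n) (tshift n s) m"
proof -
  note x = X_tshift_D[OF is_sc1_width[OF C1] assms]
  have "d (tfst n x) \<in> TE n s (Suc m)" by (rule solution_lev[OF sol]) (rule X_mono[OF _ x(2)], simp)
  then show ?thesis
    unfolding tmap_def using tpair_in_tlev_iff tangent(1)[OF x(2,3)] by blast
qed

lemma tmap_tangent_sc0:
  "sc0_map const_lev const_norm (2 * n) (tshift n s) L N (2 * n) (tshift n s)
    (X (Suc (Suc c)) (2 * n) (tshift n s)) (tmap n n d (tangent n s D d))"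
  unfolding sc0_map_def
proof (intro allI ballI conjI impI)
  fix m x0 and e :: real
  assume x0: "x0 \<in> X (Suc (Suc c)) (2 * n) (tshift n s) m"
  show "tmap n n d (tangent n s D d) x0 \<in> TE (2 * n) (tshift n s) m" by (rule tmap_tangent_lev[OF x0])
  assume e: "e > 0"
  note a0 = X_tshift_D[OF is_sc1_width[OF C1] x0]
  have a0': "tfst n x0 \<in> X c n s (Suc m)" by (rule X_mono[OF _ a0(2)]) simp
  obtain \<delta>1 where \<delta>1: "\<delta>1 > 0" "\<And>x. x \<in> X c n s (Suc m) \<Longrightarrow> NV n s (Suc m) (\<lambda>i. x i - tfst n x0 i) < \<delta>1 \<Longrightarrow>
      NE n s (Suc m) (\<lambda>i. d x i - d (tfst n x0) i) < e / 2"
    using solution_cont[OF sol a0', of "e / 2"] e by auto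
  obtain \<delta>2 where \<delta>2: "\<delta>2 > 0" "\<And>x h. x \<in> X c n s (Suc (Suc m)) \<Longrightarrow> h \<in> TV n s m \<Longrightarrow>
    NV n s m (\<lambda>i. x i - tfst n x0 i) < \<delta>2 \<Longrightarrow> NV n s m (\<lambda>i. h i - tsnd n x0 i) < \<delta>2 \<Longrightarrow>
    NE n s m (\<lambda>i. tangent n s D d x h i - tangent n s D d (tfst n x0) (tsnd n x0) i) < e / 2"
    using tangent_cont[OF a0(2,3), of "e / 2"] e by (meson half_gt_zero)
  show "\<exists>\<delta>>0. \<forall>x\<in>X (Suc (Suc c)) (2 * n) (tshift n s) m.
      NV (2 * n) (tshift n s) m (\<lambda>i. x i - x0 i) < \<delta> \<longrightarrow>
      NE (2 * n) (tshift n s) m (\<lambda>i. tmap n n d (tangent n s D d) x i - tmap n n d (tangent n s D d) x0 i) < e"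
  proof (intro exI[of _ "min \<delta>1 \<delta>2"] conjI ballI impI)
    fix x assume x: "x \<in> X (Suc (Suc c)) (2 * n) (tshift n s) m"
      and near: "NV (2 * n) (tshift n s) m (\<lambda>i. x i - x0 i) < min \<delta>1 \<delta>2"
    note a = X_tshift_D[OF is_sc1_width[OF C1] x]
    have a': "tfst n x \<in> X c n s (Suc m)" by (rule X_mono[OF _ a(2)]) simp
    have "NV n s (Suc m) (\<lambda>i. tfst n x i - tfst n x0 i) + NV n s m (\<lambda>i. tsnd n x i - tsnd n x0 i) < min \<delta>1 \<delta>2"
      using near by (simp add: tnorm_tshift tfst_minus tsnd_minus)
    moreover have "0 \<le> NV n s (Suc m) (\<lambda>i. tfst n x i - tfst n x0 i)"
      by (intro P.tnorm_nonneg P.tlev_diff X_TV[OF a(2)] X_TV[OF a0(2)])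
    moreover have "0 \<le> NV n s m (\<lambda>i. tsnd n x i - tsnd n x0 i)"
      by (intro P.tnorm_nonneg P.tlev_diff a(3) a0(3))
    moreover have "NV n s m (\<lambda>i. tfst n x i - tfst n x0 i) = NV n s (Suc m) (\<lambda>i. tfst n x i - tfst n x0 i)"
      by (rule tnorm_const_eq)
    ultimately have near': "NV n s (Suc m) (\<lambda>i. tfst n x i - tfst n x0 i) < \<delta>1"
      "NV n s m (\<lambda>i. tfst n x i - tfst n x0 i) < \<delta>2" "NV n s m (\<lambda>i. tsnd n x i - tsnd n x0 i) < \<delta>2"
      by auto
    have "NE (2 * n) (tshift n s) m (\<lambda>i. tmap n n d (tangent n s D d) x i - tmap n n d (tangent n s D d) x0 i)
      = NE n s (Suc m) (\<lambda>i. d (tfst n x) i - d (tfst n x0) i)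
        + NE n s m (\<lambda>i. tangent n s D d (tfst n x) (tsnd n x) i - tangent n s D d (tfst n x0) (tsnd n x0) i)"
      unfolding tmap_def
      by (rule NE_tpair_diff[OF solution_lev[OF sol a'] solution_lev[OF sol a0'] tangent(1)[OF a(2,3)] tangent(1)[OF a0(2,3)]])
    also have "\<dots> < e" using \<delta>1(2)[OF a' near'(1)] \<delta>2(2)[OF a(2,3) near'(2,3)] by simp
    finally show "NE (2 * n) (tshift n s) m (\<lambda>i. tmap n n d (tangent n s D d) x i - tmap n n d (tangent n s D d) x0 i) < e" .
  qed (use \<delta>1 \<delta>2 in auto)
qed

text \<open>The tangent equation is the pair of the equation at the base point and its
  linearisation; the tangent of the solution satisfies both by construction.\<close>

lemma tmap_tangent_solution:
  "solution (2 * n) (tshift n s) (Suc (Suc c)) (tmap n n g D) (tmap n n d (tangent n s D d))"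
  unfolding solution_def
proof (intro conjI allI ballI tmap_tangent_sc0)
  have n: "n \<ge> 1" by (rule is_sc1_width[OF C1])
  then show "1 \<le> 2 * n" by simp
  show "(x 0, tmap n n d (tangent n s D d) x 0) \<in> U (m + tshift n s 0)"
    if "x \<in> X (Suc (Suc c)) (2 * n) (tshift n s) m" for x m
  proof -
    note a = X_tshift_D[OF is_sc1_width[OF C1] that]
    have "(tfst n x 0, d (tfst n x) 0) \<in> U (Suc m + s 0)"
    proof -
      have "\<forall>x\<in>X c n s (Suc m). (x 0, d x 0) \<in> U (Suc m + s 0)"
        using sol unfolding solution_def by blast
      then show ?thesis using X_mono[OF _ a(2), of "Suc m"] by simp
    qed
    then show ?thesis using n by (simp add: tmap_def tpair_def tshift_def tfst_def)
  qed
  show "tmap n n g D (fun_zip x (tmap n n d (tangent n s D d) x)) = (\<lambda>i. 0)"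
    if "x \<in> X (Suc (Suc c)) (2 * n) (tshift n s) 0" for x
  proof -
    note a = X_tshift_D[OF is_sc1_width[OF C1] that]
    have 1: "tfst n (tmap n n d (tangent n s D d) x) = d (tfst n x)"
      unfolding tmap_def by (rule tfst_tpair[OF solution_lev[OF sol a(2)]])
    have 2: "tsnd n (tmap n n d (tangent n s D d) x) = tangent n s D d (tfst n x) (tsnd n x)"
      unfolding tmap_def by (rule tsnd_tpair[OF tangent(1)[OF a(2,3)]])
    have "tmap n n g D (fun_zip x (tmap n n d (tangent n s D d) x)) = tpair n (\<lambda>i. 0) (\<lambda>i. 0)"
      unfolding tmap_def[of n n g] tfst_fun_zip tsnd_fun_zip 1 2
      using solution_zero[OF sol a(2)] tangent(2)[OF a(2,3)] by simp
    then show ?thesis by (simp add: tpair_def)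
  qed
qed

end

section \<open>Passing to the tangent equation\<close>

lemma \<Omega>_tshift_D:
  assumes "n \<ge> 1" "\<zeta> \<in> \<Omega> (2 * n) (tshift n s) m"
  shows "\<zeta> = tpair n (tfst n \<zeta>) (tsnd n \<zeta>)" "tfst n \<zeta> \<in> \<Omega> n s (Suc m)" "tsnd n \<zeta> \<in> TZ n s m"
proof -
  have \<zeta>: "\<zeta> \<in> TZ (2 * n) (tshift n s) m" by (rule \<Omega>_TZ[OF assms(2)])
  then show 1: "\<zeta> = tpair n (tfst n \<zeta>) (tsnd n \<zeta>)" "tsnd n \<zeta> \<in> TZ n s m"
    by (auto simp: tlev_tshift_iff)
  have "tfst n \<zeta> \<in> TZ n s (Suc m)" using \<zeta> by (auto simp: tlev_tshift_iff)
  moreover have "tfst n \<zeta> 0 \<in> U (Suc m + s 0)"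
    using assms by (simp add: base_dom_def tshift_def tfst_def)
  ultimately show "tfst n \<zeta> \<in> \<Omega> n s (Suc m)" by (simp add: base_dom_def)
qed

text \<open>The tangent map is compared at \<open>(z, h)\<close> and \<open>(z', h)\<close>. The
  segment between them moves only the base point, so its length at tangent level \<open>m\<close> is
  the base norm at level \<open>Suc m\<close>. The bound comes from the derivative \<open>D'\<close>
  of the tangent map, that is, from a second derivative of \<open>g\<close>.\<close>

lemma tmap_Lipschitz_fibre:
  assumes C1: "is_sc1 n s g D" and C1': "is_sc1 (2 * n) (tshift n s) (tmap n n g D) D'"
    and \<zeta>0: "\<zeta>0 \<in> \<Omega> (2 * n) (tshift n s) (Suc m)"
  shows "\<exists>r>0. \<exists>B>0. \<forall>z z' h. tpair n z h \<in> TZ (2 * n) (tshift n s) (Suc m) \<longrightarrow>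
    tpair n z' h \<in> TZ (2 * n) (tshift n s) (Suc m) \<longrightarrow>
    z \<in> \<Omega> n s (Suc (Suc m)) \<longrightarrow> z' \<in> \<Omega> n s (Suc (Suc m)) \<longrightarrow> h \<in> TZ n s (Suc m) \<longrightarrow>
    NZ (2 * n) (tshift n s) (Suc m) (\<lambda>i. tpair n z h i - \<zeta>0 i) < r \<longrightarrow>
    NZ (2 * n) (tshift n s) (Suc m) (\<lambda>i. tpair n z' h i - \<zeta>0 i) < r \<longrightarrow>
    NE n s m (\<lambda>i. D z' h i - D z h i) \<le> B * NZ n s (Suc m) (\<lambda>i. z' i - z i)"
proof -
  have n: "n \<ge> 1" "2 * n \<ge> 1" using is_sc1_width[OF C1] by simp_all
  let ?T = "TZ (2 * n) (tshift n s)" and ?N = "NZ (2 * n) (tshift n s)" and ?\<Omega> = "\<Omega> (2 * n) (tshift n s)"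
  obtain r1 B where r1: "r1 > 0" "B > 0" "\<And>\<zeta> \<eta>. \<zeta> \<in> ?\<Omega> (Suc m) \<Longrightarrow>
    ?N (Suc m) (\<lambda>i. \<zeta> i - \<zeta>0 i) < r1 \<Longrightarrow> \<eta> \<in> ?T m \<Longrightarrow>
    NE (2 * n) (tshift n s) m (D' \<zeta> \<eta>) \<le> B * ?N m \<eta>"
    using deriv_locally_bounded[OF C1' \<zeta>0] by meson
  obtain r2 where r2: "r2 > 0" "\<And>\<zeta> \<zeta>' t. \<zeta> \<in> ?T (Suc m) \<Longrightarrow> \<zeta>' \<in> ?T (Suc m) \<Longrightarrow>
    fst (\<zeta> 0) \<in> V \<Longrightarrow> fst (\<zeta>' 0) \<in> V \<Longrightarrow>
    ?N (Suc m) (\<lambda>i. \<zeta> i - \<zeta>0 i) < r2 \<Longrightarrow> ?N (Suc m) (\<lambda>i. \<zeta>' i - \<zeta>0 i) < r2 \<Longrightarrow> t \<in> {0..1} \<Longrightarrow>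
    (\<lambda>i. \<zeta> i + t *\<^sub>R (\<zeta>' i - \<zeta> i)) \<in> ?\<Omega> (Suc m) \<and>
      ?N (Suc m) (\<lambda>i. (\<zeta> i + t *\<^sub>R (\<zeta>' i - \<zeta> i)) - \<zeta>0 i)
        \<le> max (?N (Suc m) (\<lambda>i. \<zeta> i - \<zeta>0 i)) (?N (Suc m) (\<lambda>i. \<zeta>' i - \<zeta>0 i))"
    using \<Omega>_segment[OF n(2) \<zeta>0] by meson
  have "NE n s m (\<lambda>i. D z' h i - D z h i) \<le> (real (2 * n) * B) * NZ n s (Suc m) (\<lambda>i. z' i - z i)"
    if T: "tpair n z h \<in> ?T (Suc m)" "tpair n z' h \<in> ?T (Suc m)"
      and z: "z \<in> \<Omega> n s (Suc (Suc m))" and z': "z' \<in> \<Omega> n s (Suc (Suc m))" and h: "h \<in> TZ n s (Suc m)"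
      and near: "?N (Suc m) (\<lambda>i. tpair n z h i - \<zeta>0 i) < min r1 r2"
        "?N (Suc m) (\<lambda>i. tpair n z' h i - \<zeta>0 i) < min r1 r2" for z z' h
  proof -
    define \<zeta> where "\<zeta> = tpair n z h"
    define \<zeta>' where "\<zeta>' = tpair n z' h"
    note T = T[folded \<zeta>_def \<zeta>'_def] and near = near[folded \<zeta>_def \<zeta>'_def]
    have V: "fst (\<zeta> 0) \<in> V" "fst (\<zeta>' 0) \<in> V"
      using \<Omega>_V[OF z] \<Omega>_V[OF z'] n by (simp_all add: \<zeta>_def \<zeta>'_def tpair_def)
    have near2: "?N (Suc m) (\<lambda>i. \<zeta> i - \<zeta>0 i) < r2" "?N (Suc m) (\<lambda>i. \<zeta>' i - \<zeta>0 i) < r2"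
      using near by simp_all
    define \<eta> where "\<eta> = (\<lambda>i. \<zeta>' i - \<zeta> i)"
    have \<eta>: "\<eta> \<in> ?T (Suc m)" unfolding \<eta>_def by (rule Z.tlev_diff[OF T(2,1)])
    have \<eta>m: "\<eta> \<in> ?T m" using \<eta> Z.tlev_mono[of m "Suc m" "2 * n" "tshift n s"] by auto
    have zT: "z \<in> TZ n s (Suc m)" "z' \<in> TZ n s (Suc m)"
      using \<Omega>_TZ[OF \<Omega>_mono[OF _ z, of "Suc m"]] \<Omega>_TZ[OF \<Omega>_mono[OF _ z', of "Suc m"]] by simp_all
    have hm: "h \<in> TZ n s m" using h Z.tlev_mono[of m "Suc m" n s] by auto
    have N\<eta>: "?N m \<eta> = NZ n s (Suc m) (\<lambda>i. z' i - z i)"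
      unfolding \<eta>_def \<zeta>_def \<zeta>'_def using NZ_tpair_diff[OF zT(2,1) hm hm] by simp
    have "NE (2 * n) (tshift n s) m (\<lambda>i. tmap n n g D (\<lambda>i. \<zeta> i + \<eta> i) i - tmap n n g D \<zeta> i - (\<lambda>i. 0) i)
        \<le> real (2 * n) * (B * ?N m \<eta>)"
    proof (rule sc1_mean_value[OF C1' \<eta> tlev_0])
      fix t :: real assume t: "t \<in> {0..1}"
      note seg = r2(2)[OF T V near2 t, folded \<eta>_def]
      show seg1: "(\<lambda>i. \<zeta> i + t *\<^sub>R \<eta> i) \<in> ?\<Omega> (Suc m)" unfolding \<eta>_def by (rule conjunct1[OF seg])
      have "?N (Suc m) (\<lambda>i. (\<zeta> i + t *\<^sub>R \<eta> i) - \<zeta>0 i) < r1"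
        unfolding \<eta>_def by (rule le_less_trans[OF conjunct2[OF seg]]) (use near in simp)
      from r1(3)[OF seg1 this \<eta>m]
      show "NE (2 * n) (tshift n s) m (\<lambda>i. D' (\<lambda>i. \<zeta> i + t *\<^sub>R \<eta> i) \<eta> i - (\<lambda>i. 0) i) \<le> B * ?N m \<eta>" by simp
    qed
    moreover have "(\<lambda>i. \<zeta> i + \<eta> i) = \<zeta>'" by (simp add: \<eta>_def)
    ultimately have mv: "NE (2 * n) (tshift n s) m (\<lambda>i. tmap n n g D \<zeta>' i - tmap n n g D \<zeta> i)
        \<le> real (2 * n) * (B * ?N m \<eta>)" by simp
    have zm: "z \<in> \<Omega> n s (Suc m)" "z' \<in> \<Omega> n s (Suc m)"
      using \<Omega>_mono[OF _ z, of "Suc m"] \<Omega>_mono[OF _ z', of "Suc m"] by simp_all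
    have "NE (2 * n) (tshift n s) m (\<lambda>i. tmap n n g D \<zeta>' i - tmap n n g D \<zeta> i)
      = NE n s (Suc m) (\<lambda>i. g z' i - g z i) + NE n s m (\<lambda>i. D z' h i - D z h i)"
      unfolding \<zeta>_def \<zeta>'_def tmap_tpair[OF zT(1) h] tmap_tpair[OF zT(2) h]
      by (rule NE_tpair_diff[OF is_sc1_lev[OF C1 zm(2)] is_sc1_lev[OF C1 zm(1)] deriv_lev[OF C1 zm(2) hm] deriv_lev[OF C1 zm(1) hm]])
    moreover have "0 \<le> NE n s (Suc m) (\<lambda>i. g z' i - g z i)"
      by (intro tnorm_nonneg tlev_diff is_sc1_lev[OF C1] zm)
    ultimately show ?thesis using mv by (simp add: N\<eta> mult.assoc)
  qed
  moreover have "min r1 r2 > 0" "real (2 * n) * B > 0" using r1 r2 n by auto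
  ultimately show ?thesis by blast
qed

text \<open>The base parts are controlled by the old estimate at level \<open>Suc m\<close>. For the
  vector parts, \<open>D z (h - h')\<close> is the sum of \<open>D z h - D z' h'\<close> and
  \<open>D z' h' - D z h'\<close>. The former is a difference of values of the tangent equation; the
  latter is Lipschitz in \<open>z' - z\<close>, a fibre difference that has already been
  bounded.\<close>

lemma inj_estimate_tmap:
  assumes C1: "is_sc1 n s g D" and sol: "solution n s c g d" and inj: "inj_estimate n s c g d"
    and C1': "is_sc1 (2 * n) (tshift n s) (tmap n n g D) D'"
  shows "inj_estimate (2 * n) (tshift n s) (Suc (Suc c)) (tmap n n g D) (tmap n n d (tangent n s D d))"
  unfolding inj_estimate_def
proof (intro allI ballI)
  fix m x0 assume x0: "x0 \<in> X (Suc (Suc c)) (2 * n) (tshift n s) (Suc m)"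
  have n: "n \<ge> 1" by (rule is_sc1_width[OF C1])
  let ?N = "NZ (2 * n) (tshift n s)"
  define d' where "d' = tmap n n d (tangent n s D d)"
  define \<zeta>0 where "\<zeta>0 = fun_zip x0 (d' x0)"
  have \<zeta>0: "\<zeta>0 \<in> \<Omega> (2 * n) (tshift n s) (Suc m)"
    unfolding \<zeta>0_def d'_def by (rule solution_in_\<Omega>[OF tmap_tangent_solution[OF C1 sol inj] x0])
  define a where "a = tfst n x0"
  have a3: "a \<in> X c n s (Suc (Suc (Suc m)))" unfolding a_def by (rule X_tshift_D(2)[OF n x0])
  have a2: "a \<in> X c n s (Suc (Suc m))" and a1: "a \<in> X c n s (Suc m)" by (rule X_mono[OF _ a3], simp)+
  define z0 where "z0 = fun_zip a (d a)"
  have z0: "z0 \<in> \<Omega> n s (Suc (Suc m))" unfolding z0_def by (rule solution_in_\<Omega>[OF sol a2])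
  have \<zeta>0_fst: "tfst n \<zeta>0 = z0"
    unfolding \<zeta>0_def z0_def d'_def tfst_fun_zip a_def tmap_def
    using tfst_tpair[OF solution_lev[OF sol a3]] by (simp add: a_def)
  obtain r1 C where r1: "r1 > 0" "C > 0" "\<And>x y y'. fun_zip x y \<in> \<Omega> n s (Suc (Suc m)) \<Longrightarrow>
    fun_zip x y' \<in> \<Omega> n s (Suc (Suc m)) \<Longrightarrow>
    NZ n s (Suc (Suc m)) (\<lambda>i. fun_zip x y i - z0 i) < r1 \<Longrightarrow>
    NZ n s (Suc (Suc m)) (\<lambda>i. fun_zip x y' i - z0 i) < r1 \<Longrightarrow>
    NE n s (Suc m) (\<lambda>i. y i - y' i) \<le> C * NE n s (Suc m) (\<lambda>i. g (fun_zip x y) i - g (fun_zip x y') i)"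
    using inj a2 unfolding inj_estimate_def z0_def by meson
  obtain r2 K where r2: "r2 > 0" "K > 0" "\<And>x y k. fun_zip x y \<in> \<Omega> n s (Suc m) \<Longrightarrow>
    NZ n s (Suc m) (\<lambda>i. fun_zip x y i - z0 i) < r2 \<Longrightarrow> k \<in> TE n s m \<Longrightarrow>
    NE n s m k \<le> K * NE n s m (D (fun_zip x y) (fun_zip (\<lambda>i. 0) k))"
    using deriv_fibre_bounded_below[OF C1 sol inj a1] unfolding z0_def by meson
  obtain A where A: "A > 0" "\<And>z. z \<in> TZ n s (Suc (Suc m)) \<Longrightarrow> NZ n s (Suc m) z \<le> A * NZ n s (Suc (Suc m)) z"
    using Z.tnorm_embed[of "Suc m" "Suc (Suc m)" n s] by auto
  obtain r3 B where r3: "r3 > 0" "B > 0" "\<And>z z' h. tpair n z h \<in> TZ (2 * n) (tshift n s) (Suc m) \<Longrightarrow>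
    tpair n z' h \<in> TZ (2 * n) (tshift n s) (Suc m) \<Longrightarrow>
    z \<in> \<Omega> n s (Suc (Suc m)) \<Longrightarrow> z' \<in> \<Omega> n s (Suc (Suc m)) \<Longrightarrow> h \<in> TZ n s (Suc m) \<Longrightarrow>
    ?N (Suc m) (\<lambda>i. tpair n z h i - \<zeta>0 i) < r3 \<Longrightarrow>
    ?N (Suc m) (\<lambda>i. tpair n z' h i - \<zeta>0 i) < r3 \<Longrightarrow>
    NE n s m (\<lambda>i. D z' h i - D z h i) \<le> B * NZ n s (Suc m) (\<lambda>i. z' i - z i)"
    using tmap_Lipschitz_fibre[OF C1 C1' \<zeta>0] by meson
  \<comment> \<open>\<open>r2\<close> is a radius at the lower level, hence the embedding constant
    \<open>A\<close>. Half of \<open>r3\<close> is taken because of the mixed tuple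
    \<open>(z, h')\<close>, whose distance is bounded by the sum of those of the two given
    tuples.\<close>
  define r where "r = min (min r1 (r2 / A)) (r3 / 2)"
  have r: "r > 0" using r1 r2 r3 A by (simp add: r_def)
  \<comment> \<open>Sum of the coefficients in \<open>C * e1 + K * (e2 + B * (C * e1))\<close>,
    which bounds base and vector part together.\<close>
  define Q where "Q = C + K + K * B * C"
  have Q: "Q > 0" using r1 r2 r3 by (simp add: Q_def add_pos_pos)
  have "NE (2 * n) (tshift n s) m (\<lambda>i. y i - y' i) \<le> Q * NE (2 * n) (tshift n s) m
      (\<lambda>i. tmap n n g D (fun_zip x y) i - tmap n n g D (fun_zip x y') i)"
    if \<zeta>: "fun_zip x y \<in> \<Omega> (2 * n) (tshift n s) (Suc m)"
      and \<zeta>': "fun_zip x y' \<in> \<Omega> (2 * n) (tshift n s) (Suc m)"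
      and near: "?N (Suc m) (\<lambda>i. fun_zip x y i - \<zeta>0 i) < r" "?N (Suc m) (\<lambda>i. fun_zip x y' i - \<zeta>0 i) < r"
    for x y y'
  proof -
    define z where "z = fun_zip (tfst n x) (tfst n y)"
    define z' where "z' = fun_zip (tfst n x) (tfst n y')"
    define h where "h = fun_zip (tsnd n x) (tsnd n y)"
    define h' where "h' = fun_zip (tsnd n x) (tsnd n y')"
    note D\<zeta> = \<Omega>_tshift_D[OF n \<zeta>, unfolded tfst_fun_zip tsnd_fun_zip, folded z_def h_def]
    note D\<zeta>' = \<Omega>_tshift_D[OF n \<zeta>', unfolded tfst_fun_zip tsnd_fun_zip, folded z'_def h'_def]
    have z1: "z \<in> \<Omega> n s (Suc m)" "z' \<in> \<Omega> n s (Suc m)"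
      using \<Omega>_mono[OF _ D\<zeta>(2), of "Suc m"] \<Omega>_mono[OF _ D\<zeta>'(2), of "Suc m"] by simp_all
    have hm: "h \<in> TZ n s m" "h' \<in> TZ n s m"
      using D\<zeta>(3) D\<zeta>'(3) Z.tlev_mono[of m "Suc m" n s] by auto
    have y: "tfst n y \<in> TE n s (Suc m)" "tfst n y' \<in> TE n s (Suc m)" "tsnd n y \<in> TE n s m" "tsnd n y' \<in> TE n s m"
      using \<Omega>_TZ[OF z1(1)] \<Omega>_TZ[OF z1(2)] hm
      unfolding z_def z'_def h_def h'_def fun_zip_in_sum_lev_iff by blast+
    have split: "?N (Suc m) (\<lambda>i. \<omega> i - \<zeta>0 i) = NZ n s (Suc (Suc m)) (\<lambda>i. tfst n \<omega> i - z0 i)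
        + NZ n s (Suc m) (\<lambda>i. tsnd n \<omega> i - tsnd n \<zeta>0 i)" for \<omega>
      unfolding tnorm_tshift tfst_minus tsnd_minus \<zeta>0_fst ..
    have \<zeta>0s: "tsnd n \<zeta>0 \<in> TZ n s (Suc m)" by (rule \<Omega>_tshift_D(3)[OF n \<zeta>0])
    have zz0: "(\<lambda>i. z i - z0 i) \<in> TZ n s (Suc (Suc m))" "(\<lambda>i. z' i - z0 i) \<in> TZ n s (Suc (Suc m))"
      by (intro Z.tlev_diff \<Omega>_TZ D\<zeta>(2) D\<zeta>'(2) z0)+
    have pos: "0 \<le> NZ n s (Suc (Suc m)) (\<lambda>i. z i - z0 i)" "0 \<le> NZ n s (Suc (Suc m)) (\<lambda>i. z' i - z0 i)"
      "0 \<le> NZ n s (Suc m) (\<lambda>i. h i - tsnd n \<zeta>0 i)" "0 \<le> NZ n s (Suc m) (\<lambda>i. h' i - tsnd n \<zeta>0 i)"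
      by (intro Z.tnorm_nonneg zz0 Z.tlev_diff D\<zeta>(3) D\<zeta>'(3) \<zeta>0s)+
    have sum: "NZ n s (Suc (Suc m)) (\<lambda>i. z i - z0 i) + NZ n s (Suc m) (\<lambda>i. h i - tsnd n \<zeta>0 i) < r"
      "NZ n s (Suc (Suc m)) (\<lambda>i. z' i - z0 i) + NZ n s (Suc m) (\<lambda>i. h' i - tsnd n \<zeta>0 i) < r"
      using near unfolding split tfst_fun_zip tsnd_fun_zip z_def z'_def h_def h'_def by blast+
    have nz: "NZ n s (Suc (Suc m)) (\<lambda>i. z i - z0 i) < r" "NZ n s (Suc (Suc m)) (\<lambda>i. z' i - z0 i) < r"
      using sum pos by linarith+
    define e1 where "e1 = NE n s (Suc m) (\<lambda>i. g z i - g z' i)"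
    define e2 where "e2 = NE n s m (\<lambda>i. D z h i - D z' h' i)"
    have e: "e1 \<ge> 0" "e2 \<ge> 0" unfolding e1_def e2_def
      by (intro tnorm_nonneg tlev_diff is_sc1_lev[OF C1] deriv_lev[OF C1] z1 hm)+
    have base: "NE n s (Suc m) (\<lambda>i. tfst n y i - tfst n y' i) \<le> C * e1"
      unfolding e1_def z_def z'_def
      by (rule r1(3)) (use D\<zeta>(2) D\<zeta>'(2) nz in \<open>simp_all add: z_def z'_def r_def\<close>)
    define k where "k = (\<lambda>i. tsnd n y i - tsnd n y' i)"
    have k: "k \<in> TE n s m" unfolding k_def by (intro tlev_diff y)
    have "fun_zip (\<lambda>i. 0) k = (\<lambda>i. h i - h' i)" by (simp add: fun_zip_def k_def h_def h'_def)
    then have Dk: "D z (fun_zip (\<lambda>i. 0) k) = (\<lambda>i. D z h i - D z h' i)"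
      using deriv_diff[OF C1 z1(1) hm] by simp
    have "NZ n s (Suc m) (\<lambda>i. z i - z0 i) < r2"
    proof -
      have "NZ n s (Suc m) (\<lambda>i. z i - z0 i) \<le> A * NZ n s (Suc (Suc m)) (\<lambda>i. z i - z0 i)" by (rule A(2)[OF zz0(1)])
      also have "\<dots> < A * (r2 / A)" using nz(1) A(1) by (intro mult_strict_left_mono) (auto simp: r_def)
      finally show ?thesis using A(1) by simp
    qed
    then have "NE n s m k \<le> K * NE n s m (\<lambda>i. D z h i - D z h' i)"
      using r2(3)[of "tfst n x" "tfst n y" k, folded z_def, OF z1(1) _ k] unfolding Dk by blast
    also have "\<dots> \<le> K * (e2 + NE n s m (\<lambda>i. D z' h' i - D z h' i))"
      unfolding e2_def using r2(2)
      by (intro mult_left_mono tnorm_diff_triangle deriv_lev[OF C1] z1 hm) auto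
    also have "\<dots> \<le> K * (e2 + B * (C * e1))"
    proof -
      have "NE n s m (\<lambda>i. D z' h' i - D z h' i) \<le> B * NZ n s (Suc m) (\<lambda>i. z' i - z i)"
      proof (rule r3(3)[OF _ _ D\<zeta>(2) D\<zeta>'(2) D\<zeta>'(3)])
        show "tpair n z h' \<in> TZ (2 * n) (tshift n s) (Suc m)" "tpair n z' h' \<in> TZ (2 * n) (tshift n s) (Suc m)"
          using tpair_in_tlev_iff[OF \<Omega>_TZ[OF D\<zeta>(2)] D\<zeta>'(3)] tpair_in_tlev_iff[OF \<Omega>_TZ[OF D\<zeta>'(2)] D\<zeta>'(3)]
            \<Omega>_TZ[OF D\<zeta>(2)] \<Omega>_TZ[OF D\<zeta>'(2)] D\<zeta>'(3) by blast+
        show "?N (Suc m) (\<lambda>i. tpair n z h' i - \<zeta>0 i) < r3" "?N (Suc m) (\<lambda>i. tpair n z' h' i - \<zeta>0 i) < r3"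
          unfolding split tfst_tpair[OF \<Omega>_TZ[OF D\<zeta>(2)]] tfst_tpair[OF \<Omega>_TZ[OF D\<zeta>'(2)]] tsnd_tpair[OF D\<zeta>'(3)]
          using sum pos by (auto simp: r_def)
      qed
      also have "(\<lambda>i. z' i - z i) = (\<lambda>i. fun_zip (tfst n x) (tfst n y') i - fun_zip (tfst n x) (tfst n y) i)"
        by (simp add: z_def z'_def)
      also have "NZ n s (Suc m) \<dots> = NE n s (Suc m) (\<lambda>i. tfst n y i - tfst n y' i)"
        unfolding tnorm_fun_zip_diff using tnorm_minus_commute[OF y(2,1)] by simp
      also have "B * \<dots> \<le> B * (C * e1)" using base r3(2) by (intro mult_left_mono) auto
      finally show ?thesis using r2(2) by (intro mult_left_mono) auto
    qed
    finally have fibre: "NE n s m k \<le> K * (e2 + B * (C * e1))" .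
    have lhs: "NE (2 * n) (tshift n s) m (\<lambda>i. y i - y' i)
        = NE n s (Suc m) (\<lambda>i. tfst n y i - tfst n y' i) + NE n s m k"
      unfolding tnorm_tshift tfst_minus tsnd_minus k_def ..
    have rhs: "NE (2 * n) (tshift n s) m (\<lambda>i. tmap n n g D (fun_zip x y) i - tmap n n g D (fun_zip x y') i) = e1 + e2"
      unfolding tmap_def tfst_fun_zip tsnd_fun_zip z_def[symmetric] z'_def[symmetric] h_def[symmetric] h'_def[symmetric]
        e1_def e2_def
      by (rule NE_tpair_diff[OF is_sc1_lev[OF C1 z1(1)] is_sc1_lev[OF C1 z1(2)] deriv_lev[OF C1 z1(1) hm(1)] deriv_lev[OF C1 z1(2) hm(2)]])
    have "C * e1 + K * (e2 + B * (C * e1)) \<le> Q * (e1 + e2)"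
    proof -
      have "0 \<le> C * e2" "0 \<le> K * e1" "0 \<le> K * B * C * e2" using e r1 r2 r3 by simp_all
      then show ?thesis unfolding Q_def by (simp add: algebra_simps)
    qed
    then show ?thesis unfolding lhs rhs using base fibre by linarith
  qed
  with r Q show "\<exists>r>0. \<exists>C>0. \<forall>x y y'. fun_zip x y \<in> \<Omega> (2 * n) (tshift n s) (Suc m) \<longrightarrow>
      fun_zip x y' \<in> \<Omega> (2 * n) (tshift n s) (Suc m) \<longrightarrow>
      ?N (Suc m) (\<lambda>i. fun_zip x y i - fun_zip x0 (tmap n n d (tangent n s D d) x0) i) < r \<longrightarrow>
      ?N (Suc m) (\<lambda>i. fun_zip x y' i - fun_zip x0 (tmap n n d (tangent n s D d) x0) i) < r \<longrightarrow>
      NE (2 * n) (tshift n s) m (\<lambda>i. y i - y' i) \<le> C * NE (2 * n) (tshift n s) m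
        (\<lambda>i. tmap n n g D (fun_zip x y) i - tmap n n g D (fun_zip x y') i)"
    unfolding \<zeta>0_def d'_def by blast
qed

section \<open>Induction on the order of differentiability\<close>

lemma sck_Suc_D:
  assumes "sck (Suc k) (sum_lev L) (sum_norm N) n s L N n s (\<Omega> n s) g" and n: "n \<ge> 1"
  obtains D where "is_sc1 n s g D"
    "sck k (sum_lev L) (sum_norm N) (2 * n) (tshift n s) L N (2 * n) (tshift n s)
      (\<Omega> (2 * n) (tshift n s)) (tmap n n g D)"
proof -
  obtain D where g: "sc0_map (sum_lev L) (sum_norm N) n s L N n s (\<Omega> n s) g"
    and D: "sc_deriv (sum_lev L) (sum_norm N) n s L N n s (\<Omega> n s) g D"
    and Tg: "sck k (sum_lev L) (sum_norm N) (2 * n) (tshift n s) L N (2 * n) (tshift n s)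
      (\<Omega> (2 * n) (tshift n s)) (tmap n n g D)"
    using assms by (auto simp: tdom_\<Omega>)
  have "is_sc1 n s g D" unfolding is_sc1_def using n g D sck_imp_sc0_map[OF Tg] by blast
  with Tg that show ?thesis by blast
qed

text \<open>Each step replaces \<open>k\<close> by \<open>k - 1\<close> and \<open>c\<close> by
  \<open>c + 2\<close>, so \<open>c + k\<close> rises by one, exactly as the offset does under
  \<open>tdom\<close>. The estimate is asked for only while \<open>k > 0\<close>, since carrying it
  to the tangent equation needs that equation to be sc1, which is not given in the last
  step.\<close>

lemma solution_sck:
  assumes "sck k (sum_lev L) (sum_norm N) n s L N n s (\<Omega> n s) g"
    and "solution n s c g d" and "k > 0 \<Longrightarrow> inj_estimate n s c g d"
  shows "sck k const_lev const_norm n s L N n s (X (c + k) n s) d"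
  using assms
proof (induction k arbitrary: n s c g d)
  case 0
  then show ?case by (simp add: solution_def)
next
  case (Suc k)
  note sol = Suc.prems(2) and inj = Suc.prems(3)[OF zero_less_Suc]
  have n: "n \<ge> 1" using sol by (simp add: solution_def)
  obtain D where C1: "is_sc1 n s g D" and Tg: "sck k (sum_lev L) (sum_norm N) (2 * n) (tshift n s) L N
      (2 * n) (tshift n s) (\<Omega> (2 * n) (tshift n s)) (tmap n n g D)"
    using sck_Suc_D[OF Suc.prems(1) n] by blast
  define d' where "d' = tmap n n d (tangent n s D d)"
  have inj': "inj_estimate (2 * n) (tshift n s) (Suc (Suc c)) (tmap n n g D) d'" if kpos: "k > 0"
  proof -
    obtain k' where k': "k = Suc k'" using kpos gr0_implies_Suc by blast
    have "2 * n \<ge> 1" using n by simp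
    then obtain D' where "is_sc1 (2 * n) (tshift n s) (tmap n n g D) D'"
      by (rule sck_Suc_D[OF Tg[unfolded k']])
    then show ?thesis unfolding d'_def by (rule inj_estimate_tmap[OF C1 sol inj])
  qed
  have "sck k const_lev const_norm (2 * n) (tshift n s) L N (2 * n) (tshift n s)
      (X (Suc (Suc c) + k) (2 * n) (tshift n s)) d'"
    by (rule Suc.IH[OF Tg _ inj']) (simp add: d'_def tmap_tangent_solution[OF C1 sol inj])
  moreover have "tdom const_lev n s (X (c + Suc k) n s) = X (Suc (Suc c) + k) (2 * n) (tshift n s)"
    using tdom_base_dom[OF n, of const_lev s G "c + Suc k"] by simp
  moreover have "sc0_map const_lev const_norm n s L N n s (X (c + Suc k) n s) d"
  proof (rule sc0_map_mono)
    show "sc0_map const_lev const_norm n s L N n s (X c n s) d" using sol by (simp add: solution_def)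
    show "X (c + Suc k) n s m \<subseteq> X c n s m" for m
    proof
      fix x assume "x \<in> X (c + Suc k) n s m"
      then have "x \<in> X c n s (m + Suc k)" unfolding X_shift .
      then show "x \<in> X c n s m" by (rule X_mono[rotated]) simp
    qed
  qed
  moreover have "sc_deriv const_lev const_norm n s L N n s (X (c + Suc k) n s) d (tangent n s D d)"
  proof (rule sc_deriv_mono[OF tangent_sc_deriv[OF C1 sol inj]])
    show "X (c + Suc k) n s m \<subseteq> X (Suc c) n s m" for m
    proof
      fix x assume "x \<in> X (c + Suc k) n s m"
      then have "x \<in> X (Suc c + k) n s m" by simp
      then have "x \<in> X (Suc c) n s (m + k)" unfolding X_shift .
      then show "x \<in> X (Suc c) n s m" by (rule X_mono[rotated]) simp
    qed
  qed
  ultimately show ?case unfolding d'_def by auto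
qed

end

section \<open>Solution germs of contraction germs\<close>

lemma partial_quadrant_cone:
  assumes "partial_quadrant V"
  shows "a \<in> V \<Longrightarrow> b \<in> V \<Longrightarrow> a + b \<in> V"
    and "a \<in> V \<Longrightarrow> c \<ge> 0 \<Longrightarrow> c *\<^sub>R a \<in> V"
    and "\<exists>a\<in>V. \<exists>b\<in>V. v = a - b"
proof -
  obtain T :: "'a \<Rightarrow> 'a" and B where T: "linear T" "bij T" and B: "B \<subseteq> Basis"
    and V: "V = T ` {x. \<forall>b\<in>B. 0 \<le> x \<bullet> b}"
    using assms unfolding partial_quadrant_def by blast
  let ?Q = "{x. \<forall>b\<in>B. 0 \<le> x \<bullet> b}"
  show "a + b \<in> V" if "a \<in> V" "b \<in> V"
  proof -
    obtain x y where "a = T x" "b = T y" "x \<in> ?Q" "y \<in> ?Q" using \<open>a \<in> V\<close> \<open>b \<in> V\<close> unfolding V by blast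
    then have "a + b = T (x + y)" "x + y \<in> ?Q" by (auto simp: linear_add[OF T(1)] inner_add_left)
    then show ?thesis unfolding V by blast
  qed
  show "c *\<^sub>R a \<in> V" if "a \<in> V" "c \<ge> 0"
  proof -
    obtain x where "a = T x" "x \<in> ?Q" using \<open>a \<in> V\<close> unfolding V by blast
    then have "c *\<^sub>R a = T (c *\<^sub>R x)" "c *\<^sub>R x \<in> ?Q" using \<open>c \<ge> 0\<close> by (auto simp: linear_scale[OF T(1)])
    then show ?thesis unfolding V by blast
  qed
  obtain x where x: "v = T x" using T(2) by (metis bij_pointE)
  \<comment> \<open>Positive and negative part of the preimage under \<open>T\<close>; both have
    nonnegative coordinates and thus lie in \<open>?Q\<close>, whatever \<open>B\<close> is.\<close>
  define p where "p = (\<Sum>b\<in>Basis. max 0 (x \<bullet> b) *\<^sub>R b)"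
  define q where "q = (\<Sum>b\<in>Basis. max 0 (- (x \<bullet> b)) *\<^sub>R b)"
  have "x = p - q"
  proof (rule euclidean_eqI)
    fix b :: 'a assume "b \<in> Basis"
    then show "x \<bullet> b = (p - q) \<bullet> b"
      by (auto simp: p_def q_def inner_diff_left max_def)
  qed
  then have "v = T p - T q" using x linear_diff[OF T(1)] by simp
  moreover have "p \<in> ?Q" "q \<in> ?Q" using B by (auto simp: p_def q_def subset_iff)
  ultimately show "\<exists>a\<in>V. \<exists>b\<in>V. v = a - b" unfolding V by blast
qed

lemma germ_nbhd_zero: "germ_nbhd La Na C G \<Longrightarrow> 0 \<in> G m"
  and germ_nbhd_subset: "germ_nbhd La Na C G \<Longrightarrow> G m \<subseteq> C \<inter> La m"
  and germ_nbhd_Suc: "germ_nbhd La Na C G \<Longrightarrow> G (Suc m) \<subseteq> G m"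
  unfolding germ_nbhd_def by blast+

lemma germ_nbhdI:
  assumes "\<And>m. G (Suc m) \<subseteq> G m" "\<And>m. 0 \<in> G m" "\<And>m. G m \<subseteq> C \<inter> La m"
    and "\<And>m x. x \<in> G m \<Longrightarrow> \<exists>r>0. \<forall>y\<in>C \<inter> La m. Na m (y - x) < r \<longrightarrow> y \<in> G m"
  shows "germ_nbhd La Na C G"
  unfolding germ_nbhd_def using assms by (intro conjI allI ballI) auto

text \<open>Imposing the bounds of all levels \<open>j \<le> m\<close>, not of level
  \<open>m\<close> alone, makes the sets decrease. They stay open because these are finitely many
  conditions, each continuous at level \<open>m\<close> by the bounded inclusions.\<close>

lemma (in normed_scale) germ_nbhd_restrict_balls:
  assumes G: "germ_nbhd La Na C G" and \<rho>: "\<And>m. \<rho> m > 0"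
  shows "germ_nbhd La Na C (\<lambda>m. {x \<in> G m. \<forall>j\<le>m. Na j x < \<rho> j})"
proof (rule germ_nbhdI)
  fix m
  show "{x \<in> G (Suc m). \<forall>j\<le>Suc m. Na j x < \<rho> j} \<subseteq> {x \<in> G m. \<forall>j\<le>m. Na j x < \<rho> j}"
    using germ_nbhd_Suc[OF G] by auto
  show "0 \<in> {x \<in> G m. \<forall>j\<le>m. Na j x < \<rho> j}" using germ_nbhd_zero[OF G] \<rho> by simp
  show "{x \<in> G m. \<forall>j\<le>m. Na j x < \<rho> j} \<subseteq> C \<inter> La m" using germ_nbhd_subset[OF G] by blast
  fix x assume x: "x \<in> {x \<in> G m. \<forall>j\<le>m. Na j x < \<rho> j}"
  then have xL: "x \<in> La m" using germ_nbhd_subset[OF G] by blast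
  have "\<exists>r>0. \<forall>y\<in>La m. Na m (y - x) < r \<longrightarrow> (\<forall>j<k. Na j y < \<rho> j)" if "k \<le> Suc m" for k
    using that
  proof (induction k)
    case 0
    then show ?case by (intro exI[of _ 1]) simp
  next
    case (Suc k)
    then obtain r where r: "r > 0" "\<And>y j. y \<in> La m \<Longrightarrow> Na m (y - x) < r \<Longrightarrow> j < k \<Longrightarrow> Na j y < \<rho> j"
      by auto
    obtain A where A: "A > 0" "\<And>y. y \<in> La m \<Longrightarrow> Na k y \<le> A * Na m y"
      using N_embed[of k m] Suc.prems by auto
    have xk: "Na k x < \<rho> k" using x Suc.prems by simp
    have "Na k y < \<rho> k" if y: "y \<in> La m" "Na m (y - x) < (\<rho> k - Na k x) / A" for y
    proof -
      have yx: "y - x \<in> La m" by (rule lev_diff[OF y(1) xL])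
      have "Na k (y - x) \<le> A * Na m (y - x)" by (rule A(2)[OF yx])
      also have "\<dots> < \<rho> k - Na k x" using y(2) A(1) by (simp add: pos_less_divide_eq mult.commute)
      finally have "Na k (y - x) + Na k x < \<rho> k" by simp
      moreover have "y - x \<in> La k" "x \<in> La k" using yx xL lev_mono[of k m] Suc.prems by auto
      ultimately show ?thesis using N_triangle[of "y - x" k x] by simp
    qed
    moreover have "(\<rho> k - Na k x) / A > 0" using xk A(1) by simp
    ultimately show ?case using r
      by (intro exI[of _ "min r ((\<rho> k - Na k x) / A)"]) (auto simp: less_Suc_eq)
  qed
  from this[of "Suc m"] obtain r1 where r1: "r1 > 0"
    "\<And>y j. y \<in> La m \<Longrightarrow> Na m (y - x) < r1 \<Longrightarrow> j \<le> m \<Longrightarrow> Na j y < \<rho> j"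
    by (auto simp: less_Suc_eq_le)
  obtain r2 where r2: "r2 > 0" "\<And>y. y \<in> C \<inter> La m \<Longrightarrow> Na m (y - x) < r2 \<Longrightarrow> y \<in> G m"
    using germ_nbhd_open[OF G, of x m] x by auto
  show "\<exists>r>0. \<forall>y\<in>C \<inter> La m. Na m (y - x) < r \<longrightarrow> y \<in> {x \<in> G m. \<forall>j\<le>m. Na j x < \<rho> j}"
    using r1 r2 by (intro exI[of _ "min r1 r2"]) auto
qed

text \<open>Nearness in the constant structure is the same at every level, so a shifted sequence is
  again a germ of neighbourhoods. This is how the offset accumulated by the induction is absorbed at
  the end.\<close>

lemma germ_nbhd_const_shift:
  assumes "germ_nbhd const_lev const_norm V G"
  shows "germ_nbhd const_lev const_norm V (\<lambda>m. G (m + k))"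
proof (rule germ_nbhdI)
  fix m x assume "x \<in> G (m + k)"
  then show "\<exists>r>0. \<forall>y\<in>V \<inter> const_lev m. const_norm m (y - x) < r \<longrightarrow> y \<in> G (m + k)"
    using germ_nbhd_open[OF assms, of x "m + k"] unfolding const_lev_def const_norm_def by blast
qed (use germ_nbhd_zero[OF assms] germ_nbhd_subset[OF assms] germ_nbhd_Suc[OF assms]
    in \<open>auto simp: const_lev_def\<close>)

lemma sc0_germ_level:
  assumes "sc0_germ La Na C Lb Nb U f" "x \<in> U m"
  shows "f x \<in> Lb m"
    and "e > 0 \<Longrightarrow> \<exists>\<delta>>0. \<forall>y\<in>U m. Na m (y - x) < \<delta> \<longrightarrow> Nb m (f y - f x) < e"
proof -
  define l where "l y = (\<lambda>i::nat. if i = 0 then y else 0)" for y :: 'a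
  have l: "l y \<in> lift_dom U m" if "y \<in> U m" for y using that by (simp add: l_def lift_dom_def)
  have sc: "sc0_map La Na 1 (\<lambda>_. 0) Lb Nb 1 (\<lambda>_. 0) (lift_dom U) (lift_map f)"
    using assms(1) by (simp add: sc0_germ_def sc_k_on_def)
  have "lift_map f (l x) \<in> tlev Lb 1 (\<lambda>_. 0) m"
    using sc l[OF assms(2)] unfolding sc0_map_def by blast
  then show "f x \<in> Lb m" by (simp add: tlev_def lift_map_def l_def)
  assume "e > 0"
  then obtain \<delta> where \<delta>: "\<delta> > 0" "\<And>y. y \<in> lift_dom U m \<Longrightarrow> tnorm Na 1 (\<lambda>_. 0) m (\<lambda>i. y i - l x i) < \<delta> \<Longrightarrow>
      tnorm Nb 1 (\<lambda>_. 0) m (\<lambda>i. lift_map f y i - lift_map f (l x) i) < e"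
    using sc l[OF assms(2)] unfolding sc0_map_def by meson
  have "Nb m (f y - f x) < e" if "y \<in> U m" "Na m (y - x) < \<delta>" for y
    using \<delta>(2)[OF l[OF that(1)]] that(2) by (simp add: tnorm_def lift_map_def l_def)
  with \<delta>(1) show "\<exists>\<delta>>0. \<forall>y\<in>U m. Na m (y - x) < \<delta> \<longrightarrow> Nb m (f y - f x) < e" by blast
qed

text \<open>Continuity of \<open>\<delta>\<close> at every level makes the preimage of open sets
  under the graph map open, and \<open>\<delta> 0 = 0\<close> keeps 0 inside.\<close>

lemma germ_nbhd_graph_preimage:
  fixes \<delta> :: "'v::euclidean_space \<Rightarrow> 'e::real_vector"
  assumes \<delta>: "sc0_germ const_lev const_norm V L N U\<delta> \<delta>"
    and U: "germ_nbhd (sum_lev L) (sum_norm N) (V \<times> UNIV) U"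
  shows "germ_nbhd const_lev const_norm V (\<lambda>m. {v \<in> U\<delta> m. (v, \<delta> v) \<in> U m})"
proof (rule germ_nbhdI)
  have G: "germ_nbhd const_lev const_norm V U\<delta>" and z: "\<delta> 0 = 0"
    using \<delta> by (simp_all add: sc0_germ_def)
  fix m
  show "{v \<in> U\<delta> (Suc m). (v, \<delta> v) \<in> U (Suc m)} \<subseteq> {v \<in> U\<delta> m. (v, \<delta> v) \<in> U m}"
    using germ_nbhd_Suc[OF G] germ_nbhd_Suc[OF U] by blast
  show "0 \<in> {v \<in> U\<delta> m. (v, \<delta> v) \<in> U m}"
    using germ_nbhd_zero[OF G] germ_nbhd_zero[OF U] z by (simp add: zero_prod_def)
  show "{v \<in> U\<delta> m. (v, \<delta> v) \<in> U m} \<subseteq> V \<inter> const_lev m" using germ_nbhd_subset[OF G] by blast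
  fix x assume x: "x \<in> {v \<in> U\<delta> m. (v, \<delta> v) \<in> U m}"
  then have x': "x \<in> U\<delta> m" "(x, \<delta> x) \<in> U m" by auto
  obtain r1 where r1: "r1 > 0" "\<And>y. y \<in> V \<inter> const_lev m \<Longrightarrow> const_norm m (y - x) < r1 \<Longrightarrow> y \<in> U\<delta> m"
    using germ_nbhd_open[OF G x'(1)] by blast
  obtain r2 where r2: "r2 > 0" "\<And>y. y \<in> (V \<times> UNIV) \<inter> sum_lev L m \<Longrightarrow>
      sum_norm N m (y - (x, \<delta> x)) < r2 \<Longrightarrow> y \<in> U m"
    using germ_nbhd_open[OF U x'(2)] by blast
  obtain r3 where r3: "r3 > 0" "\<And>y. y \<in> U\<delta> m \<Longrightarrow> const_norm m (y - x) < r3 \<Longrightarrow> N m (\<delta> y - \<delta> x) < r2 / 2"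
    using sc0_germ_level(2)[OF \<delta> x'(1), of "r2 / 2"] r2(1) by auto
  have "y \<in> {v \<in> U\<delta> m. (v, \<delta> v) \<in> U m}"
    if y: "y \<in> V \<inter> const_lev m" "const_norm m (y - x) < min r1 (min (r2 / 2) r3)" for y
  proof -
    have yU: "y \<in> U\<delta> m" using r1(2)[OF y(1)] y(2) by simp
    have "sum_norm N m ((y, \<delta> y) - (x, \<delta> x)) < r2"
      using r3(2)[OF yU] y(2) by (simp add: sum_norm_def const_norm_def)
    then have "(y, \<delta> y) \<in> U m"
      using y(1) sc0_germ_level(1)[OF \<delta> yU] by (intro r2(2)) (auto simp: sum_lev_def)
    with yU show ?thesis by simp
  qed
  then show "\<exists>r>0. \<forall>y\<in>V \<inter> const_lev m. const_norm m (y - x) < r \<longrightarrow> y \<in> {v \<in> U\<delta> m. (v, \<delta> v) \<in> U m}"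
    using r1(1) r2(1) r3(1) by (intro exI[of _ "min r1 (min (r2 / 2) r3)"]) auto
qed

theorem theorem2p7:
  fixes L :: "nat \<Rightarrow> 'e::banach set" and N :: "nat \<Rightarrow> 'e \<Rightarrow> real"
    and V :: "'v::euclidean_space set"
    and U :: "nat \<Rightarrow> ('v \<times> 'e) set" and f :: "'v \<times> 'e \<Rightarrow> 'e"
    and U\<delta> :: "nat \<Rightarrow> 'v set" and \<delta> :: "'v \<Rightarrow> 'e" and k :: nat
  assumes "sc_banach L N"
    and "partial_quadrant V"
    and "sc0_contraction_germ L N V U f"
    and "sck_germ k (sum_lev L) (sum_norm N) (V \<times> UNIV) L N U f"
    and "sc0_germ const_lev const_norm V L N U\<delta> \<delta>"
    and "\<forall>v\<in>U\<delta> 0. (v, \<delta> v) \<in> U 0 \<and> f (v, \<delta> v) = 0"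
  shows "sck_germ k const_lev const_norm V L N U\<delta> \<delta>"
proof -
  interpret sc_space L N by unfold_locales (rule assms(1))
  interpret S: normed_scale "sum_lev L :: nat \<Rightarrow> ('v \<times> 'e) set" "sum_norm N" by (rule normed_scale_sum)
  have U\<delta>: "germ_nbhd const_lev const_norm V U\<delta>" using assms(5) by (simp add: sc0_germ_def)
  obtain U' where U': "germ_nbhd (sum_lev L) (sum_norm N) (V \<times> UNIV) U'" "\<And>m. U' m \<subseteq> U m"
    "sc_k_on k (sum_lev L) (sum_norm N) L N U' f"
    using assms(4) unfolding sck_germ_def by blast
  have "\<exists>r>0. \<forall>v u u'. v \<in> V \<and> u \<in> L m \<and> u' \<in> L m \<and> norm v < r \<and> N m u < r \<and> N m u' < r \<and>
      (v, u) \<in> U m \<and> (v, u') \<in> U m \<longrightarrow>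
      N m ((u - f (v, u)) - (u' - f (v, u'))) \<le> 1 / 2 * N m (u - u')" for m
  proof -
    have "\<forall>m. \<forall>\<epsilon>. 0 < \<epsilon> \<and> \<epsilon> < 1 \<longrightarrow>
        (\<exists>r>0. \<forall>v u u'. v \<in> V \<and> u \<in> L m \<and> u' \<in> L m \<and>
            norm v < r \<and> N m u < r \<and> N m u' < r \<and> (v, u) \<in> U m \<and> (v, u') \<in> U m \<longrightarrow>
            N m ((u - f (v, u)) - (u' - f (v, u'))) \<le> \<epsilon> * N m (u - u'))"
      using assms(3) unfolding sc0_contraction_germ_def by (elim conjE)
    \<comment> \<open>The factor \<open>1 / 2\<close> lets the contraction term be absorbed, which
      leads to the constant 2 in the fibre estimate.\<close>
    from this[rule_format, of "1 / 2" m] show ?thesis by simp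
  qed
  then obtain r where r: "\<And>m. r m > 0" and contr: "\<And>m v u u'. v \<in> V \<Longrightarrow> u \<in> L m \<Longrightarrow> u' \<in> L m \<Longrightarrow>
      norm v < r m \<Longrightarrow> N m u < r m \<Longrightarrow> N m u' < r m \<Longrightarrow> (v, u) \<in> U m \<Longrightarrow> (v, u') \<in> U m \<Longrightarrow>
      N m ((u - f (v, u)) - (u' - f (v, u'))) \<le> 1 / 2 * N m (u - u')"
    by metis
  \<comment> \<open>Shrinks by the contraction radii of all levels up to \<open>m\<close>, so that
    the contraction property holds on the whole of every \<open>W m\<close>.\<close>
  define W where "W m = {z \<in> U' m. \<forall>j\<le>m. sum_norm N j z < r j}" for m
  have W: "germ_nbhd (sum_lev L) (sum_norm N) (V \<times> UNIV) W"
    unfolding W_def by (rule S.germ_nbhd_restrict_balls[OF U'(1) r])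
  have WU': "W m \<subseteq> U' m" for m by (auto simp: W_def)
  define G where "G m = {v \<in> U\<delta> m. (v, \<delta> v) \<in> W m}" for m
  have G: "germ_nbhd const_lev const_norm V G"
    unfolding G_def by (rule germ_nbhd_graph_preimage[OF assms(5) W])
  have GU: "G m \<subseteq> U\<delta> m" for m by (auto simp: G_def)
  interpret sc_implicit L N V W G
    by unfold_locales (use partial_quadrant_cone[OF assms(2)] W G in auto)
  let ?s = "\<lambda>_::nat. 0::nat"
  have \<Omega>: "\<Omega> 1 ?s = lift_dom W"
    by (rule lift_dom_eq_base_dom[symmetric]) (use U_sub in blast)
  have X0: "X 0 1 ?s = lift_dom G"
    by (rule lift_dom_eq_base_dom[symmetric]) (simp add: const_lev_def)
  have Xk: "X k 1 ?s = lift_dom (\<lambda>m. G (m + k))"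
    by (auto simp: base_dom_def lift_dom_def tlev_def const_lev_def fun_eq_iff)
  have "sck k (sum_lev L) (sum_norm N) 1 ?s L N 1 ?s (\<Omega> 1 ?s) (lift_map f)"
    unfolding \<Omega>
    by (rule sck_mono[OF U'(3)[unfolded sc_k_on_def]]) (use WU' in \<open>auto simp: lift_dom_def\<close>)
  moreover have "solution 1 ?s 0 (lift_map f) (lift_map \<delta>)"
    unfolding solution_def
  proof (intro conjI allI ballI)
    show "sc0_map const_lev const_norm 1 ?s L N 1 ?s (X 0 1 ?s) (lift_map \<delta>)"
      unfolding X0
    proof (rule sc0_map_mono)
      show "sc0_map const_lev const_norm 1 ?s L N 1 ?s (lift_dom U\<delta>) (lift_map \<delta>)"
        using assms(5) by (simp add: sc0_germ_def sc_k_on_def)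
    qed (use GU in \<open>auto simp: lift_dom_def\<close>)
    show "(x 0, lift_map \<delta> x 0) \<in> W (m + 0)" if "x \<in> X 0 1 ?s m" for x m
      using that by (simp add: base_dom_def lift_map_def G_def)
    show "lift_map f (fun_zip x (lift_map \<delta> x)) = (\<lambda>i. 0)" if "x \<in> X 0 1 ?s 0" for x
      using that assms(6) by (auto simp: base_dom_def lift_map_def G_def fun_eq_iff)
  qed simp
  moreover have "inj_estimate 1 ?s 0 (lift_map f) (lift_map \<delta>)"
    unfolding inj_estimate_def
  proof (intro allI ballI exI conjI impI)
    fix m x y y'
    assume "fun_zip x y \<in> \<Omega> 1 ?s (Suc m)" "fun_zip x y' \<in> \<Omega> 1 ?s (Suc m)"
    then have xy: "(x 0, y 0) \<in> W m" "(x 0, y' 0) \<in> W m"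
      using U_Suc[of m] by (auto simp: base_dom_def)
    have mem: "x 0 \<in> V" "y 0 \<in> L m" "y' 0 \<in> L m"
      using xy U_sub[of m] by (auto simp: sum_lev_def)
    have n: "norm (x 0) + N m (y 0) < r m" "norm (x 0) + N m (y' 0) < r m"
      using xy by (auto simp: W_def sum_norm_def)
    have pos: "0 \<le> norm (x 0)" "0 \<le> N m (y 0)" "0 \<le> N m (y' 0)" using mem N_nonneg by auto
    have small: "norm (x 0) < r m" "N m (y 0) < r m" "N m (y' 0) < r m" using n pos by linarith+
    define a where "a = y 0 - y' 0"
    define b where "b = f (x 0, y 0) - f (x 0, y' 0)"
    have xyU: "(x 0, y 0) \<in> U' m" "(x 0, y' 0) \<in> U' m" using xy WU' by auto
    have le: "N m ((y 0 - f (x 0, y 0)) - (y' 0 - f (x 0, y' 0))) \<le> 1 / 2 * N m a"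
      unfolding a_def
      by (rule contr[OF mem small]) (use xyU U'(2)[of m] in auto)
    have "sc0_germ (sum_lev L) (sum_norm N) (V \<times> UNIV) L N U f"
      using assms(3) unfolding sc0_contraction_germ_def by blast
    then have fU: "f z \<in> L m" if "z \<in> U' m" for z
      using sc0_germ_level(1) that U'(2)[of m] by blast
    have a: "a \<in> L m" and b: "b \<in> L m"
      unfolding a_def b_def by (intro lev_diff mem fU xyU)+
    have "N m a \<le> N m (a - b) + N m b" using N_triangle[OF lev_diff[OF a b] b] by simp
    moreover have "a - b = (y 0 - f (x 0, y 0)) - (y' 0 - f (x 0, y' 0))" by (simp add: a_def b_def)
    \<comment> \<open>Here \<open>a = (a - b) + b\<close>, and \<open>a - b\<close> is the
      difference of the contraction part, of norm at most half that of \<open>a\<close>.\<close>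
    ultimately have "N m a \<le> 2 * N m b" using le by simp
    then show "NE 1 ?s m (\<lambda>i. y i - y' i)
        \<le> 2 * NE 1 ?s m (\<lambda>i. lift_map f (fun_zip x y) i - lift_map f (fun_zip x y') i)"
      by (simp add: tnorm_def lift_map_def a_def b_def)
  \<comment> \<open>Smallness is already built into \<open>W m\<close>, so the radius 1 is an
    arbitrary choice.\<close>
  qed (rule zero_less_one, simp)
  ultimately have "sck k const_lev const_norm 1 ?s L N 1 ?s (X (0 + k) 1 ?s) (lift_map \<delta>)"
    by (intro solution_sck)
  then have "sc_k_on k const_lev const_norm L N (\<lambda>m. G (m + k)) \<delta>"
    unfolding sc_k_on_def Xk[symmetric] by simp
  moreover have "G (m + k) \<subseteq> U\<delta> m" for m
  proof -
    have "G (m + k) \<subseteq> G m" by (rule lift_Suc_antimono_le[of G]) (use G_Suc in auto)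
    with GU show ?thesis by blast
  qed
  ultimately show ?thesis
    unfolding sck_germ_def using assms(5) germ_nbhd_const_shift[OF G] by blast
qed

end
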